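(* Let $K$ be an algebraically closed field of characteristic zero and let $H$ be a finite dimensional semisimple Hopf algebra over $K$. If all the basic invariants of $H$ are algebraic integers, then $H$ satisfies Kaplansky's Sixth Conjecture: the dimension of every irreducible representation of $H$ and of $H^*$ divides the dimension of $H$.
   Context: Let $\ell\in H$, $\lambda\in H^*$ be the integrals with $\epsilon(\ell)=\lambda(1)=\dim(H)$ (the characters of the regular representations of $H^*$ and $H$). A basic invariant of $H$ is a scalar in $K$ obtained from $\lambda^{\otimes a}\otimes\ell^{\otimes b}$ ($a,b\ge0$) by repeatedly applying the comultiplications of $H$ and of $H^*$ to tensor factors, permuting the tensor factors of $H$ among themselves and those of $H^*$ among themselves, and pairing factors of $H$ with factors of $H^*$ by evaluation, until a scalar remains. *)

theory Defs
  imports Complex_Main "HOL-Library.Function_Algebras"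
    "HOL-Computational_Algebra.Polynomial" "HOL-Combinatorics.Permutations"
begin

section \<open>Tensors\<close>

abbreviation functional :: "('k::field \<Rightarrow> 'h::ab_group_add \<Rightarrow> 'h) \<Rightarrow> ('h \<Rightarrow> 'k) \<Rightarrow> bool"
  where "functional scale \<equiv> Vector_Spaces.linear scale (*)"

abbreviation dual_space :: "('k::field \<Rightarrow> 'h::ab_group_add \<Rightarrow> 'h) \<Rightarrow> ('h \<Rightarrow> 'k) set"
  where "dual_space scale \<equiv> {\<phi>. functional scale \<phi>}"

definition bilinear_form :: "('k::field \<Rightarrow> 'h::ab_group_add \<Rightarrow> 'h) \<Rightarrow> ('h \<Rightarrow> 'h \<Rightarrow> 'k) \<Rightarrow> bool" where
  "bilinear_form scale F \<longleftrightarrow>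
     (\<forall>x. functional scale (F x)) \<and> (\<forall>y. functional scale (\<lambda>x. F x y))"

definition trilinear_form :: "('k::field \<Rightarrow> 'h::ab_group_add \<Rightarrow> 'h) \<Rightarrow> ('h \<Rightarrow> 'h \<Rightarrow> 'h \<Rightarrow> 'k) \<Rightarrow> bool" where
  "trilinear_form scale F \<longleftrightarrow>
     (\<forall>x y. functional scale (F x y)) \<and> (\<forall>x z. functional scale (\<lambda>y. F x y z)) \<and>
     (\<forall>y z. functional scale (\<lambda>x. F x y z))"

text \<open>
  A list of pairs \<open>[(x\<^sub>1, y\<^sub>1), \<dots>, (x\<^sub>r, y\<^sub>r)]\<close> denotes the element
  \<open>x\<^sub>1 \<otimes> y\<^sub>1 + \<dots> + x\<^sub>r \<otimes> y\<^sub>r\<close> of \<open>H \<otimes> H\<close>, and similarly for triples.  By the universal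
  property of the tensor product over a field, two such lists denote the same element if
  and only if every multilinear form takes the same value on them.
\<close>

definition tensor2_eq ::
  "('k::field \<Rightarrow> 'h::ab_group_add \<Rightarrow> 'h) \<Rightarrow> ('h \<times> 'h) list \<Rightarrow> ('h \<times> 'h) list \<Rightarrow> bool" where
  "tensor2_eq scale t u \<longleftrightarrow>
     (\<forall>F. bilinear_form scale F \<longrightarrow> (\<Sum>(x, y)\<leftarrow>t. F x y) = (\<Sum>(x, y)\<leftarrow>u. F x y))"

definition tensor3_eq ::
  "('k::field \<Rightarrow> 'h::ab_group_add \<Rightarrow> 'h) \<Rightarrow> ('h \<times> 'h \<times> 'h) list \<Rightarrow> ('h \<times> 'h \<times> 'h) list \<Rightarrow> bool" where
  "tensor3_eq scale t u \<longleftrightarrow>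
     (\<forall>F. trilinear_form scale F \<longrightarrow>
        (\<Sum>(x, y, z)\<leftarrow>t. F x y z) = (\<Sum>(x, y, z)\<leftarrow>u. F x y z))"


section \<open>Hopf algebras\<close>

text \<open>
  The list \<open>\<Delta> h\<close> is a Sweedler expression \<open>\<Sum> h\<^sub>(\<^sub>1\<^sub>) \<otimes> h\<^sub>(\<^sub>2\<^sub>)\<close> for the coproduct of \<open>h\<close>.  All
  axioms on \<open>\<Delta>\<close> are equations between tensors, so the choice of the expression is immaterial.
\<close>

locale hopf_algebra = vector_space scale
  for scale :: "'k::field \<Rightarrow> 'h::ring_1 \<Rightarrow> 'h" +
  fixes \<Delta> :: "'h \<Rightarrow> ('h \<times> 'h) list"
    and \<epsilon> :: "'h \<Rightarrow> 'k"
    and S :: "'h \<Rightarrow> 'h"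
  assumes scale_mult_left: "scale c x * y = scale c (x * y)"
    and scale_mult_right: "x * scale c y = scale c (x * y)"
    and comult_add: "tensor2_eq scale (\<Delta> (x + y)) (\<Delta> x @ \<Delta> y)"
    and comult_scale: "tensor2_eq scale (\<Delta> (scale c x)) [(scale c a, b). (a, b) \<leftarrow> \<Delta> x]"
    and coassoc: "tensor3_eq scale
          [(a1, a2, b). (a, b) \<leftarrow> \<Delta> x, (a1, a2) \<leftarrow> \<Delta> a]
          [(a, b1, b2). (a, b) \<leftarrow> \<Delta> x, (b1, b2) \<leftarrow> \<Delta> b]"
    and counit_linear: "functional scale \<epsilon>"
    and counit_left: "(\<Sum>(a, b)\<leftarrow>\<Delta> x. scale (\<epsilon> a) b) = x"
    and counit_right: "(\<Sum>(a, b)\<leftarrow>\<Delta> x. scale (\<epsilon> b) a) = x"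
    and comult_mult: "tensor2_eq scale (\<Delta> (x * y))
          [(a * c, b * d). (a, b) \<leftarrow> \<Delta> x, (c, d) \<leftarrow> \<Delta> y]"
    and comult_one: "tensor2_eq scale (\<Delta> 1) [(1, 1)]"
    and counit_mult: "\<epsilon> (x * y) = \<epsilon> x * \<epsilon> y"
    and counit_one: "\<epsilon> 1 = 1"
    and antipode_linear: "Vector_Spaces.linear scale scale S"
    and antipode_left: "(\<Sum>(a, b)\<leftarrow>\<Delta> x. S a * b) = scale (\<epsilon> x) 1"
    and antipode_right: "(\<Sum>(a, b)\<leftarrow>\<Delta> x. a * S b) = scale (\<epsilon> x) 1"

definition finite_dim :: "('k::field \<Rightarrow> 'h::ab_group_add \<Rightarrow> 'h) \<Rightarrow> bool" where
  "finite_dim scale \<longleftrightarrow> (\<exists>B. finite B \<and> module.span scale B = UNIV)"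

definition left_ideal :: "('k::field \<Rightarrow> 'h::ring_1 \<Rightarrow> 'h) \<Rightarrow> 'h set \<Rightarrow> bool" where
  "left_ideal scale I \<longleftrightarrow> module.subspace scale I \<and> (\<forall>a. \<forall>x\<in>I. a * x \<in> I)"

text \<open>An algebra is semisimple if its left regular module is completely reducible.\<close>

definition semisimple_algebra :: "('k::field \<Rightarrow> 'h::ring_1 \<Rightarrow> 'h) \<Rightarrow> bool" where
  "semisimple_algebra scale \<longleftrightarrow>
     (\<forall>I. left_ideal scale I \<longrightarrow>
        (\<exists>J. left_ideal scale J \<and> I \<inter> J = {0} \<and> (\<forall>x. \<exists>y\<in>I. \<exists>z\<in>J. x = y + z)))"


section \<open>The dual Hopf algebra\<close>

text \<open>
  For finite dimensional \<open>H\<close>, the dual \<open>H\<^sup>*\<close> has product \<open>conv \<Delta>\<close>, unit \<open>\<epsilon>\<close>, coproduct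
  \<open>dual_comult scale\<close> and counit \<open>\<phi> \<mapsto> \<phi> 1\<close>.
\<close>

definition conv :: "('h \<Rightarrow> ('h \<times> 'h) list) \<Rightarrow> ('h \<Rightarrow> 'k::field) \<Rightarrow> ('h \<Rightarrow> 'k) \<Rightarrow> 'h \<Rightarrow> 'k" where
  "conv \<Delta> \<phi> \<psi> x = (\<Sum>(a, b)\<leftarrow>\<Delta> x. \<phi> a * \<psi> b)"

definition dual_scale :: "'k::field \<Rightarrow> ('h \<Rightarrow> 'k) \<Rightarrow> 'h \<Rightarrow> 'k" where
  "dual_scale c \<phi> = (\<lambda>x. c * \<phi> x)"

text \<open>
  A Sweedler expression \<open>\<Sum> \<phi>\<^sub>(\<^sub>1\<^sub>) \<otimes> \<phi>\<^sub>(\<^sub>2\<^sub>)\<close> in \<open>H\<^sup>* \<otimes> H\<^sup>*\<close> for the coproduct of the functional \<open>\<phi>\<close>.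
  It exists because \<open>H\<close> is finite dimensional, and any two choices are the same tensor.
\<close>

definition dual_comult ::
  "('k::field \<Rightarrow> 'h::ring_1 \<Rightarrow> 'h) \<Rightarrow> ('h \<Rightarrow> 'k) \<Rightarrow> (('h \<Rightarrow> 'k) \<times> ('h \<Rightarrow> 'k)) list" where
  "dual_comult scale \<phi> = (SOME t.
     (\<forall>(\<alpha>, \<beta>) \<in> set t. functional scale \<alpha> \<and> functional scale \<beta>) \<and>
     (\<forall>x y. \<phi> (x * y) = (\<Sum>(\<alpha>, \<beta>)\<leftarrow>t. \<alpha> x * \<beta> y)))"


section \<open>Basic invariants\<close>

definition integral_in :: "('k::field \<Rightarrow> 'h::ring_1 \<Rightarrow> 'h) \<Rightarrow> ('h \<Rightarrow> 'k) \<Rightarrow> 'h \<Rightarrow> bool" where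
  "integral_in scale \<epsilon> l \<longleftrightarrow> (\<forall>x. x * l = scale (\<epsilon> x) l \<and> l * x = scale (\<epsilon> x) l)"

definition integral_on ::
  "('k::field \<Rightarrow> 'h::ring_1 \<Rightarrow> 'h) \<Rightarrow> ('h \<Rightarrow> ('h \<times> 'h) list) \<Rightarrow> ('h \<Rightarrow> 'k) \<Rightarrow> bool" where
  "integral_on scale \<Delta> lam \<longleftrightarrow> functional scale lam \<and>
     (\<forall>\<phi>. functional scale \<phi> \<longrightarrow>
        conv \<Delta> \<phi> lam = dual_scale (\<phi> 1) lam \<and> conv \<Delta> lam \<phi> = dual_scale (\<phi> 1) lam)"

text \<open>
  A summand \<open>(c, [\<phi>\<^sub>1, \<dots>, \<phi>\<^sub>p], [x\<^sub>1, \<dots>, x\<^sub>q])\<close> stands for the tensor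
  \<open>c \<phi>\<^sub>1 \<otimes> \<dots> \<otimes> \<phi>\<^sub>p \<otimes> x\<^sub>1 \<otimes> \<dots> \<otimes> x\<^sub>q\<close> in \<open>(H\<^sup>*)\<^sup>\<otimes>\<^sup>p \<otimes> H\<^sup>\<otimes>\<^sup>q\<close>, and a list of summands for their sum.
  Tensor factors are numbered from 0.
\<close>

type_synonym ('k, 'h) summand = "'k \<times> ('h \<Rightarrow> 'k) list \<times> 'h list"

fun comult_at :: "('h \<Rightarrow> ('h \<times> 'h) list) \<Rightarrow> nat \<Rightarrow> ('k, 'h) summand \<Rightarrow> ('k, 'h) summand list" where
  "comult_at \<Delta> j (c, \<phi>s, xs) =
     [(c, \<phi>s, take j xs @ [a, b] @ drop (Suc j) xs). (a, b) \<leftarrow> \<Delta> (xs ! j)]"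

fun dual_comult_at ::
  "('k::field \<Rightarrow> 'h::ring_1 \<Rightarrow> 'h) \<Rightarrow> nat \<Rightarrow> ('k, 'h) summand \<Rightarrow> ('k, 'h) summand list" where
  "dual_comult_at scale i (c, \<phi>s, xs) =
     [(c, take i \<phi>s @ [\<alpha>, \<beta>] @ drop (Suc i) \<phi>s, xs). (\<alpha>, \<beta>) \<leftarrow> dual_comult scale (\<phi>s ! i)]"

fun permute_factors ::
  "(nat \<Rightarrow> nat) \<Rightarrow> (nat \<Rightarrow> nat) \<Rightarrow> ('k, 'h) summand \<Rightarrow> ('k, 'h) summand" where
  "permute_factors \<sigma> \<pi> (c, \<phi>s, xs) = (c, permute_list \<sigma> \<phi>s, permute_list \<pi> xs)"

fun pair_at :: "nat \<Rightarrow> nat \<Rightarrow> ('k::field, 'h) summand \<Rightarrow> ('k, 'h) summand" where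
  "pair_at i j (c, \<phi>s, xs) =
     (c * (\<phi>s ! i) (xs ! j), take i \<phi>s @ drop (Suc i) \<phi>s, take j xs @ drop (Suc j) xs)"

text \<open>
  \<open>obtainable scale \<Delta> l lam p q t\<close>: the tensor \<open>t\<close> in \<open>(H\<^sup>*)\<^sup>\<otimes>\<^sup>p \<otimes> H\<^sup>\<otimes>\<^sup>q\<close> is obtained from
  some \<open>lam\<^sup>\<otimes>\<^sup>a \<otimes> l\<^sup>\<otimes>\<^sup>b\<close> by the allowed operations.
\<close>

inductive obtainable ::
  "('k::field \<Rightarrow> 'h::ring_1 \<Rightarrow> 'h) \<Rightarrow> ('h \<Rightarrow> ('h \<times> 'h) list) \<Rightarrow> 'h \<Rightarrow> ('h \<Rightarrow> 'k) \<Rightarrow>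
   nat \<Rightarrow> nat \<Rightarrow> ('k, 'h) summand list \<Rightarrow> bool"
  for scale \<Delta> l lam
where
  start: "obtainable scale \<Delta> l lam a b [(1, replicate a lam, replicate b l)]"
| comult: "\<lbrakk>obtainable scale \<Delta> l lam p q t; j < q\<rbrakk> \<Longrightarrow>
    obtainable scale \<Delta> l lam p (Suc q) (concat (map (comult_at \<Delta> j) t))"
| dual_comult: "\<lbrakk>obtainable scale \<Delta> l lam p q t; i < p\<rbrakk> \<Longrightarrow>
    obtainable scale \<Delta> l lam (Suc p) q (concat (map (dual_comult_at scale i) t))"
| permute: "\<lbrakk>obtainable scale \<Delta> l lam p q t; \<sigma> permutes {..<p}; \<pi> permutes {..<q}\<rbrakk> \<Longrightarrow>
    obtainable scale \<Delta> l lam p q (map (permute_factors \<sigma> \<pi>) t)"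
| pair: "\<lbrakk>obtainable scale \<Delta> l lam (Suc p) (Suc q) t; i \<le> p; j \<le> q\<rbrakk> \<Longrightarrow>
    obtainable scale \<Delta> l lam p q (map (pair_at i j) t)"

text \<open>
  For \<open>H\<close> semisimple over a field of characteristic zero, \<open>l\<close> and \<open>lam\<close> as below exist and are unique.
\<close>

definition basic_invariant ::
  "('k::field \<Rightarrow> 'h::ring_1 \<Rightarrow> 'h) \<Rightarrow> ('h \<Rightarrow> ('h \<times> 'h) list) \<Rightarrow> ('h \<Rightarrow> 'k) \<Rightarrow> 'k \<Rightarrow> bool" where
  "basic_invariant scale \<Delta> \<epsilon> r \<longleftrightarrow> (\<exists>l lam t.
     integral_in scale \<epsilon> l \<and> \<epsilon> l = of_nat (vector_space.dim scale UNIV) \<and>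
     integral_on scale \<Delta> lam \<and> lam 1 = of_nat (vector_space.dim scale UNIV) \<and>
     obtainable scale \<Delta> l lam 0 0 t \<and> r = (\<Sum>(c, _, _)\<leftarrow>t. c))"


section \<open>Representations\<close>

text \<open>
  Representations on \<open>'v\<close> of the algebra with carrier \<open>A\<close>, scalar multiplication \<open>sa\<close>,
  product \<open>m\<close> and unit \<open>u\<close>.  The carrier is needed since \<open>H\<^sup>*\<close> is not a full type.
\<close>

definition representation_of ::
  "'a::ab_group_add set \<Rightarrow> ('k::field \<Rightarrow> 'a \<Rightarrow> 'a) \<Rightarrow> ('a \<Rightarrow> 'a \<Rightarrow> 'a) \<Rightarrow> 'a \<Rightarrow>
   ('k \<Rightarrow> 'v::ab_group_add \<Rightarrow> 'v) \<Rightarrow> ('a \<Rightarrow> 'v \<Rightarrow> 'v) \<Rightarrow> bool" where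
  "representation_of A sa m u sv \<rho> \<longleftrightarrow>
     vector_space sv \<and>
     (\<forall>a\<in>A. Vector_Spaces.linear sv sv (\<rho> a)) \<and>
     (\<forall>a\<in>A. \<forall>b\<in>A. \<forall>v. \<rho> (a + b) v = \<rho> a v + \<rho> b v) \<and>
     (\<forall>c. \<forall>a\<in>A. \<forall>v. \<rho> (sa c a) v = sv c (\<rho> a v)) \<and>
     (\<forall>a\<in>A. \<forall>b\<in>A. \<forall>v. \<rho> (m a b) v = \<rho> a (\<rho> b v)) \<and>
     (\<forall>v. \<rho> u v = v)"

definition irreducible_representation ::
  "'a::ab_group_add set \<Rightarrow> ('k::field \<Rightarrow> 'a \<Rightarrow> 'a) \<Rightarrow> ('a \<Rightarrow> 'a \<Rightarrow> 'a) \<Rightarrow> 'a \<Rightarrow>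
   ('k \<Rightarrow> 'v::ab_group_add \<Rightarrow> 'v) \<Rightarrow> ('a \<Rightarrow> 'v \<Rightarrow> 'v) \<Rightarrow> bool" where
  "irreducible_representation A sa m u sv \<rho> \<longleftrightarrow>
     representation_of A sa m u sv \<rho> \<and> (\<exists>v::'v. v \<noteq> 0) \<and>
     (\<forall>W. module.subspace sv W \<and> (\<forall>a\<in>A. \<forall>w\<in>W. \<rho> a w \<in> W) \<longrightarrow> W = {0} \<or> W = UNIV)"

end

theory Submission
  imports Defs
begin

text \<open>
  Let \<open>H\<close> have dimension \<open>n\<close>.  The proof combines a computation in an algebra with nondegenerate
  trace form, which is then applied to \<open>H\<close> and to \<open>H\<^sup>*\<close>, with the theorem of Larson and Radford that
  the antipode of \<open>H\<close> is an involution.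

  The computation.  Let \<open>\<tau>\<close> be the trace of the regular representation of an algebra \<open>A\<close> and let the
  Casimir tensor \<open>C = \<Sum> a \<otimes> b\<close> be determined by \<open>\<Sum> \<tau>(b x) a = n x\<close>.  On a matrix block of size \<open>d\<close>
  with matrix units \<open>e\<^sub>s\<^sub>t\<close>, \<open>\<tau>\<close> is \<open>d\<close> times the matrix trace, so \<open>C\<close> is \<open>(n/d) \<Sum> e\<^sub>s\<^sub>t \<otimes> e\<^sub>t\<^sub>s\<close> and its
  square in \<open>A \<otimes> A\<close> is the scalar \<open>(n/d)\<^sup>2\<close>.  Hence \<open>(\<tau> \<otimes> \<tau>)(C\<^bsup>2k\<^esup>)\<close> is the sum of \<open>d\<^sup>4 (n/d)\<^bsup>2k\<^esup>\<close>
  over all blocks (\<open>casimir_iter_even\<close>).  If these rational numbers are algebraic integers, they are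
  integers; isolating one block by an integer polynomial that vanishes at the other values of
  \<open>(n/d)\<^sup>2\<close> shows that the powers of \<open>n/d\<close> have bounded denominators, so \<open>d\<close> divides \<open>n\<close>
  (\<open>dvd_of_power_sums_algebraic_int\<close>).  The dimension of an irreducible representation is the size
  of a block (\<open>irreducible_dim\<close>).

  The invariants.  If \<open>S\<^sup>2 = 1\<close>, then the integral \<open>\<lambda>\<close> is the regular character of \<open>H\<close> and the Casimir
  tensor is \<open>\<Sum> \<ell>\<^sub>1 \<otimes> S(\<ell>\<^sub>2)\<close>.  Moving the antipodes to the outside with \<open>\<lambda> \<circ> S = \<lambda>\<close> turns
  \<open>(\<tau> \<otimes> \<tau>)(C\<^sup>r)\<close>, for copies \<open>\<ell>, \<ell>', \<dots>\<close> of the integral, into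
  \<open>\<lambda>(\<ell>\<^sub>1 \<ell>'\<^sub>1 \<dots>) \<lambda>(\<dots> \<ell>'\<^sub>2 \<ell>\<^sub>2)\<close>, which is a basic invariant (\<open>chain_one_basic_invariant\<close>).  For \<open>H\<^sup>*\<close>
  the roles of \<open>\<lambda>\<close> and \<open>\<ell>\<close> are exchanged (\<open>dual_chain_basic_invariant\<close>).

  The antipode.  Semisimplicity gives an integral \<open>\<Lambda>\<close> with \<open>\<epsilon>(\<Lambda>) = 1\<close>, and \<open>\<lambda>\<close> is defined by
  \<open>\<Lambda>\<^sub>1 \<lambda>(\<Lambda>\<^sub>2) = 1\<close>.  From \<open>S(a) = \<Lambda>\<^sub>1 \<lambda>(a \<Lambda>\<^sub>2)\<close> one reads off the standard properties of \<open>S\<close>, the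
  formula \<open>\<lambda>(x) = Tr(L\<^sub>x \<circ> S\<^sup>2)\<close>, and that \<open>S\<^sup>4\<close> is conjugation by a grouplike element \<open>v\<close>, which has
  finite order.  The decisive point is \<open>\<lambda>(1) = Tr(S\<^sup>2) \<noteq> 0\<close> (\<open>lam_one_nonzero\<close>): \<open>S\<^sup>2\<close> is conjugation
  by an element \<open>u\<close> of finite order, so its trace is the sum over the blocks of \<open>tr(u) tr(u\<^bsup>-1\<^esup>)\<close>;
  over the complex numbers these are squared absolute values, and vanishing of a polynomial with
  rational coefficients at a root of unity can be tested in the complex numbers.  It follows that
  \<open>v = 1\<close> and \<open>S\<^sup>4 = 1\<close>.  Finally the regular character \<open>\<chi>\<close> satisfies \<open>\<chi> \<chi> = n \<chi>\<close> in \<open>H\<^sup>*\<close>, and \<open>Tr(S\<^sup>2)\<close>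
  equals \<open>n\<close> times the trace of the involution \<open>S\<^sup>2\<close> on the image of the idempotent \<open>\<chi>/n\<close>.  So the
  nonzero integer \<open>Tr(S\<^sup>2)\<close> is a multiple of \<open>n\<close>, while \<open>S\<^sup>2\<close> has only eigenvalues \<open>1\<close> and \<open>-1\<close>; this
  leaves \<open>S\<^sup>2 = 1\<close> (\<open>antipode_involution\<close>).
\<close>

section \<open>Traces on a finite dimensional space\<close>

locale fdvs = finite_dimensional_vector_space scale Basis
  for scale :: "'k::{alg_closed_field, field_char_0} \<Rightarrow> 'a::ab_group_add \<Rightarrow> 'a" and Basis :: "'a set"
begin

abbreviation lfun :: "('a \<Rightarrow> 'k) \<Rightarrow> bool" where "lfun f \<equiv> functional scale f"
abbreviation lmap :: "('a \<Rightarrow> 'a) \<Rightarrow> bool" where "lmap T \<equiv> Vector_Spaces.linear scale scale T"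

lemma lfun_iff: "lfun f \<longleftrightarrow> (\<forall>x y. f (x + y) = f x + f y) \<and> (\<forall>c x. f (scale c x) = c * f x)"
proof -
  have "vector_space ((*) :: 'k \<Rightarrow> 'k \<Rightarrow> 'k)" by unfold_locales (auto simp: algebra_simps)
  then show ?thesis by (auto simp: Vector_Spaces.linear_iff vector_space_axioms)
qed

lemma lmap_iff: "lmap f \<longleftrightarrow> (\<forall>x y. f (x + y) = f x + f y) \<and> (\<forall>c x. f (scale c x) = scale c (f x))"
  by (auto simp: Vector_Spaces.linear_iff vector_space_axioms)

lemma lfunI: "(\<And>x y. f (x + y) = f x + f y) \<Longrightarrow> (\<And>c x. f (scale c x) = c * f x) \<Longrightarrow> lfun f"
  by (simp add: lfun_iff)
lemma lmapI: "(\<And>x y. f (x + y) = f x + f y) \<Longrightarrow> (\<And>c x. f (scale c x) = scale c (f x)) \<Longrightarrow> lmap f"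
  by (simp add: lmap_iff)
lemma lfun_add: "lfun f \<Longrightarrow> f (x + y) = f x + f y" and lfun_scale: "lfun f \<Longrightarrow> f (scale c x) = c * f x"
  by (simp_all add: lfun_iff)
lemmas lfun_simps = lfun_add lfun_scale
lemma lmap_add: "lmap T \<Longrightarrow> T (x + y) = T x + T y" and lmap_scale: "lmap T \<Longrightarrow> T (scale c x) = scale c (T x)"
  by (simp_all add: lmap_iff)
lemmas lmap_simps = lmap_add lmap_scale
lemma lfun_0: "lfun f \<Longrightarrow> f 0 = 0" using lfun_add[of f 0 0] by simp
lemma lmap_0: "lmap f \<Longrightarrow> f 0 = 0" using lmap_add[of f 0 0] by simp
lemma lfun_diff: "lfun f \<Longrightarrow> f (x - y) = f x - f y" using lfun_add[of f "x - y" y] by simp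
lemma lmap_diff: "lmap f \<Longrightarrow> f (x - y) = f x - f y" using lmap_add[of f "x - y" y] by simp
lemma lfun_sum: "lfun f \<Longrightarrow> f (\<Sum>i\<in>I. g i) = (\<Sum>i\<in>I. f (g i))"
  by (induction I rule: infinite_finite_induct) (simp_all add: lfun_0 lfun_add)
lemma lmap_sum: "lmap f \<Longrightarrow> f (\<Sum>i\<in>I. g i) = (\<Sum>i\<in>I. f (g i))"
  by (induction I rule: infinite_finite_induct) (simp_all add: lmap_0 lmap_add)
lemma lfun_sum_list: "lfun f \<Longrightarrow> f (\<Sum>i\<leftarrow>I. g i) = (\<Sum>i\<leftarrow>I. f (g i))"
  by (induction I) (simp_all add: lfun_0 lfun_add)
lemma lfun_comp: "lfun f \<Longrightarrow> lmap T \<Longrightarrow> lfun (\<lambda>x. f (T x))"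
  by (simp add: lfun_iff lmap_iff)
lemma lmap_comp: "lmap f \<Longrightarrow> lmap T \<Longrightarrow> lmap (\<lambda>x. f (T x))"
  by (simp add: lmap_iff)

definition coord :: "'a \<Rightarrow> 'a \<Rightarrow> 'k" where "coord b v = representation Basis v b"

lemma lfun_coord: "lfun (coord b)"
  by (rule lfunI) (auto simp: coord_def representation_add representation_scale independent_Basis span_Basis)

lemmas coord_add = lfun_add[OF lfun_coord] and coord_scale = lfun_scale[OF lfun_coord]
  and coord_sum = lfun_sum[OF lfun_coord] and coord_0 [simp] = lfun_0[OF lfun_coord]

lemma coord_basis: "b \<in> Basis \<Longrightarrow> coord c b = (if c = b then 1 else 0)"
  by (auto simp: coord_def representation_basis independent_Basis)

lemma expand: "(\<Sum>b\<in>Basis. scale (coord b v) b) = v"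
  unfolding coord_def
  by (rule sum_representation_eq) (auto simp: independent_Basis span_Basis finite_Basis)

lemma lfun_expand: "lfun f \<Longrightarrow> f v = (\<Sum>b\<in>Basis. coord b v * f b)"
  using lfun_sum[of f "\<lambda>b. scale (coord b v) b" Basis] by (simp add: expand lfun_scale)

lemma lmap_expand: "lmap f \<Longrightarrow> f v = (\<Sum>b\<in>Basis. scale (coord b v) (f b))"
  using lmap_sum[of f "\<lambda>b. scale (coord b v) b" Basis] by (simp add: expand lmap_scale)

lemma lfun_sep: "(\<And>f. lfun f \<Longrightarrow> f x = f y) \<Longrightarrow> x = y"
  by (metis (no_types, lifting) expand lfun_coord sum.cong)

lemma lfun_eqI: "lfun f \<Longrightarrow> lfun g \<Longrightarrow> (\<And>b. b \<in> Basis \<Longrightarrow> f b = g b) \<Longrightarrow> f = g"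
proof (rule ext)
  fix x assume "lfun f" "lfun g" "\<And>b. b \<in> Basis \<Longrightarrow> f b = g b"
  then show "f x = g x" by (subst (1 2) lfun_expand) auto
qed

lemma lmap_inj_surj: "lmap T \<Longrightarrow> (\<And>x. T x = 0 \<Longrightarrow> x = 0) \<Longrightarrow> surj T"
proof (rule linear_inj_imp_surj)
  assume T: "lmap T" "\<And>x. T x = 0 \<Longrightarrow> x = 0"
  show "inj T" using T(2)[of "_ - _"] by (auto intro!: injI simp: lmap_diff[OF T(1)])
qed

text \<open>
  Every functional is of the form \<open>\<Theta> x\<close> as soon as \<open>\<Theta>\<close> is injective and linear, because a
  space and its dual have the same dimension.  This provides representing elements for
  nondegenerate forms.
\<close>

lemma inj_imp_surj_functional:
  assumes add: "\<And>x y. \<Theta> (x + y) = (\<lambda>z. \<Theta> x z + \<Theta> y z)" and sc: "\<And>c x. \<Theta> (scale c x) = (\<lambda>z. c * \<Theta> x z)"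
    and l: "\<And>x. lfun (\<Theta> x)" and inj: "\<And>x. (\<forall>y. \<Theta> x y = 0) \<Longrightarrow> x = 0" and f: "lfun f"
  shows "\<exists>x. f = \<Theta> x"
proof -
  define T where "T x = (\<Sum>b\<in>Basis. scale (\<Theta> x b) b)" for x
  have c: "coord b (T x) = \<Theta> x b" if "b \<in> Basis" for b x
    using that by (simp add: T_def coord_sum coord_scale coord_basis if_distrib finite_Basis cong: if_cong)
  have T: "lmap T" by (rule lmapI) (simp_all add: T_def add sc scale_left_distrib sum.distrib scale_sum_right)
  have "surj T"
  proof (rule lmap_inj_surj[OF T])
    fix x assume "T x = 0"
    then have "\<Theta> x b = 0" if "b \<in> Basis" for b using c[OF that, of x] by simp
    then have "\<forall>y. \<Theta> x y = 0" by (subst lfun_expand[OF l]) simp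
    then show "x = 0" by (rule inj)
  qed
  then obtain x where x: "T x = (\<Sum>b\<in>Basis. scale (f b) b)" by (metis surjD)
  have "f b = \<Theta> x b" if "b \<in> Basis" for b
    using that by (simp flip: c add: x) (simp add: coord_sum coord_scale coord_basis if_distrib finite_Basis cong: if_cong)
  then show ?thesis using lfun_eqI[OF f l] by blast
qed

definition trace :: "('a \<Rightarrow> 'a) \<Rightarrow> 'k" where "trace T = (\<Sum>b\<in>Basis. coord b (T b))"

lemma trace_add: "trace (\<lambda>x. T x + U x) = trace T + trace U"
  by (simp add: trace_def coord_add sum.distrib)
lemma trace_scale: "trace (\<lambda>x. scale c (T x)) = c * trace T"
  by (simp add: trace_def coord_scale sum_distrib_left)
lemma trace_sum: "trace (\<lambda>x. \<Sum>i\<in>I. T i x) = (\<Sum>i\<in>I. trace (T i))"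
  unfolding trace_def coord_sum by (rule sum.swap)

lemma trace_rank1: "lfun f \<Longrightarrow> trace (\<lambda>x. scale (f x) w) = f w"
  by (subst (2) lfun_expand) (simp_all add: trace_def coord_scale mult.commute)

lemma trace_id: "trace (\<lambda>x. x) = of_nat (card Basis)"
  by (simp add: trace_def coord_basis)

text \<open>
  Traces are computed from whichever expansion \<open>x = \<Sum> \<phi>\<^sub>i(x) v\<^sub>i\<close> of the identity is at hand.
\<close>

lemma trace_dual_system:
  assumes "lmap T" and "\<And>i. i \<in> I \<Longrightarrow> lfun (\<phi> i)" and "\<And>x. x = (\<Sum>i\<in>I. scale (\<phi> i x) (v i))"
  shows "trace T = (\<Sum>i\<in>I. \<phi> i (T (v i)))"
proof -
  have "T x = (\<Sum>i\<in>I. scale (\<phi> i x) (T (v i)))" for x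
    using arg_cong[OF assms(3)[of x], of T] by (simp add: lmap_sum lmap_scale assms(1))
  then have "T = (\<lambda>x. \<Sum>i\<in>I. scale (\<phi> i x) (T (v i)))" by (rule ext)
  then have "trace T = trace (\<lambda>x. \<Sum>i\<in>I. scale (\<phi> i x) (T (v i)))" by (rule arg_cong)
  also have "... = (\<Sum>i\<in>I. \<phi> i (T (v i)))" by (simp add: trace_sum trace_rank1 assms(2))
  finally show ?thesis .
qed

lemma trace_comm:
  assumes T: "lmap T" and U: "lmap U" shows "trace (\<lambda>x. T (U x)) = trace (\<lambda>x. U (T x))"
proof -
  have "(\<lambda>x. T (U x)) = (\<lambda>x. \<Sum>b\<in>Basis. scale (coord b (U x)) (T b))"
    by (rule ext) (simp flip: lmap_expand[OF T])
  then have "trace (\<lambda>x. T (U x)) = (\<Sum>b\<in>Basis. trace (\<lambda>x. scale (coord b (U x)) (T b)))"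
    by (simp add: trace_sum)
  also have "... = (\<Sum>b\<in>Basis. coord b (U (T b)))"
    by (rule sum.cong[OF refl], rule trace_rank1, rule lfun_comp[OF lfun_coord U])
  finally show ?thesis by (simp add: trace_def)
qed

text \<open>
  The trace of an idempotent is its rank.  In characteristic zero the rank can be recovered from
  its image in the field, so this lemma converts traces into integers between \<open>0\<close> and the
  dimension.
\<close>

lemma trace_idempotent:
  assumes T: "lmap T" and i: "\<And>x. T (T x) = T x"
  obtains r where "trace T = of_nat r" "r \<le> card Basis" "r = 0 \<longrightarrow> (\<forall>x. T x = 0)"
    "r = card Basis \<longrightarrow> (\<forall>x. T x = x)"
proof -
  have sub: "subspace (range T)"
  proof (rule subspaceI)
    show "0 \<in> range T" using lmap_0[OF T] by (metis rangeI)
    fix x y c assume "x \<in> range T"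
    then obtain x' where x': "x = T x'" by blast
    then show "scale c x \<in> range T" by (simp flip: lmap_scale[OF T])
    assume "y \<in> range T"
    then obtain y' where "y = T y'" by blast
    then show "x + y \<in> range T" by (simp add: x' flip: lmap_add[OF T])
  qed
  have subk: "subspace {x. T x = 0}"
    unfolding subspace_def by (auto simp: lmap_0 lmap_add lmap_scale T)
  obtain B where B: "B \<subseteq> range T" "independent B" "range T \<subseteq> span B" "card B = dim (range T)"
    by (rule basis_exists)
  have spB: "span B = range T" using B sub by (metis span_subspace)
  obtain C where C: "C \<subseteq> {x. T x = 0}" "independent C" "{x. T x = 0} \<subseteq> span C" 
    by (rule basis_exists)
  have spC: "span C = {x. T x = 0}" using C subk by (metis span_subspace)
  have fB: "finite B" and fC: "finite C" using B C finiteI_independent by blast+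
  define \<phi> where "\<phi> b x = representation B (T x) b" for b x
  define \<psi> where "\<psi> c x = representation C (x - T x) c" for c x
  have inC: "x - T x \<in> span C" for x by (simp add: spC lmap_diff[OF T] i)
  have inB: "T x \<in> span B" for x by (simp add: spB)
  have l1: "lfun (\<phi> b)" for b
    by (rule lfunI) (simp_all add: \<phi>_def lmap_simps[OF T] representation_add representation_scale B inB)
  have l2: "lfun (\<psi> b)" for b
  proof (rule lfunI)
    fix x y and d :: 'k
    have "x + y - T (x + y) = (x - T x) + (y - T y)" by (simp add: lmap_add[OF T])
    then show "\<psi> b (x + y) = \<psi> b x + \<psi> b y"
      by (simp only: \<psi>_def representation_add[OF C(2) inC inC])
    have "scale d x - T (scale d x) = scale d (x - T x)" by (simp add: lmap_scale[OF T] scale_right_diff_distrib)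
    then show "\<psi> b (scale d x) = d * \<psi> b x"
      by (simp only: \<psi>_def representation_scale[OF C(2) inC])
  qed
  have e1: "(\<Sum>b\<in>B. scale (\<phi> b x) b) = T x" for x
    unfolding \<phi>_def by (rule sum_representation_eq) (use B fB inB in auto)
  have e2: "(\<Sum>b\<in>C. scale (\<psi> b x) b) = x - T x" for x
    unfolding \<psi>_def by (rule sum_representation_eq) (use C fC inC in auto)
  have tr: "trace T = of_nat (card B)"
  proof -
    have "T = (\<lambda>x. \<Sum>b\<in>B. scale (\<phi> b x) b)" by (rule ext) (simp add: e1)
    then have "trace T = trace (\<lambda>x. \<Sum>b\<in>B. scale (\<phi> b x) b)" by (rule arg_cong)
    then have "trace T = (\<Sum>b\<in>B. \<phi> b b)" by (simp only: trace_sum trace_rank1 l1)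
    also have "... = (\<Sum>b\<in>B. 1)"
    proof (rule sum.cong)
      fix b assume b: "b \<in> B"
      then obtain y where "b = T y" using B(1) by auto
      then have "T b = b" by (simp add: i)
      then show "\<phi> b b = 1" by (simp add: \<phi>_def representation_basis B b)
    qed simp
    finally show ?thesis by simp
  qed
  have tr2: "trace (\<lambda>x. x - T x) = of_nat (card C)"
  proof -
    have "(\<lambda>x. x - T x) = (\<lambda>x. \<Sum>b\<in>C. scale (\<psi> b x) b)" by (rule ext) (simp add: e2)
    then have "trace (\<lambda>x. x - T x) = trace (\<lambda>x. \<Sum>b\<in>C. scale (\<psi> b x) b)" by (rule arg_cong)
    then have "trace (\<lambda>x. x - T x) = (\<Sum>b\<in>C. \<psi> b b)" by (simp only: trace_sum trace_rank1 l2)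
    also have "... = (\<Sum>b\<in>C. 1)"
    proof (rule sum.cong)
      fix b assume b: "b \<in> C"
      then have "T b = 0" using C(1) by auto
      then show "\<psi> b b = 1" by (simp add: \<psi>_def representation_basis C b)
    qed simp
    finally show ?thesis by simp
  qed
  have "of_nat (card B) + of_nat (card C) = (of_nat (card Basis) :: 'k)"
    using trace_add[of T "\<lambda>x. x - T x"] by (simp add: tr tr2 trace_id)
  then have sum: "card B + card C = card Basis" by (metis of_nat_add of_nat_eq_iff)
  show thesis
  proof (rule that[OF tr])
    show "card B \<le> card Basis" using sum by simp
    show "card B = 0 \<longrightarrow> (\<forall>x. T x = 0)" using fB e1 by auto
    show "card B = card Basis \<longrightarrow> (\<forall>x. T x = x)"
    proof
      assume "card B = card Basis"
      then have "C = {}" using sum fC by auto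
      then show "\<forall>x. T x = x" using e2 by simp
    qed
  qed
qed

text \<open>
  The value at \<open>v\<close> of the operator \<open>p(T)\<close>.
\<close>

definition pev :: "('a \<Rightarrow> 'a) \<Rightarrow> 'k poly \<Rightarrow> 'a \<Rightarrow> 'a" where
  "pev T p v = (\<Sum>i\<le>degree p. scale (coeff p i) ((T ^^ i) v))"

lemma pev_alt: "degree p \<le> n \<Longrightarrow> pev T p v = (\<Sum>i\<le>n. scale (coeff p i) ((T ^^ i) v))"
  unfolding pev_def by (rule sum.mono_neutral_left) (auto simp: coeff_eq_0)

lemma pev_linear_factor:
  assumes T: "lmap T" shows "pev T ([:-c, 1:] * q) v = T (pev T q v) - scale c (pev T q v)"
proof -
  have 1: "pev T (smult c q) v = scale c (pev T q v)"
    by (subst pev_alt[of _ "degree q"]) (auto simp: degree_smult_le pev_def scale_sum_right)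
  have 2: "pev T (pCons 0 q) v = T (pev T q v)"
    by (subst pev_alt[of _ "Suc (degree q)"])
      (simp_all add: degree_pCons_le pev_def lmap_sum[OF T] lmap_scale[OF T] sum.atMost_Suc_shift del: sum.atMost_Suc)
  have "degree (pCons 0 q) \<le> Suc (degree q)" "degree (smult c q) \<le> Suc (degree q)"
    "degree (pCons 0 q - smult c q) \<le> Suc (degree q)"
    by (auto simp: degree_pCons_le intro!: degree_diff_le)
  then have "pev T (pCons 0 q - smult c q) v = pev T (pCons 0 q) v - pev T (smult c q) v"
    by (simp add: pev_alt[where n = "Suc (degree q)"] scale_left_diff_distrib sum_subtractf)
  moreover have "[:-c, 1:] * q = pCons 0 q - smult c q" by simp
  ultimately show ?thesis by (simp add: 1 2 del: mult_pCons_left)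
qed

text \<open>
  A polynomial annihilates \<open>v\<close> because the powers of \<open>T\<close> applied to \<open>v\<close> are dependent.  Splitting
  off one linear factor after the other, the last nonzero vector met is an eigenvector; it lies in
  the span of the iterates of \<open>v\<close>.
\<close>

lemma eigenvector_in_invariant_subspace:
  assumes T: "lmap T" and W: "subspace W" "\<And>x. x \<in> W \<Longrightarrow> T x \<in> W" and v: "v \<in> W" "v \<noteq> 0"
  obtains c w where "w \<in> W" "w \<noteq> 0" "T w = scale c w"
proof -
  have pow: "(T ^^ i) v \<in> W" for i by (induction i) (use v W in auto)
  then have evW: "pev T p v \<in> W" for p
    unfolding pev_def by (intro subspace_sum subspace_scale W)
  \<comment> \<open>Either two iterates coincide, or there are more of them than the dimension allows.\<close>
  have "\<exists>p. p \<noteq> 0 \<and> pev T p v = 0"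
  proof (cases "inj_on (\<lambda>i. (T ^^ i) v) {..card Basis}")
    case False
    then obtain i j where "i \<noteq> j" "(T ^^ i) v = (T ^^ j) v"
      unfolding inj_on_def by blast
    then obtain i j where ij: "i < j" "(T ^^ i) v = (T ^^ j) v"
      by (cases i j rule: linorder_cases) force+
    define p :: "'k poly" where "p = monom 1 j - monom 1 i"
    have "coeff p j = 1" using ij by (simp add: p_def)
    then have "p \<noteq> 0" by auto
    have "degree p \<le> j" unfolding p_def using ij by (intro degree_diff_le) (auto simp: degree_monom_eq)
    then have "pev T p v = (\<Sum>k\<le>j. scale (coeff p k) ((T ^^ k) v))" by (rule pev_alt)
    also have "... = (T ^^ j) v - (T ^^ i) v"
      using ij by (simp add: p_def scale_left_diff_distrib sum_subtractf if_distrib[of "\<lambda>c. scale c _"] cong: if_cong)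
    finally have "pev T p v = 0" using ij by simp
    with \<open>p \<noteq> 0\<close> show ?thesis by blast
  next
    case True
    define S where "S = (\<lambda>i. (T ^^ i) v) ` {..card Basis}"
    have "card S = Suc (card Basis)" using True by (simp add: S_def card_image)
    moreover have "\<not> (independent S \<and> card S > card Basis)" 
      using independent_span_bound[of Basis S] finite_Basis span_Basis by fastforce
    ultimately have "dependent S" by auto
    then obtain u where u: "\<exists>s\<in>S. u s \<noteq> 0" "(\<Sum>s\<in>S. scale (u s) s) = 0"
      using dependent_finite[of S] by (auto simp: S_def)
    define p where "p = (\<Sum>i\<le>card Basis. monom (u ((T ^^ i) v)) i)"
    have cp: "coeff p i = (if i \<le> card Basis then u ((T ^^ i) v) else 0)" for i
      by (simp add: p_def coeff_sum coeff_monom)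
    obtain i where "i \<le> card Basis" "u ((T ^^ i) v) \<noteq> 0" using u(1) by (auto simp: S_def)
    then have "coeff p i \<noteq> 0" by (simp add: cp)
    then have "p \<noteq> 0" by auto
    have "degree p \<le> card Basis" by (rule degree_le) (simp add: cp)
    then have "pev T p v = (\<Sum>k\<le>card Basis. scale (coeff p k) ((T ^^ k) v))" by (rule pev_alt)
    also have "... = (\<Sum>s\<in>S. scale (u s) s)" by (simp add: S_def sum.reindex[OF True] cp)
    finally have "pev T p v = 0" using u by simp
    with \<open>p \<noteq> 0\<close> show ?thesis by blast
  qed
  then obtain p where "p \<noteq> 0" "pev T p v = 0" by blast
  then have "\<exists>c w. w \<in> W \<and> w \<noteq> 0 \<and> T w = scale c w"
  proof (induction "degree p" arbitrary: p rule: less_induct)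
    case less
    show ?case
    proof (cases "degree p = 0")
      case True
      then obtain a where "p = [:a:]" by (metis degree_eq_zeroE)
      then show ?thesis using less v by (simp add: pev_def)
    next
      case False
      then obtain c where "poly p c = 0" using alg_closed_imp_poly_has_root[of p] by auto
      then obtain q where q: "p = [:-c, 1:] * q" by (metis poly_eq_0_iff_dvd dvdE)
      then have "q \<noteq> 0" using less by auto
      then have d: "degree q < degree p" unfolding q by (subst degree_mult_eq) auto
      show ?thesis
      proof (cases "pev T q v = 0")
        case True then show ?thesis using less(1)[OF d] \<open>q \<noteq> 0\<close> by blast
      next
        case False
        have "T (pev T q v) = scale c (pev T q v)" using less(3) by (simp add: q pev_linear_factor[OF T] del: mult_pCons_left)
        then show ?thesis using False evW by blast
      qed
    qed
  qed
  then show thesis using that by blast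
qed

end

section \<open>Algebras with nondegenerate trace form\<close>

text \<open>
  The multiplication is a parameter and not that of a type class, so that the dual of a Hopf
  algebra can be placed on the same type as the Hopf algebra itself.
\<close>

locale trace_form_algebra = fdvs scale Basis
  for scale :: "'k::{alg_closed_field, field_char_0} \<Rightarrow> 'a::ab_group_add \<Rightarrow> 'a" and Basis :: "'a set" +
  fixes m :: "'a \<Rightarrow> 'a \<Rightarrow> 'a" (infixl "\<odot>" 70) and u :: 'a
  assumes m_add_left: "(x + y) \<odot> z = x \<odot> z + y \<odot> z"
    and m_add_right: "x \<odot> (y + z) = x \<odot> y + x \<odot> z"
    and m_scale_left: "scale c x \<odot> y = scale c (x \<odot> y)"
    and m_scale_right: "x \<odot> scale c y = scale c (x \<odot> y)"
    and m_assoc: "(x \<odot> y) \<odot> z = x \<odot> (y \<odot> z)"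
    and unit_left: "u \<odot> x = x"
    and unit_right: "x \<odot> u = x"
    and nondegenerate: "(\<And>y. trace (\<lambda>z. (y \<odot> x) \<odot> z) = 0) \<Longrightarrow> x = 0"
begin

lemma lmap_left: "lmap (\<lambda>x. a \<odot> x)" and lmap_right: "lmap (\<lambda>x. x \<odot> a)"
  by (simp_all add: lmap_iff m_add_left m_add_right m_scale_left m_scale_right)

lemmas m_0_left [simp] = lmap_0[OF lmap_right] and m_0_right [simp] = lmap_0[OF lmap_left]
  and m_diff_left = lmap_diff[OF lmap_right] and m_diff_right = lmap_diff[OF lmap_left]
  and m_sum_left = lmap_sum[OF lmap_right] and m_sum_right = lmap_sum[OF lmap_left]

definition \<tau> :: "'a \<Rightarrow> 'k" where "\<tau> x = trace (\<lambda>z. x \<odot> z)"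

lemma lfun_\<tau>: "lfun \<tau>"
  by (rule lfunI) (simp_all add: \<tau>_def m_add_left m_scale_left trace_add trace_scale)

lemma \<tau>_comm: "\<tau> (x \<odot> y) = \<tau> (y \<odot> x)"
  using trace_comm[OF lmap_left lmap_left, of x y] by (simp add: \<tau>_def m_assoc)

lemma \<tau>_nondeg: "(\<And>y. \<tau> (y \<odot> x) = 0) \<Longrightarrow> x = 0"
  using nondegenerate by (simp add: \<tau>_def)

lemma \<tau>_represents:
  assumes f: "lfun f" shows "\<exists>y. \<forall>x. f x = \<tau> (y \<odot> x)"
proof -
  have "\<exists>y. f = (\<lambda>x. \<tau> (y \<odot> x))"
  proof (rule inj_imp_surj_functional[of "\<lambda>y x. \<tau> (y \<odot> x)"])
    show "lfun (\<lambda>y. \<tau> (x \<odot> y))" for x by (rule lfun_comp[OF lfun_\<tau> lmap_left])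
    show "x = 0" if "\<forall>y. \<tau> (x \<odot> y) = 0" for x
      using that by (intro \<tau>_nondeg) (metis \<tau>_comm)
  qed (auto simp: m_add_left m_scale_left lfun_simps[OF lfun_\<tau>] f)
  then show ?thesis by (auto simp: fun_eq_iff)
qed

definition dual :: "'a \<Rightarrow> 'a" where "dual b = (SOME y. \<forall>x. coord b x = \<tau> (y \<odot> x))"

lemma \<tau>_dual: "\<tau> (dual b \<odot> x) = coord b x"
  unfolding dual_def by (rule someI_ex[OF \<tau>_represents[OF lfun_coord[of b]], THEN spec, symmetric])

text \<open>
  A Casimir tensor \<open>\<Sum> c\<^sub>i v\<^sub>i \<otimes> w\<^sub>i\<close> is symmetric in the two legs: by associativity and symmetry of
  the form, expanding the first leg by means of the second is the same as the converse.
\<close>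

lemma dual_expansion:
  assumes "\<And>x. (\<Sum>i\<in>I. scale (c i * \<tau> (w i \<odot> x)) (v i)) = x"
  shows "(\<Sum>i\<in>I. scale (c i * \<tau> (y \<odot> v i)) (w i)) = y"
proof -
  have "\<tau> (x \<odot> ((\<Sum>i\<in>I. scale (c i * \<tau> (y \<odot> v i)) (w i)) - y)) = 0" for x
  proof -
    have "\<tau> ((\<Sum>i\<in>I. scale (c i * \<tau> (y \<odot> v i)) (w i)) \<odot> x) = (\<Sum>i\<in>I. c i * \<tau> (y \<odot> v i) * \<tau> (w i \<odot> x))"
      by (simp add: m_sum_left m_scale_left lfun_sum[OF lfun_\<tau>] lfun_scale[OF lfun_\<tau>])
    also have "... = \<tau> (y \<odot> (\<Sum>i\<in>I. scale (c i * \<tau> (w i \<odot> x)) (v i)))"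
      by (simp add: m_sum_right m_scale_right lfun_sum[OF lfun_\<tau>] lfun_scale[OF lfun_\<tau>] mult_ac)
    also have "... = \<tau> (y \<odot> x)" by (simp only: assms)
    finally have "\<tau> (((\<Sum>i\<in>I. scale (c i * \<tau> (y \<odot> v i)) (w i)) - y) \<odot> x) = 0"
      by (simp add: m_diff_left lfun_diff[OF lfun_\<tau>])
    then show ?thesis by (subst \<tau>_comm)
  qed
  from \<tau>_nondeg[OF this] show ?thesis by simp
qed

lemma expand_dual: "(\<Sum>b\<in>Basis. scale (\<tau> (y \<odot> b)) (dual b)) = y"
  using dual_expansion[where I = Basis and c = "\<lambda>_. 1" and w = dual and v = "\<lambda>b. b" and y = y] by (simp add: \<tau>_dual expand)

text \<open>
  Both sides represent \<open>\<tau>\<close> with respect to the trace form: computing the trace of left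
  multiplication in the basis gives the left-hand side.
\<close>

lemma casimir_unit: "(\<Sum>b\<in>Basis. b \<odot> dual b) = u"
proof -
  have "\<tau> (x \<odot> ((\<Sum>b\<in>Basis. b \<odot> dual b) - u)) = 0" for x
  proof -
    have "\<tau> (x \<odot> (b \<odot> dual b)) = coord b (x \<odot> b)" for b
      using \<tau>_comm[of "dual b" "x \<odot> b"] by (simp add: m_assoc \<tau>_dual)
    then show ?thesis
      by (simp add: m_diff_right m_sum_right unit_right lfun_diff[OF lfun_\<tau>] lfun_sum[OF lfun_\<tau>])
        (simp add: \<tau>_def trace_def)
  qed
  from \<tau>_nondeg[OF this] show ?thesis by simp
qed

lemma subspace_projection:
  assumes I: "subspace I"
  obtains P where "lmap P" "\<And>x. P x \<in> I" "\<And>x. x \<in> I \<Longrightarrow> P x = x"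
proof -
  obtain B where B: "B \<subseteq> I" "independent B" "I \<subseteq> span B" by (rule basis_exists)
  define C where "C = extend_basis B"
  have C: "independent C" "span C = UNIV" "B \<subseteq> C" 
    using independent_extend_basis[OF B(2)] span_extend_basis[OF B(2)] extend_basis_superset[OF B(2)]
    by (simp_all add: C_def)
  have fB: "finite B" by (rule finiteI_independent[OF B(2)])
  define P where "P v = (\<Sum>b\<in>B. scale (representation C v b) b)" for v
  have "lmap P" by (rule lmapI) (simp_all add: P_def representation_add representation_scale C 
      scale_left_distrib sum.distrib scale_sum_right)
  moreover have "P x \<in> I" for x
    unfolding P_def by (rule subspace_sum[OF I]) (use B I in \<open>auto intro: subspace_scale\<close>)
  moreover have "P x = x" if "x \<in> I" for x
  proof -
    have x: "x \<in> span B" using that B by blast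
    have "representation C x = representation B x" by (rule representation_extend[OF C(1) x C(3)])
    then show ?thesis unfolding P_def by (simp add: sum_representation_eq[OF B(2) x fB])
  qed
  ultimately show thesis by (rule that)
qed

definition left_ideal_of :: "'a set \<Rightarrow> bool" where
  "left_ideal_of I \<longleftrightarrow> subspace I \<and> (\<forall>a. \<forall>x\<in>I. a \<odot> x \<in> I)"

lemma left_ideal_ofI:
  "0 \<in> I \<Longrightarrow> (\<And>x y. x \<in> I \<Longrightarrow> y \<in> I \<Longrightarrow> x + y \<in> I) \<Longrightarrow> (\<And>c x. x \<in> I \<Longrightarrow> scale c x \<in> I) \<Longrightarrow>
   (\<And>a x. x \<in> I \<Longrightarrow> a \<odot> x \<in> I) \<Longrightarrow> left_ideal_of I"
  by (simp add: left_ideal_of_def subspace_def)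

text \<open>
  Complete reducibility in the form in which it is used.  As in the proof of Maschke's theorem,
  a linear projection \<open>P\<close> onto the left ideal is averaged with the separability idempotent
  \<open>\<Sum> b \<otimes> dual b\<close>; the resulting module projection is right multiplication by its value at the
  unit.
\<close>

lemma left_ideal_right_unit:
  assumes I: "left_ideal_of I" obtains e where "e \<in> I" "\<And>x. x \<in> I \<Longrightarrow> x \<odot> e = x"
proof -
  have sI: "subspace I" and lI: "\<And>a x. x \<in> I \<Longrightarrow> a \<odot> x \<in> I" using I by (auto simp: left_ideal_of_def)
  obtain P where P: "lmap P" "\<And>x. P x \<in> I" "\<And>x. x \<in> I \<Longrightarrow> P x = x" using subspace_projection[OF sI] by blast
  define Q where "Q x = (\<Sum>b\<in>Basis. b \<odot> P (dual b \<odot> x))" for x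
  have Qm: "Q (x \<odot> y) = x \<odot> Q y" for x y
  proof -
    have "Q (x \<odot> y) = (\<Sum>b\<in>Basis. b \<odot> P ((\<Sum>c\<in>Basis. scale (\<tau> ((dual b \<odot> x) \<odot> c)) (dual c)) \<odot> y))"
      unfolding expand_dual by (simp add: Q_def m_assoc)
    also have "... = (\<Sum>b\<in>Basis. \<Sum>c\<in>Basis. scale (coord b (x \<odot> c)) (b \<odot> P (dual c \<odot> y)))"
      by (simp add: m_sum_left m_sum_right m_scale_left m_scale_right lmap_sum[OF P(1)] lmap_scale[OF P(1)] m_assoc \<tau>_dual)
    also have "... = (\<Sum>c\<in>Basis. \<Sum>b\<in>Basis. scale (coord b (x \<odot> c)) (b \<odot> P (dual c \<odot> y)))"
      by (rule sum.swap)
    also have "... = (\<Sum>c\<in>Basis. (\<Sum>b\<in>Basis. scale (coord b (x \<odot> c)) b) \<odot> P (dual c \<odot> y))"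
      by (simp add: m_sum_left m_scale_left)
    also have "... = x \<odot> Q y" by (simp add: expand Q_def m_assoc m_sum_right)
    finally show ?thesis .
  qed
  have "Q u \<in> I" unfolding Q_def by (rule subspace_sum[OF sI]) (simp add: lI P)
  moreover have "x \<odot> Q u = x" if x: "x \<in> I" for x
  proof -
    have "x \<odot> Q u = Q x" using Qm[of x u] by (simp add: unit_right)
    also have "... = (\<Sum>b\<in>Basis. b \<odot> dual b) \<odot> x" by (simp add: Q_def P(3) lI x m_sum_left m_assoc)
    finally show ?thesis by (simp add: casimir_unit unit_left)
  qed
  ultimately show thesis by (rule that)
qed

text \<open>
  For a semisimple algebra these are the primitive idempotents.
\<close>

definition minimal :: "'a \<Rightarrow> bool" where
  "minimal f \<longleftrightarrow> f \<noteq> 0 \<and> f \<odot> f = f \<and>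
     (\<forall>g. g \<odot> g = g \<and> f \<odot> g = g \<and> g \<odot> f = g \<longrightarrow> g = 0 \<or> g = f)"

lemma minimal_idem: "minimal f \<Longrightarrow> f \<odot> f = f" and minimal_nonzero: "minimal f \<Longrightarrow> f \<noteq> 0"
  by (simp_all add: minimal_def)

lemma minimal_idem': "minimal f \<Longrightarrow> f \<odot> (f \<odot> x) = f \<odot> x"
  by (simp add: minimal_idem flip: m_assoc)

text \<open>
  The left ideal generated by a minimal idempotent is simple: a nonzero left ideal inside it has
  a right unit \<open>e\<close>, and \<open>f \<odot> e\<close> is a nonzero idempotent below \<open>f\<close>.
\<close>

lemma minimal_left_ideal:
  assumes f: "minimal f" and I: "left_ideal_of I" and If: "\<And>x. x \<in> I \<Longrightarrow> x \<odot> f = x"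
    and x: "x \<in> I" "x \<noteq> 0"
  shows "f \<in> I"
proof -
  obtain e where e: "e \<in> I" "\<And>x. x \<in> I \<Longrightarrow> x \<odot> e = x" using left_ideal_right_unit[OF I] by blast
  have ee: "e \<odot> e = e" and ef: "e \<odot> f = e" using e If by auto
  have "e \<noteq> 0" using e(2)[OF x(1)] x(2) by auto
  define g where "g = f \<odot> e"
  have efe: "e \<odot> (f \<odot> e) = e" by (simp add: ee ef flip: m_assoc)
  have "g \<odot> g = g" by (simp add: g_def m_assoc efe)
  moreover have "f \<odot> g = g" by (simp add: g_def minimal_idem'[OF f])
  moreover have "g \<odot> f = g" by (simp add: g_def m_assoc ef)
  ultimately have "g = 0 \<or> g = f" using f unfolding minimal_def by blast
  moreover have "g \<noteq> 0" using efe \<open>e \<noteq> 0\<close> unfolding g_def by auto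
  moreover have "g \<in> I" using I e(1) by (simp add: g_def left_ideal_of_def)
  ultimately show ?thesis by simp
qed

text \<open>
  Schur's lemma: right multiplication by \<open>f \<odot> y \<odot> f\<close> on the simple left ideal of \<open>f\<close> has an
  eigenvector, and the eigenspace is a left ideal, hence everything.
\<close>

lemma minimal_corner:
  assumes f: "minimal f" shows "\<exists>c. f \<odot> (y \<odot> f) = scale c f"
proof -
  define z where "z = f \<odot> (y \<odot> f)"
  have zf: "z \<odot> f = z" and fz: "f \<odot> z = z" by (simp_all add: z_def m_assoc minimal_idem[OF f] minimal_idem'[OF f])
  have W: "subspace {x. x \<odot> f = x}" 
    by (simp add: subspace_def m_add_left m_scale_left)
  obtain c w where w: "w \<odot> f = w" "w \<noteq> 0" "w \<odot> z = scale c w"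
    by (rule eigenvector_in_invariant_subspace[OF lmap_right[of z] W, of f]) 
       (auto simp: m_assoc zf minimal_idem[OF f] minimal_nonzero[OF f])
  have "f \<in> {x. x \<odot> f = x \<and> x \<odot> z = scale c x}"
  proof (rule minimal_left_ideal[OF f])
    show "left_ideal_of {x. x \<odot> f = x \<and> x \<odot> z = scale c x}"
      by (rule left_ideal_ofI) (auto simp: m_add_left m_scale_left m_scale_right m_assoc scale_right_distrib scale_left_commute)
  qed (use w in auto)
  then have "f \<odot> z = scale c f" by simp
  then show ?thesis using fz unfolding z_def by metis
qed

text \<open>
  A nonzero element of \<open>f \<odot> A \<odot> h\<close> is an isomorphism between two simple left ideals; the lemma
  provides its inverse.
\<close>

lemma minimal_inverse:
  assumes f: "minimal f" and h: "minimal h" and x: "x \<noteq> 0" "f \<odot> x = x" "x \<odot> h = x"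
  shows "\<exists>y. h \<odot> y = y \<and> y \<odot> f = y \<and> x \<odot> y = f \<and> y \<odot> x = h"
proof -
  have "h \<in> range (\<lambda>a. a \<odot> x)"
  proof (rule minimal_left_ideal[OF h])
    show "left_ideal_of (range (\<lambda>a. a \<odot> x))"
    proof (rule left_ideal_ofI)
      show "0 \<in> range (\<lambda>a. a \<odot> x)" by (rule range_eqI[of _ _ 0]) simp
      fix y z :: 'a and c a
      assume "y \<in> range (\<lambda>a. a \<odot> x)" 
      then obtain y' where y: "y = y' \<odot> x" by blast
      then show "scale c y \<in> range (\<lambda>a. a \<odot> x)" "a \<odot> y \<in> range (\<lambda>a. a \<odot> x)"
        by (metis m_scale_left rangeI, metis m_assoc rangeI)
      assume "z \<in> range (\<lambda>a. a \<odot> x)" 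
      then obtain z' where "z = z' \<odot> x" by blast
      with y show "y + z \<in> range (\<lambda>a. a \<odot> x)" by (metis m_add_left rangeI)
    qed
    show "x \<in> range (\<lambda>a. a \<odot> x)" by (rule range_eqI[of _ _ u]) (simp add: unit_left)
  qed (use x in \<open>auto simp: m_assoc\<close>)
  then obtain z where z: "h = z \<odot> x" by auto
  define y where "y = h \<odot> (z \<odot> f)"
  have y: "h \<odot> y = y" "y \<odot> f = y" by (simp_all add: y_def minimal_idem' minimal_idem f h m_assoc)
  have yx: "y \<odot> x = h"
    by (simp add: y_def m_assoc x minimal_idem[OF h] flip: z)
  obtain c where c: "f \<odot> ((x \<odot> y) \<odot> f) = scale c f" using minimal_corner[OF f] by blast
  have "f \<odot> ((x \<odot> y) \<odot> f) = x \<odot> y" by (simp add: m_assoc y x flip: m_assoc[of f x])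
  with c have xy: "x \<odot> y = scale c f" by simp
  have "x = (x \<odot> y) \<odot> x" by (simp add: m_assoc yx x)
  also have "... = scale c x" by (simp add: xy m_scale_left x)
  finally have "scale (c - 1) x = 0" by (simp add: scale_left_diff_distrib)
  then have "c = 1" using x(1) by simp
  then show ?thesis using y yx xy by auto
qed

definition orthogonal_decomposition :: "'a \<Rightarrow> 'a set \<Rightarrow> bool" where
  "orthogonal_decomposition e X \<longleftrightarrow> finite X \<and> (\<forall>f\<in>X. minimal f) \<and>
     (\<forall>f\<in>X. \<forall>g\<in>X. f \<noteq> g \<longrightarrow> f \<odot> g = 0) \<and> (\<Sum>f\<in>X. f) = e"

lemma decomposition_absorbs:
  assumes X: "orthogonal_decomposition e X" and f: "f \<in> X"
  shows "e \<odot> f = f" "f \<odot> e = f"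
proof -
  have 1: "g \<odot> f = (if g = f then f else 0)" "f \<odot> g = (if g = f then f else 0)" if "g \<in> X" for g
    using X f that minimal_idem by (auto simp: orthogonal_decomposition_def)
  have e: "e = (\<Sum>g\<in>X. g)" "finite X" using X by (auto simp: orthogonal_decomposition_def)
  show "e \<odot> f = f" "f \<odot> e = f"
    unfolding e(1) m_sum_left m_sum_right using f e(2) by (simp_all add: 1 cong: sum.cong)
qed

lemma decomposition_union:
  assumes eg: "e \<odot> g = 0" "g \<odot> e = 0" and X: "orthogonal_decomposition e X" and Y: "orthogonal_decomposition g Y"
  shows "orthogonal_decomposition (e + g) (X \<union> Y)"
proof -
  have o: "x \<odot> y = 0" "y \<odot> x = 0" if "x \<in> X" "y \<in> Y" for x y
  proof -
    have "x \<odot> y = (x \<odot> e) \<odot> (g \<odot> y)"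
      using decomposition_absorbs[OF X that(1)] decomposition_absorbs[OF Y that(2)] by simp
    also have "(x \<odot> e) \<odot> (g \<odot> y) = x \<odot> ((e \<odot> g) \<odot> y)" by (simp add: m_assoc)
    finally show "x \<odot> y = 0" by (simp add: eg)
    have "y \<odot> x = (y \<odot> g) \<odot> (e \<odot> x)" using decomposition_absorbs[OF X that(1)] decomposition_absorbs[OF Y that(2)] by simp
    also have "... = y \<odot> ((g \<odot> e) \<odot> x)" by (simp add: m_assoc)
    finally show "y \<odot> x = 0" by (simp add: eg)
  qed
  have "X \<inter> Y = {}"
  proof (rule ccontr)
    assume "X \<inter> Y \<noteq> {}"
    then obtain x where x: "x \<in> X" "x \<in> Y" by blast
    then have "x \<odot> x = 0" "minimal x" using o X by (auto simp: orthogonal_decomposition_def)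
    then show False using minimal_idem minimal_nonzero by metis
  qed
  then show ?thesis using X Y o by (auto simp: orthogonal_decomposition_def sum.union_disjoint)
qed

text \<open>
  An idempotent that is not minimal splits into two orthogonal ones of smaller rank, where the
  rank is the trace of right multiplication.
\<close>

lemma decomposition_exists:
  assumes "e \<odot> e = e" shows "\<exists>X. orthogonal_decomposition e X"
proof -
  have tr: "\<exists>r. trace (\<lambda>x. x \<odot> e) = of_nat r \<and> (r = 0 \<longrightarrow> e = 0)" if "e \<odot> e = e" for e
  proof -
    have i: "(x \<odot> e) \<odot> e = x \<odot> e" for x by (simp only: m_assoc that)
    obtain r where "trace (\<lambda>x. x \<odot> e) = of_nat r" "r = 0 \<longrightarrow> (\<forall>x. x \<odot> e = 0)"
      using trace_idempotent[OF lmap_right[of e] i] by blast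
    moreover have "e = 0" if "r = 0" using calculation(2) that \<open>e \<odot> e = e\<close> by simp
    ultimately show ?thesis by blast
  qed
  obtain r where "trace (\<lambda>x. x \<odot> e) = of_nat r" using tr[OF assms] by blast
  with assms show ?thesis
  proof (induction r arbitrary: e rule: less_induct)
    case (less r)
    show ?case
    proof (cases "e = 0 \<or> minimal e")
      case True
      then have "orthogonal_decomposition e (if e = 0 then {} else {e})" by (auto simp: orthogonal_decomposition_def)
      then show ?thesis by blast
    next
      case False
      then obtain g where g: "g \<odot> g = g" "e \<odot> g = g" "g \<odot> e = g" "g \<noteq> 0" "g \<noteq> e"
        using less by (auto simp: minimal_def)
      define h where "h = e - g"
      have h: "h \<odot> h = h" "h \<noteq> 0" "g \<odot> h = 0" "h \<odot> g = 0" "e = g + h"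
        using g less(2) by (auto simp: h_def m_diff_left m_diff_right)
      obtain a where a: "trace (\<lambda>x. x \<odot> g) = of_nat a" "a \<noteq> 0" using tr[OF g(1)] g(4) by auto
      obtain b where b: "trace (\<lambda>x. x \<odot> h) = of_nat b" "b \<noteq> 0" using tr[OF h(1)] h(2) by auto
      have "of_nat r = (of_nat (a + b) :: 'k)"
        using less(3) trace_add[of "\<lambda>x. x \<odot> g" "\<lambda>x. x \<odot> h"] a b by (simp add: h(5) m_add_right)
      then have r: "r = a + b" by (simp only: of_nat_eq_iff)
      obtain X where X: "orthogonal_decomposition g X" using less(1)[OF _ g(1) a(1)] r b by auto
      obtain Y where Y: "orthogonal_decomposition h Y" using less(1)[OF _ h(1) b(1)] r a by auto
      show ?thesis using decomposition_union[OF h(3,4) X Y] h(5) by blast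
    qed
  qed
qed

end

section \<open>The Peirce decomposition\<close>

locale peirce = trace_form_algebra scale Basis m u
  for scale :: "'k::{alg_closed_field, field_char_0} \<Rightarrow> 'a::ab_group_add \<Rightarrow> 'a" and Basis :: "'a set"
    and m (infixl "\<odot>" 70) and u +
  fixes X assumes X: "orthogonal_decomposition u X"
begin

lemma finX: "finite X" and minX: "f \<in> X \<Longrightarrow> minimal f" and orthX: "f \<in> X \<Longrightarrow> g \<in> X \<Longrightarrow> f \<noteq> g \<Longrightarrow> f \<odot> g = 0"
  and sumX: "(\<Sum>f\<in>X. f) = u"
  using X by (auto simp: orthogonal_decomposition_def)

lemma multX: "f \<in> X \<Longrightarrow> g \<in> X \<Longrightarrow> f \<odot> g = (if f = g then f else 0)"
  by (simp add: orthX minimal_idem minX)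

lemma multX': "f \<in> X \<Longrightarrow> g \<in> X \<Longrightarrow> f \<odot> (g \<odot> x) = (if f = g then f \<odot> x else 0)"
  by (simp add: multX flip: m_assoc)

text \<open>
  Linked idempotents belong to the same matrix block.  A choice of nonzero elements \<open>E f g\<close> in
  \<open>f \<odot> A \<odot> g\<close> with inverses \<open>E' f g\<close> in \<open>g \<odot> A \<odot> f\<close> serves as a system of matrix units
  up to scalars.  The functional \<open>\<kappa> f g\<close> is the matrix coefficient, \<open>R\<close> the
  index set of the matrix units, and \<open>d f\<close> the size of the block of \<open>f\<close>.
\<close>

definition linked :: "'a \<Rightarrow> 'a \<Rightarrow> bool" where "linked f g \<longleftrightarrow> (\<exists>x. f \<odot> (x \<odot> g) \<noteq> 0)"

definition E :: "'a \<Rightarrow> 'a \<Rightarrow> 'a" where "E f g = (SOME x. x \<noteq> 0 \<and> f \<odot> x = x \<and> x \<odot> g = x)"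
definition E' :: "'a \<Rightarrow> 'a \<Rightarrow> 'a" where
  "E' f g = (SOME y. g \<odot> y = y \<and> y \<odot> f = y \<and> E f g \<odot> y = f \<and> y \<odot> E f g = g)"
definition ev :: "'a \<Rightarrow> 'a \<Rightarrow> 'k" where "ev f x = (THE c. f \<odot> (x \<odot> f) = scale c f)"
definition \<kappa> :: "'a \<Rightarrow> 'a \<Rightarrow> 'a \<Rightarrow> 'k" where "\<kappa> f g x = ev f (x \<odot> E' f g)"
definition R :: "('a \<times> 'a) set" where "R = {(f, g). f \<in> X \<and> g \<in> X \<and> linked f g}"
definition d :: "'a \<Rightarrow> nat" where "d f = card {g \<in> X. linked f g}"

lemma E: assumes "f \<in> X" "g \<in> X" "linked f g"
  shows E_nonzero: "E f g \<noteq> 0" and E_left: "f \<odot> E f g = E f g" and E_right: "E f g \<odot> g = E f g"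
proof -
  obtain x where x: "f \<odot> (x \<odot> g) \<noteq> 0" using assms by (auto simp: linked_def)
  have "\<exists>x. x \<noteq> 0 \<and> f \<odot> x = x \<and> x \<odot> g = x"
    by (rule exI[of _ "f \<odot> (x \<odot> g)"]) (simp add: x m_assoc minimal_idem minimal_idem' minX assms)
  from someI_ex[OF this] show "E f g \<noteq> 0" "f \<odot> E f g = E f g" "E f g \<odot> g = E f g" by (simp_all add: E_def)
qed

lemma E': assumes "f \<in> X" "g \<in> X" "linked f g"
  shows E'_left: "g \<odot> E' f g = E' f g" and E'_right: "E' f g \<odot> f = E' f g"
    and E_E': "E f g \<odot> E' f g = f" and E'_E: "E' f g \<odot> E f g = g"
proof -
  have "\<exists>y. g \<odot> y = y \<and> y \<odot> f = y \<and> E f g \<odot> y = f \<and> y \<odot> E f g = g"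
    by (rule minimal_inverse) (use E[OF assms] minX assms in auto)
  from someI_ex[OF this]
  show "g \<odot> E' f g = E' f g" "E' f g \<odot> f = E' f g" "E f g \<odot> E' f g = f" "E' f g \<odot> E f g = g"
    by (simp_all add: E'_def)
qed

lemma E_assoc: assumes "f \<in> X" "g \<in> X" "linked f g"
  shows "E f g \<odot> (E' f g \<odot> x) = f \<odot> x" "E' f g \<odot> (E f g \<odot> x) = g \<odot> x" 
  using E_E'[OF assms] E'_E[OF assms] by (simp_all flip: m_assoc)

lemma linked_refl: "f \<in> X \<Longrightarrow> linked f f"
  unfolding linked_def by (rule exI[of _ f]) (simp add: multX minimal_nonzero minX)

lemma linked_sym: assumes "f \<in> X" "g \<in> X" "linked f g" shows "linked g f"
proof -
  have "g \<odot> (E' f g \<odot> f) = E' f g" using E'[OF assms] by simp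
  moreover have "E' f g \<noteq> 0" using E'_E[OF assms] minimal_nonzero[OF minX[OF assms(2)]] by auto
  ultimately show ?thesis unfolding linked_def by metis
qed

lemma linked_trans: assumes "f \<in> X" "g \<in> X" "h \<in> X" "linked f g" "linked g h" shows "linked f h"
proof -
  have fg: "E' f g \<odot> (E f g \<odot> E g h) = E g h" using assms by (simp add: E_assoc E_left)
  have "f \<odot> ((E f g \<odot> E g h) \<odot> h) = E f g \<odot> E g h"
    using assms by (simp add: m_assoc E_right) (simp add: E_left flip: m_assoc)
  moreover have "E f g \<odot> E g h \<noteq> 0" using fg E_nonzero[of g h] assms by auto
  ultimately show ?thesis unfolding linked_def by metis
qed

lemma d_linked: assumes "f \<in> X" "g \<in> X" "linked f g" shows "d f = d g"
proof -
  have "{h \<in> X. linked f h} = {h \<in> X. linked g h}"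
    using assms linked_trans linked_sym by blast
  then show ?thesis by (simp add: d_def)
qed

lemma d_pos: "f \<in> X \<Longrightarrow> d f > 0"
  using linked_refl finX by (auto simp: d_def card_gt_0_iff)

lemma ev: assumes "f \<in> X" shows "f \<odot> (x \<odot> f) = scale (ev f x) f"
proof -
  have "\<exists>!c. f \<odot> (x \<odot> f) = scale c f"
    using minimal_corner[OF minX[OF assms]] minimal_nonzero[OF minX[OF assms]] by (metis scale_cancel_right)
  from theI'[OF this] show ?thesis by (simp add: ev_def)
qed

lemma ev_eqI: assumes "f \<in> X" "f \<odot> (x \<odot> f) = scale c f" shows "ev f x = c"
  using assms ev[of f x] minimal_nonzero[OF minX[OF assms(1)]] by simp

lemma lfun_ev: assumes "f \<in> X" shows "lfun (ev f)"
  by (rule lfunI; rule ev_eqI[OF assms])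
    (simp_all add: m_add_left m_add_right m_scale_left m_scale_right ev[OF assms] scale_left_distrib)

lemma lfun_\<kappa>: "f \<in> X \<Longrightarrow> lfun (\<kappa> f g)"
  unfolding \<kappa>_def by (rule lfun_comp[OF lfun_ev lmap_right])

lemma corner: assumes "f \<in> X" "g \<in> X" 
  shows "f \<odot> (x \<odot> g) = (if linked f g then scale (\<kappa> f g x) (E f g) else 0)"
proof (cases "linked f g")
  case True
  have "f \<odot> (x \<odot> g) = (f \<odot> ((x \<odot> E' f g) \<odot> f)) \<odot> E f g"
    by (simp add: m_assoc E_left E'_E assms True)
  also have "... = scale (\<kappa> f g x) (E f g)"
    by (simp add: ev assms m_scale_left E_left True \<kappa>_def)
  finally show ?thesis by (simp add: True)
qed (simp add: linked_def)

lemma finR: "finite R"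
  by (rule finite_subset[of _ "X \<times> X"]) (auto simp: R_def finX)

lemma RD: "(f, g) \<in> R \<Longrightarrow> f \<in> X" "(f, g) \<in> R \<Longrightarrow> g \<in> X" "(f, g) \<in> R \<Longrightarrow> linked f g"
  by (auto simp: R_def)

lemma sum_R: "(\<Sum>(f, g)\<in>R. h f g) = (\<Sum>f\<in>X. \<Sum>g | g \<in> X \<and> linked f g. h f g)"
  by (subst sum.Sigma) (auto simp: finX R_def intro!: sum.cong)

lemma peirce_expansion: "x = (\<Sum>(f, g)\<in>R. scale (\<kappa> f g x) (E f g))"
proof -
  have "x = u \<odot> (x \<odot> u)" by (simp add: unit_left unit_right)
  also have "... = (\<Sum>f\<in>X. \<Sum>g\<in>X. f \<odot> (x \<odot> g))"
    by (subst (1 2) sumX[symmetric], simp only: m_sum_left m_sum_right) (rule sum.swap)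
  also have "... = (\<Sum>f\<in>X. \<Sum>g\<in>X. if linked f g then scale (\<kappa> f g x) (E f g) else 0)"
    by (intro sum.cong refl corner)
  also have "... = (\<Sum>(f, g)\<in>R. scale (\<kappa> f g x) (E f g))"
    unfolding sum_R by (rule sum.cong[OF refl]) (simp add: sum.If_cases finX Int_def)
  finally show ?thesis .
qed

lemma trace_peirce: assumes T: "lmap T" shows "trace T = (\<Sum>(f, g)\<in>R. \<kappa> f g (T (E f g)))"
  using trace_dual_system[OF T, of R "\<lambda>p. \<kappa> (fst p) (snd p)" "\<lambda>p. E (fst p) (snd p)"]
  peirce_expansion RD lfun_\<kappa> by (force simp: case_prod_unfold)

lemma \<kappa>_mult_E: assumes "(f, g) \<in> R" shows "\<kappa> f g (x \<odot> E f g) = ev f x"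
  using RD[OF assms] by (simp add: \<kappa>_def m_assoc E_E') (simp add: ev_def m_assoc minimal_idem minX)

text \<open>
  The regular character is \<open>d\<close> times the matrix trace on a block of size \<open>d\<close>.
\<close>

lemma \<tau>_peirce: "\<tau> x = (\<Sum>f\<in>X. of_nat (d f) * ev f x)"
proof -
  have "\<tau> x = (\<Sum>(f, g)\<in>R. ev f x)"
    unfolding \<tau>_def trace_peirce[OF lmap_left] by (rule sum.cong) (auto simp: \<kappa>_mult_E)
  also have "... = (\<Sum>f\<in>X. of_nat (d f) * ev f x)" by (simp add: sum_R d_def)
  finally show ?thesis .
qed

lemma \<tau>_idempotent: assumes "f \<in> X" shows "\<tau> f = of_nat (d f)"
proof -
  have "ev g f = (if g = f then 1 else 0)" if "g \<in> X" for g
    by (rule ev_eqI[OF that]) (auto simp add: multX assms that)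
  then have "\<tau> f = (\<Sum>g\<in>X. if g = f then of_nat (d g) else 0)"
    unfolding \<tau>_peirce by (intro sum.cong) auto
  then show ?thesis using assms finX by simp
qed

lemma \<tau>_E': assumes "(f, g) \<in> R" shows "\<tau> (E' f g \<odot> x) = of_nat (d f) * \<kappa> f g x"
proof -
  note fg = RD[OF assms]
  have "ev h (x \<odot> E' f g) = (if h = f then \<kappa> f g x else 0)" if h: "h \<in> X" for h
  proof -
    have "E' f g \<odot> h = (if h = f then E' f g else 0)"
      using E'_right[OF fg] multX[OF fg(1) h] by (metis m_assoc m_0_right)
    then show ?thesis
      by (auto simp: \<kappa>_def m_assoc intro!: ev_eqI h)
  qed
  then have "\<tau> (x \<odot> E' f g) = (\<Sum>h\<in>X. if h = f then of_nat (d f) * \<kappa> f g x else 0)"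
    unfolding \<tau>_peirce by (intro sum.cong) auto
  then show ?thesis using fg finX by (simp add: \<tau>_comm[of "E' f g"])
qed

lemma expand_E: "(\<Sum>(f, g)\<in>R. scale (1 / of_nat (d f) * \<tau> (E' f g \<odot> x)) (E f g)) = x"
proof -
  have "(\<Sum>(f, g)\<in>R. scale (1 / of_nat (d f) * \<tau> (E' f g \<odot> x)) (E f g)) = (\<Sum>(f, g)\<in>R. scale (\<kappa> f g x) (E f g))"
    using d_pos RD by (intro sum.cong) (force simp: \<tau>_E')+
  then show ?thesis using peirce_expansion by simp
qed

lemma expand_E': "(\<Sum>(f, g)\<in>R. scale (1 / of_nat (d f) * \<tau> (y \<odot> E f g)) (E' f g)) = y"
  using dual_expansion[where I = R and c = "\<lambda>p. 1 / of_nat (d (fst p))" and w = "\<lambda>p. E' (fst p) (snd p)" and v = "\<lambda>p. E (fst p) (snd p)" and y = y]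
    expand_E by (simp add: case_prod_unfold)

text \<open>
  All Casimir tensors for \<open>\<tau>\<close> agree, so an arbitrary one may be replaced by the tensor
  \<open>\<Sum> (c/d) E \<otimes> E'\<close> inside every bilinear form.
\<close>

lemma casimir_sum:
  assumes C: "\<And>x. (\<Sum>(a, b)\<leftarrow>C. scale (\<tau> (b \<odot> x)) a) = scale c x"
    and F1: "\<And>y. lfun (\<lambda>x. F x y)" and F2: "\<And>x. lfun (F x)"
  shows "(\<Sum>(a, b)\<leftarrow>C. F a b) = (\<Sum>(f, g)\<in>R. c / of_nat (d f) * F (E f g) (E' f g))"
proof -
  have swap: "(\<Sum>p\<leftarrow>C. \<Sum>q\<in>R. h p q) = (\<Sum>q\<in>R. \<Sum>p\<leftarrow>C. h p q)" for h :: "_ \<Rightarrow> _ \<Rightarrow> 'k"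
    by (induction C) (simp_all add: sum.distrib)
  have pull: "k * (\<Sum>p\<leftarrow>C. h p) = (\<Sum>p\<leftarrow>C. k * h p)" for h :: "_ \<Rightarrow> 'k" and k
    by (induction C) (simp_all add: distrib_left)
  have F: "F a b = (\<Sum>q\<in>R. 1 / of_nat (d (fst q)) * (\<tau> (b \<odot> E (fst q) (snd q)) * F a (E' (fst q) (snd q))))" for a b
  proof -
    have "F a b = F a (\<Sum>(f, g)\<in>R. scale (1 / of_nat (d f) * \<tau> (b \<odot> E f g)) (E' f g))" by (simp only: expand_E')
    then show ?thesis by (simp add: lfun_sum[OF F2] lfun_scale[OF F2] case_prod_unfold)
  qed
  have "(\<Sum>(a, b)\<leftarrow>C. F a b) = (\<Sum>p\<leftarrow>C. F (fst p) (snd p))"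
    by (simp add: case_prod_unfold)
  also have "... = (\<Sum>p\<leftarrow>C. \<Sum>q\<in>R. 1 / of_nat (d (fst q)) * (\<tau> (snd p \<odot> E (fst q) (snd q)) * F (fst p) (E' (fst q) (snd q))))"
    by (rule arg_cong[where f = sum_list], rule map_cong[OF refl], rule F)
  also have "... = (\<Sum>q\<in>R. 1 / of_nat (d (fst q)) * (\<Sum>p\<leftarrow>C. F (scale (\<tau> (snd p \<odot> E (fst q) (snd q))) (fst p)) (E' (fst q) (snd q))))"
    unfolding swap pull lfun_scale[OF F1] by simp
  also have "... = (\<Sum>q\<in>R. 1 / of_nat (d (fst q)) * (F (scale c (E (fst q) (snd q))) (E' (fst q) (snd q))))"
    using C by (simp add: case_prod_unfold flip: lfun_sum_list[OF F1])
  also have "... = (\<Sum>(f, g)\<in>R. c / of_nat (d f) * F (E f g) (E' f g))"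
    by (simp add: lfun_scale[OF F1] case_prod_unfold)
  finally show ?thesis .
qed

end

section \<open>Integrality of power sums\<close>

text \<open>
  Multiplying the weights by the integer linear polynomial \<open>b x - a\<close> that vanishes at
  \<open>v1 = a/b\<close> keeps all power sums integral and removes \<open>v1\<close>.
\<close>

lemma annihilate_other_values:
  fixes W :: "rat \<Rightarrow> rat"
  assumes "finite V" "v0 \<in> V" "W v0 \<noteq> 0" "\<And>k. (\<Sum>v\<in>V. W v * v ^ k) \<in> \<int>"
  shows "\<exists>c. c \<noteq> 0 \<and> (\<forall>k. c * v0 ^ k \<in> \<int>)"
  using assms
proof (induction "card V" arbitrary: V W)
  case 0
  then show ?case by simp
next
  case (Suc n)
  show ?case
  proof (cases "V = {v0}")
    case True
    then show ?thesis using Suc(5,6) by (intro exI[of _ "W v0"]) simp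
  next
    case False
    then obtain v1 where v1: "v1 \<in> V" "v1 \<noteq> v0" using Suc(4) by blast
    obtain a b where ab: "quotient_of v1 = (a, b)" by (cases "quotient_of v1")
    then have b: "b > 0" "v1 = of_int a / of_int b" using quotient_of_denom_pos quotient_of_div by blast+
    \<comment> \<open>\<open>v1\<close> is a root of this linear factor.\<close>
    define W' where "W' v = W v * (of_int b * v - of_int a)" for v
    have "(\<Sum>v\<in>V - {v1}. W' v * v ^ k) \<in> \<int>" for k
    proof -
      have "W' v1 = 0" using b by (simp add: W'_def)
      then have "(\<Sum>v\<in>V - {v1}. W' v * v ^ k) = (\<Sum>v\<in>V. W' v * v ^ k)"
        using v1 Suc(3) by (simp add: sum.remove)
      also have "... = of_int b * (\<Sum>v\<in>V. W v * v ^ Suc k) - of_int a * (\<Sum>v\<in>V. W v * v ^ k)"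
        by (simp add: W'_def sum_distrib_left algebra_simps flip: sum_subtractf)
      also have "... \<in> \<int>" by (intro Ints_diff Ints_mult Suc(6)) auto
      finally show ?thesis .
    qed
    moreover have "W' v0 \<noteq> 0"
    proof -
      have "of_int b * v0 - of_int a = of_int b * (v0 - v1)" using b by (simp add: field_simps)
      then show ?thesis using b v1 Suc(5) by (simp add: W'_def)
    qed
    moreover have "n = card (V - {v1})" using Suc(2,3) v1 by simp
    ultimately show ?thesis using Suc(1)[of "V - {v1}" W'] Suc(3,4) v1 by auto
  qed
qed

lemma bounded_denominators_imp_int:
  fixes v c :: rat
  assumes c: "c \<noteq> 0" and i: "\<And>k. c * v ^ k \<in> \<int>"
  shows "v \<in> \<int>"
proof -
  obtain a b where ab: "quotient_of v = (a, b)" by (cases "quotient_of v")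
  then have b: "b > 0" "v = of_int a / of_int b" "coprime a b"
    using quotient_of_denom_pos quotient_of_div quotient_of_coprime by blast+
  obtain p q where pq: "quotient_of c = (p, q)" by (cases "quotient_of c")
  then have q: "q > 0" "c = of_int p / of_int q" using quotient_of_denom_pos quotient_of_div by blast+
  have p: "p \<noteq> 0" using c q by auto
  have dv: "b ^ k dvd p" for k
  proof -
    obtain z where z: "c * v ^ k = of_int z" using i[of k] by (auto elim: Ints_cases)
    have "of_int (p * a ^ k) = (of_int (z * q * b ^ k) :: rat)"
      using z b(1) q by (simp add: b(2) power_divide field_simps)
    then have "p * a ^ k = z * q * b ^ k" by (simp only: of_int_eq_iff)
    then have "b ^ k dvd p * a ^ k" by simp
    then show ?thesis using b(3) by (simp add: coprime_commute coprime_dvd_mult_left_iff)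
  qed
  have "b = 1"
  proof (rule ccontr)
    assume "b \<noteq> 1"
    then have "b \<ge> 2" using b(1) by simp
    define k where "k = nat \<bar>p\<bar>"
    have "b ^ k \<le> \<bar>p\<bar>" using dvd_imp_le_int[OF p dv[of k]] b(1) by simp
    moreover have "(2::int) ^ k \<le> b ^ k" using \<open>b \<ge> 2\<close> by (intro power_mono) auto
    moreover have "int k < 2 ^ k" by (metis of_nat_less_two_power)
    ultimately show False by (simp add: k_def)
  qed
  then show ?thesis using b by simp
qed

lemma dvd_of_power_sums_algebraic_int:
  fixes w d :: "'i \<Rightarrow> nat" and n :: nat
  assumes fin: "finite I" and w: "\<And>i. i \<in> I \<Longrightarrow> w i > 0" and d: "\<And>i. i \<in> I \<Longrightarrow> d i > 0" and n: "n > 0"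
    and s: "\<And>k. algebraic_int (\<Sum>i\<in>I. of_nat (w i) * (of_nat n / of_nat (d i) :: 'k::field_char_0) ^ (2 * Suc k))"
    and i: "i0 \<in> I"
  shows "d i0 dvd n"
proof -
  define r where "r i = (of_nat n / of_nat (d i) :: rat)\<^sup>2" for i
  define W where "W v = (\<Sum>i | i \<in> I \<and> r i = v. of_nat (w i) * v)" for v
  have "(\<Sum>v\<in>r ` I. W v * v ^ k) \<in> \<int>" for k
  proof -
    have "(\<Sum>v\<in>r ` I. W v * v ^ k) = (\<Sum>v\<in>r ` I. \<Sum>i | i \<in> I \<and> r i = v. of_nat (w i) * r i ^ Suc k)"
      unfolding W_def by (rule sum.cong[OF refl], subst sum_distrib_right, rule sum.cong) auto
    also have "... = (\<Sum>i\<in>I. of_nat (w i) * r i ^ Suc k)"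
      by (rule sum.image_gen[OF fin, symmetric])
    finally have e: "(\<Sum>v\<in>r ` I. W v * v ^ k) = (\<Sum>i\<in>I. of_nat (w i) * r i ^ Suc k)" .
    have "of_rat (\<Sum>v\<in>r ` I. W v * v ^ k) = (\<Sum>i\<in>I. of_nat (w i) * (of_nat n / of_nat (d i) :: 'k) ^ (2 * Suc k))"
      unfolding e by (simp only: of_rat_sum of_rat_mult of_rat_power of_rat_divide of_rat_of_nat_eq r_def power_mult)
    then have "algebraic_int (of_rat (\<Sum>v\<in>r ` I. W v * v ^ k) :: 'k)" using s by simp
    then have "(of_rat (\<Sum>v\<in>r ` I. W v * v ^ k) :: 'k) \<in> \<int>"
      by (rule rational_algebraic_int_is_int) (auto simp: Rats_def)
    then obtain z where "of_rat (\<Sum>v\<in>r ` I. W v * v ^ k) = (of_int z :: 'k)" by (auto elim: Ints_cases)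
    then have "(\<Sum>v\<in>r ` I. W v * v ^ k) = of_int z"
      by (metis of_rat_eq_iff of_rat_of_int_eq)
    then show ?thesis by simp
  qed
  moreover have "W (r i0) \<noteq> 0"
  proof -
    have "W (r i0) = r i0 * of_nat (\<Sum>i | i \<in> I \<and> r i = r i0. w i)" 
      by (simp add: W_def sum_distrib_left mult.commute)
    moreover have "(\<Sum>i | i \<in> I \<and> r i = r i0. w i) > 0" using i w fin by (auto simp: sum_pos2)
    then have "(of_nat (\<Sum>i | i \<in> I \<and> r i = r i0. w i) :: rat) \<noteq> 0" by (simp only: of_nat_eq_0_iff)
    moreover have "r i0 \<noteq> 0" using n d[OF i] by (simp add: r_def)
    ultimately show ?thesis by simp
  qed
  ultimately obtain c where "c \<noteq> 0" "\<And>k. c * r i0 ^ k \<in> \<int>"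
    using annihilate_other_values[of "r ` I" "r i0" W] fin i by blast
  then have "r i0 \<in> \<int>" by (rule bounded_denominators_imp_int)
  then obtain z where z: "r i0 = of_int z" by (auto elim: Ints_cases)
  have "(of_int ((int n)\<^sup>2) :: rat) = of_int (z * (int (d i0))\<^sup>2)"
    using z d[OF i] by (simp add: r_def power_divide field_simps)
  then have "(int n)\<^sup>2 = z * (int (d i0))\<^sup>2" by (simp only: of_int_eq_iff)
  then have "(int (d i0))\<^sup>2 dvd (int n)\<^sup>2" by simp
  then show ?thesis by simp
qed

section \<open>Roots of unity\<close>

text \<open>
  Evaluation of a rational polynomial in any field of characteristic zero, which allows elements
  of different fields to be compared.
\<close>

definition rpoly :: "rat poly \<Rightarrow> 'c::field_char_0 \<Rightarrow> 'c" where
  "rpoly p x = poly (map_poly of_rat p) x"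

lemma rpoly_pCons: "rpoly (pCons a p) x = of_rat a + x * rpoly p x"
  by (simp add: rpoly_def map_poly_pCons)
lemma rpoly_0: "rpoly 0 x = 0" by (simp add: rpoly_def)
lemma rpoly_add: "rpoly (p + q) x = rpoly p x + rpoly q x"
  by (induction p q rule: poly_induct2) (simp_all add: rpoly_0 rpoly_pCons of_rat_add algebra_simps)
lemma rpoly_smult: "rpoly (smult c p) x = of_rat c * rpoly p x"
  by (induction p) (simp_all add: rpoly_0 rpoly_pCons of_rat_mult algebra_simps)
lemma rpoly_mult: "rpoly (p * q) x = rpoly p x * rpoly q x"
  by (induction p) (simp_all add: rpoly_0 rpoly_pCons rpoly_add rpoly_smult algebra_simps)
lemma rpoly_1: "rpoly 1 x = 1" using rpoly_pCons[of 1 0 x] by (simp add: rpoly_0 flip: one_pCons)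
lemma rpoly_diff: "rpoly (p - q) x = rpoly p x - rpoly q x"
  using rpoly_add[of "p - q" q x] by simp
lemma rpoly_monom: "rpoly (monom 1 n) x = x ^ n"
  by (induction n) (simp_all add: monom_0 monom_Suc rpoly_pCons rpoly_0)
lemma rpoly_sum: "rpoly (\<Sum>i\<in>I. p i) x = (\<Sum>i\<in>I. rpoly (p i) x)"
  by (induction I rule: infinite_finite_induct) (simp_all add: rpoly_0 rpoly_add)

lemma minimal_polynomial:
  fixes z :: "'c::field_char_0"
  assumes p: "p \<noteq> 0" "rpoly p z = 0"
  obtains f where "f \<noteq> 0" "\<And>q. rpoly q z = 0 \<longleftrightarrow> f dvd q"
proof -
  define Q where "Q f \<longleftrightarrow> f \<noteq> 0 \<and> rpoly f z = 0" for f
  define f where "f = arg_min degree Q"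
  have f: "f \<noteq> 0" "rpoly f z = 0" and min: "\<And>g. g \<noteq> 0 \<Longrightarrow> rpoly g z = 0 \<Longrightarrow> degree f \<le> degree g"
    using arg_min_natI[of Q p degree] arg_min_nat_le[of Q _ degree] p by (auto simp: f_def Q_def)
  have "rpoly q z = 0 \<longleftrightarrow> f dvd q" for q
  proof
    assume q: "rpoly q z = 0"
    have "rpoly (q mod f) z = 0"
      using q f rpoly_add[of "q div f * f" "q mod f" z] by (simp add: rpoly_mult)
    then have "q mod f = 0" using min[of "q mod f"] degree_mod_less[OF f(1), of q] by force
    then show "f dvd q" by auto
  qed (auto simp: dvd_def rpoly_mult f)
  with f(1) show thesis by (rule that)
qed

text \<open>
  A root in the second field of the minimal polynomial over the rationals satisfies exactly the
  same rational polynomial equations.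
\<close>

lemma conjugate_root:
  fixes z :: "'c::field_char_0"
  assumes p: "p \<noteq> 0" "rpoly p z = 0"
  obtains w :: "'k::{alg_closed_field, field_char_0}" where "\<And>q. rpoly q w = 0 \<longleftrightarrow> rpoly q z = 0"
proof -
  obtain f where f: "f \<noteq> 0" "\<And>q. rpoly q z = 0 \<longleftrightarrow> f dvd q" using minimal_polynomial[OF p] by blast
  have nonconst: "degree g > 0" if "g \<noteq> 0" "rpoly g x = 0" for g and x :: "'d::field_char_0"
  proof (rule ccontr)
    assume "\<not> degree g > 0"
    then obtain a where "g = [:a:]" by (metis degree_eq_zeroE gr0I)
    then show False using that by (simp add: rpoly_pCons rpoly_0)
  qed
  have "rpoly f z = 0" using f(2) by simp
  then have "degree (map_poly of_rat f :: 'k poly) > 0" using nonconst[OF f(1)] by (simp add: degree_map_poly)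
  then obtain w :: 'k where w: "rpoly f w = 0"
    unfolding rpoly_def using alg_closed_imp_poly_has_root by blast
  obtain g where g: "g \<noteq> 0" "\<And>q. rpoly q w = 0 \<longleftrightarrow> g dvd q" using minimal_polynomial[OF f(1) w] by blast
  have "g dvd f" using w g(2) by simp
  then obtain h where h: "f = g * h" by (rule dvdE)
  have "degree g > 0" using nonconst[OF g(1), of w] g(2)[of g] by simp
  have "\<not> f dvd h"
  proof
    assume "f dvd h"
    then have "degree f \<le> degree h" using f(1) h by (intro dvd_imp_degree_le) auto
    moreover have "degree f = degree g + degree h" using f(1) by (simp add: h degree_mult_eq)
    ultimately show False using \<open>degree g > 0\<close> by simp
  qed
  then have "f dvd g" using \<open>rpoly f z = 0\<close> f(2) by (simp add: h rpoly_mult)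
  then have "f dvd q \<longleftrightarrow> g dvd q" for q using \<open>g dvd f\<close> by (meson dvd_trans)
  then show thesis by (intro that[of w]) (simp only: f(2) g(2))
qed

text \<open>
  The complex number \<open>z\<close> is the standard primitive \<open>M\<close>-th root of unity, and \<open>w\<close> is a conjugate of
  it in the given field.  Rational polynomial identities in \<open>w\<close> can therefore be checked in the
  complex numbers, where positivity is available.
\<close>

lemma primitive_root_with_complex_conjugate:
  assumes M: "M > 0"
  obtains w :: "'k::{alg_closed_field, field_char_0}" and z :: complex where
    "w ^ M = 1" "\<forall>k. 0 < k \<longrightarrow> k < M \<longrightarrow> w ^ k \<noteq> 1" "norm z = 1" "\<forall>q. rpoly q w = 0 \<longleftrightarrow> rpoly q z = 0"
proof -
  define z where "z = cis (2 * pi / M)"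
  have zk: "z ^ k = cis (2 * pi * k / M)" for k by (simp add: z_def DeMoivre mult.commute)
  have zM: "z ^ M = 1" using M by (simp add: zk)
  have z1: "z ^ k \<noteq> 1" if "0 < k" "k < M" for k
  proof
    assume "z ^ k = 1"
    then have "cos (2 * pi * k / M) = 1" by (simp add: zk complex_eq_iff)
    then obtain i where "2 * pi * k / M = real_of_int i * 2 * pi" by (auto simp: cos_one_2pi_int)
    then have "real k = real_of_int i * M" using M by (simp add: field_simps)
    then have "int k = i * int M" by (metis of_int_eq_iff of_int_mult of_int_of_nat_eq)
    then show False using that by (metis dvd_triv_right int_dvd_int_iff nat_dvd_not_less)
  qed
  have e: "rpoly (monom 1 k - 1) x = x ^ k - 1" for k and x :: "'c::field_char_0"
    by (simp add: rpoly_diff rpoly_monom rpoly_1)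
  have "monom 1 M - 1 \<noteq> (0 :: rat poly)"
  proof
    assume "monom 1 M - 1 = (0 :: rat poly)"
    then have "degree (monom 1 M :: rat poly) = degree (1 :: rat poly)" by simp
    then show False using M by (simp add: degree_monom_eq)
  qed
  moreover have "rpoly (monom 1 M - 1) z = 0" by (simp add: e zM)
  ultimately obtain w :: 'k where w: "\<And>q. rpoly q w = 0 \<longleftrightarrow> rpoly q z = 0"
    using conjugate_root by blast
  have "w ^ M = 1" using w[of "monom 1 M - 1"] by (simp add: e zM)
  moreover have "w ^ k \<noteq> 1" if "0 < k" "k < M" for k using w[of "monom 1 k - 1"] z1[OF that] by (simp add: e)
  moreover have "norm z = 1" by (simp add: z_def)
  ultimately show thesis using w by (intro that[of w z]) auto
qed

section \<open>Traces of conjugations and powers of the Casimir tensor\<close>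

context trace_form_algebra begin

lemma decomposition_sum:
  assumes "finite J" and "\<And>i j. i \<in> J \<Longrightarrow> j \<in> J \<Longrightarrow> e i \<odot> e j = (if i = j then e i else 0)"
  shows "\<exists>X. orthogonal_decomposition (\<Sum>j\<in>J. e j) X \<and> (\<forall>f\<in>X. \<exists>j\<in>J. e j \<odot> f = f \<and> f \<odot> e j = f)"
  using assms
proof (induction J)
  case empty
  then show ?case by (intro exI[of _ "{}"]) (simp add: orthogonal_decomposition_def)
next
  case (insert i J)
  obtain X where X: "orthogonal_decomposition (\<Sum>j\<in>J. e j) X" "\<forall>f\<in>X. \<exists>j\<in>J. e j \<odot> f = f \<and> f \<odot> e j = f"
    using insert by auto
  obtain Y where Y: "orthogonal_decomposition (e i) Y"
    using decomposition_exists[of "e i"] insert(4)[of i i] by auto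
  have "e i \<odot> e j = 0" "e j \<odot> e i = 0" if "j \<in> J" for j using insert(2) insert(4)[of i j] insert(4)[of j i] that by auto
  then have "e i \<odot> (\<Sum>j\<in>J. e j) = 0" "(\<Sum>j\<in>J. e j) \<odot> e i = 0" by (simp_all add: m_sum_left m_sum_right)
  then have "orthogonal_decomposition (e i + (\<Sum>j\<in>J. e j)) (Y \<union> X)"
    by (rule decomposition_union[OF _ _ Y X(1)])
  moreover have "\<forall>f\<in>Y. e i \<odot> f = f \<and> f \<odot> e i = f" using decomposition_absorbs[OF Y] by blast
  ultimately show ?case using X(2) insert(1,2) by (intro exI[of _ "Y \<union> X"]) auto
qed

end

context peirce begin

text \<open>
  If the minimal idempotents are eigenvectors of \<open>g\<close> and \<open>g'\<close>, then so are the matrix units under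
  \<open>y \<mapsto> g \<odot> y \<odot> g'\<close>.
\<close>

lemma trace_conjugation:
  assumes a: "\<And>f. f \<in> X \<Longrightarrow> g \<odot> f = scale (\<alpha> f) f" and b: "\<And>f. f \<in> X \<Longrightarrow> f \<odot> g' = scale (\<beta> f) f"
  shows "trace (\<lambda>y. x \<odot> (g \<odot> (y \<odot> g'))) = (\<Sum>f\<in>X. \<Sum>h | h \<in> X \<and> linked f h. \<alpha> f * \<beta> h * ev f x)"
proof -
  have l: "lmap (\<lambda>y. x \<odot> (g \<odot> (y \<odot> g')))"
    by (intro lmapI) (simp_all add: m_add_left m_add_right m_scale_left m_scale_right)
  have "x \<odot> (g \<odot> (E f h \<odot> g')) = scale (\<alpha> f * \<beta> h) (x \<odot> E f h)" if "(f, h) \<in> R" for f h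
  proof -
    note fh = RD[OF that]
    have 1: "E f h \<odot> g' = scale (\<beta> h) (E f h)"
      using b[OF fh(2)] E_right[OF fh] by (metis m_assoc m_scale_right)
    have 2: "g \<odot> E f h = scale (\<alpha> f) (E f h)"
      using a[OF fh(1)] E_left[OF fh] by (metis m_assoc m_scale_left)
    show ?thesis by (simp add: 1 2 m_scale_right mult.commute)
  qed
  then have "trace (\<lambda>y. x \<odot> (g \<odot> (y \<odot> g'))) = (\<Sum>(f, h)\<in>R. \<alpha> f * \<beta> h * ev f x)"
    unfolding trace_peirce[OF l] 
    by (intro sum.cong refl) (auto simp: lfun_scale[OF lfun_\<kappa>] RD \<kappa>_mult_E)
  then show ?thesis by (simp add: sum_R)
qed

lemma R_sym: "(f, g) \<in> R \<Longrightarrow> (g, f) \<in> R" by (auto simp: R_def linked_sym)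

text \<open>
  The double sum is the sum over all blocks of the squared absolute value of the block sum of
  \<open>z\<close>.  The division by the block size in the proof lets the sum over blocks be written as a sum
  over idempotents.
\<close>

lemma block_sums_vanish:
  fixes z :: "'a \<Rightarrow> complex"
  assumes "(\<Sum>f\<in>X. \<Sum>h | h \<in> X \<and> linked f h. z f * cnj (z h)) = 0" and f: "f \<in> X"
  shows "(\<Sum>h | h \<in> X \<and> linked f h. z h) = 0"
proof -
  define B where "B f = {h. h \<in> X \<and> linked f h}" for f
  have fB: "finite (B f)" for f using finX by (simp add: B_def)
  have B: "B h = B f" if "f \<in> X" "h \<in> B f" for f h
    using that linked_trans linked_sym unfolding B_def by blast
  have self: "f \<in> B f" if "f \<in> X" for f using that linked_refl by (simp add: B_def)
  define t where "t f = (\<Sum>h\<in>B f. z h)" for f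
  have tB: "t h = t f" if "f \<in> X" "h \<in> B f" for f h using B[OF that] by (simp add: t_def)
  have "(\<Sum>f\<in>X. z f * cnj (t f)) = 0" using assms(1) by (simp add: t_def B_def sum_distrib_left)
  also have "(\<Sum>f\<in>X. z f * cnj (t f)) = (\<Sum>f\<in>X. \<Sum>h\<in>B f. z f * cnj (t f) / of_nat (card (B h)))"
  proof (intro sum.cong refl)
    fix f assume "f \<in> X"
    moreover have "card (B f) \<noteq> 0" using self[OF \<open>f \<in> X\<close>] fB by auto
    moreover have "(\<Sum>h\<in>B f. z f * cnj (t f) / of_nat (card (B h))) = (\<Sum>h\<in>B f. z f * cnj (t f) / of_nat (card (B f)))"
      by (intro sum.cong refl) (simp add: B[OF \<open>f \<in> X\<close>])
    ultimately show "z f * cnj (t f) = (\<Sum>h\<in>B f. z f * cnj (t f) / of_nat (card (B h)))" by simp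
  qed
  also have "... = (\<Sum>(f, h)\<in>R. z f * cnj (t f) / of_nat (card (B h)))" by (simp add: sum_R B_def)
  also have "... = (\<Sum>(h, f)\<in>R. z f * cnj (t f) / of_nat (card (B h)))"
    by (rule sum.reindex_bij_witness[of _ prod.swap prod.swap]) (auto simp: R_sym)
  also have "... = (\<Sum>h\<in>X. \<Sum>f\<in>B h. z f * cnj (t f) / of_nat (card (B h)))" by (simp add: sum_R B_def)
  also have "... = (\<Sum>h\<in>X. \<Sum>f\<in>B h. z f * cnj (t h) / of_nat (card (B h)))"
    by (intro sum.cong refl) (simp add: tB)
  also have "... = (\<Sum>h\<in>X. of_real ((norm (t h))\<^sup>2 / real (card (B h))))"
  proof (rule sum.cong[OF refl])
    fix h assume "h \<in> X"
    have "(\<Sum>f\<in>B h. z f * k / c) = (\<Sum>f\<in>B h. z f) * k / c" for k c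
      by (simp add: sum_distrib_right sum_divide_distrib)
    then have "(\<Sum>f\<in>B h. z f * cnj (t h) / of_nat (card (B h))) = t h * cnj (t h) / of_nat (card (B h))"
      unfolding t_def .
    then show "(\<Sum>f\<in>B h. z f * cnj (t h) / of_nat (card (B h))) = of_real ((norm (t h))\<^sup>2 / real (card (B h)))"
      by (simp only: of_real_divide complex_norm_square of_real_of_nat_eq)
  qed
  finally have "complex_of_real (\<Sum>h\<in>X. (norm (t h))\<^sup>2 / real (card (B h))) = 0" by (simp only: of_real_sum)
  then have "(\<Sum>h\<in>X. (norm (t h))\<^sup>2 / real (card (B h))) = 0" by (simp only: of_real_eq_0_iff)
  then have "(norm (t f))\<^sup>2 / real (card (B f)) = 0"
    using f finX by (subst (asm) sum_nonneg_eq_0_iff) auto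
  moreover have "card (B f) \<noteq> 0" using self[OF f] fB by auto
  ultimately show ?thesis by (simp add: t_def B_def)
qed

text \<open>
  On a block of size \<open>d\<close> the Casimir tensor is \<open>c/d\<close> times the flip \<open>\<Sum> E \<otimes> E'\<close>, and the square of
  the flip is the identity.  In the product of two matrix units \<open>E h k \<odot> E f g\<close>, paired with
  \<open>E' h k \<odot> E' f g\<close>, only \<open>(h, k) = (g, f)\<close> survives.
\<close>

lemma casimir_square:
  assumes C: "\<And>x. (\<Sum>(a, b)\<leftarrow>C. scale (\<tau> (b \<odot> x)) a) = scale c x" and B: "bilinear_form scale B"
  shows "(\<Sum>(a, b)\<leftarrow>C. \<Sum>(a', b')\<leftarrow>C. B (a' \<odot> (a \<odot> x)) (b' \<odot> (b \<odot> y)))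
    = (\<Sum>(f, g)\<in>R. (c / of_nat (d f))\<^sup>2 * B (f \<odot> x) (g \<odot> y))"
proof -
  have B1: "lfun (\<lambda>x. B x y)" and B2: "lfun (B x)" for x y using B by (auto simp: bilinear_form_def)
  have one: "(\<Sum>(a, b)\<leftarrow>C. B (a \<odot> x) (b \<odot> y)) = (\<Sum>(f, g)\<in>R. c / of_nat (d f) * B (E f g \<odot> x) (E' f g \<odot> y))" for x y
    by (rule casimir_sum[OF C]) (rule lfun_comp[OF B1 lmap_right], rule lfun_comp[OF B2 lmap_right])
  have two: "(\<Sum>(a, b)\<leftarrow>C. \<Sum>(h, k)\<in>R. c / of_nat (d h) * B (E h k \<odot> (a \<odot> x)) (E' h k \<odot> (b \<odot> y)))
    = (\<Sum>(f, g)\<in>R. c / of_nat (d f) * (\<Sum>(h, k)\<in>R. c / of_nat (d h) * B (E h k \<odot> (E f g \<odot> x)) (E' h k \<odot> (E' f g \<odot> y))))"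
    by (rule casimir_sum[OF C]; rule lfunI)
      (simp_all add: m_add_left m_add_right m_scale_left m_scale_right lfun_add[OF B1] lfun_add[OF B2] lfun_scale[OF B1] lfun_scale[OF B2]
        sum.distrib sum_distrib_left algebra_simps case_prod_unfold)
  have "(\<Sum>(h, k)\<in>R. c / of_nat (d h) * B (E h k \<odot> (E f g \<odot> x)) (E' h k \<odot> (E' f g \<odot> y)))
      = c / of_nat (d g) * B (g \<odot> x) (f \<odot> y)" if fg: "(f, g) \<in> R" for f g
  proof -
    note 1 = RD[OF fg] and gf = R_sym[OF fg] note 2 = RD[OF gf]
    have "(\<Sum>(h, k)\<in>R. c / of_nat (d h) * B (E h k \<odot> (E f g \<odot> x)) (E' h k \<odot> (E' f g \<odot> y)))
      = (\<Sum>p\<in>R. if p = (g, f) then c / of_nat (d g) * B (E g f \<odot> (E f g \<odot> x)) (E' g f \<odot> (E' f g \<odot> y)) else 0)"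
    proof (rule sum.cong[OF refl])
      fix p assume "p \<in> R"
      then obtain h k where p: "p = (h, k)" and hk: "(h, k) \<in> R" by (cases p) auto
      note 3 = RD[OF hk]
      have "E h k \<odot> (E f g \<odot> x) = 0" if "k \<noteq> f"
      proof -
        have "E h k \<odot> (E f g \<odot> x) = (E h k \<odot> k) \<odot> ((f \<odot> E f g) \<odot> x)" by (simp add: E_left[OF 1] E_right[OF 3])
        also have "... = E h k \<odot> ((k \<odot> f) \<odot> (E f g \<odot> x))" by (simp only: m_assoc)
        finally show ?thesis using that 1 3 by (simp add: orthX)
      qed
      moreover have "E' h k \<odot> (E' f g \<odot> y) = 0" if "h \<noteq> g"
      proof -
        have "E' h k \<odot> (E' f g \<odot> y) = (E' h k \<odot> h) \<odot> ((g \<odot> E' f g) \<odot> y)" by (simp add: E'_left[OF 1] E'_right[OF 3])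
        also have "... = E' h k \<odot> ((h \<odot> g) \<odot> (E' f g \<odot> y))" by (simp only: m_assoc)
        finally show ?thesis using that 1 3 by (simp add: orthX)
      qed
      ultimately show "(case p of (h, k) \<Rightarrow> c / of_nat (d h) * B (E h k \<odot> (E f g \<odot> x)) (E' h k \<odot> (E' f g \<odot> y)))
        = (if p = (g, f) then c / of_nat (d g) * B (E g f \<odot> (E f g \<odot> x)) (E' g f \<odot> (E' f g \<odot> y)) else 0)"
        by (auto simp: p lfun_0[OF B1] lfun_0[OF B2])
    qed
    also have "... = c / of_nat (d g) * B (E g f \<odot> (E f g \<odot> x)) (E' g f \<odot> (E' f g \<odot> y))"
      using gf finR by simp
    also have "B (E g f \<odot> (E f g \<odot> x)) (E' g f \<odot> (E' f g \<odot> y)) = B (g \<odot> x) (f \<odot> y)"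
    proof -
      have e: "E g f = E g f \<odot> (E f g \<odot> E' f g)" by (simp add: E_E'[OF 1] E_right[OF 2])
      obtain a where a: "g \<odot> ((E g f \<odot> E f g) \<odot> g) = scale a g" using ev 1 by blast
      have aE: "E g f \<odot> E f g = scale a g"
        using a by (simp add: m_assoc E_right[OF 1]) (simp add: E_left[OF 2] flip: m_assoc)
      have Egf: "E g f = scale a (E' f g)"
        by (subst e) (simp add: aE m_scale_left E'_left[OF 1] flip: m_assoc)
      then have a0: "a \<noteq> 0" using E_nonzero[OF 2] by auto
      have "g = scale a (E' f g \<odot> E' g f)" using E_E'[OF 2] by (simp add: Egf m_scale_left)
      then have "E f g \<odot> g = scale a ((E f g \<odot> E' f g) \<odot> E' g f)" by (metis m_assoc m_scale_right)
      then have "E f g = scale a (E' g f)" by (simp add: E_right[OF 1] E_E'[OF 1] E'_left[OF 2])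
      then have "f = scale a (E' g f \<odot> E' f g)" using E_E'[OF 1] by (metis m_scale_left)
      then have b: "E' g f \<odot> E' f g = scale (1 / a) f" using a0 by (metis divide_self_if scale_one scale_scale times_divide_eq_left mult_1)
      have "B (E g f \<odot> (E f g \<odot> x)) (E' g f \<odot> (E' f g \<odot> y)) = B (scale a (g \<odot> x)) (scale (1 / a) (f \<odot> y))"
        by (simp add: aE b m_scale_left flip: m_assoc)
      then show ?thesis using a0 by (simp add: lfun_scale[OF B1] lfun_scale[OF B2])
    qed
    finally show ?thesis .
  qed
  then have "(\<Sum>(f, g)\<in>R. c / of_nat (d f) * (\<Sum>(h, k)\<in>R. c / of_nat (d h) * B (E h k \<odot> (E f g \<odot> x)) (E' h k \<odot> (E' f g \<odot> y))))
    = (\<Sum>(f, g)\<in>R. (c / of_nat (d g))\<^sup>2 * B (g \<odot> x) (f \<odot> y))"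
  proof (intro sum.cong refl)
    fix p assume *: "\<And>f g. (f, g) \<in> R \<Longrightarrow> (\<Sum>(h, k)\<in>R. c / of_nat (d h) * B (E h k \<odot> (E f g \<odot> x)) (E' h k \<odot> (E' f g \<odot> y)))
      = c / of_nat (d g) * B (g \<odot> x) (f \<odot> y)" and "p \<in> R"
    then obtain f g where p: "p = (f, g)" and fg: "(f, g) \<in> R" by (cases p) auto
    show "(case p of (f, g) \<Rightarrow> c / of_nat (d f) * (\<Sum>(h, k)\<in>R. c / of_nat (d h) * B (E h k \<odot> (E f g \<odot> x)) (E' h k \<odot> (E' f g \<odot> y))))
      = (case p of (f, g) \<Rightarrow> (c / of_nat (d g))\<^sup>2 * B (g \<odot> x) (f \<odot> y))"
      unfolding p prod.case *[OF fg] d_linked[OF RD[OF fg]] by (simp add: power2_eq_square)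
  qed
  also have "... = (\<Sum>(f, g)\<in>R. (c / of_nat (d f))\<^sup>2 * B (f \<odot> x) (g \<odot> y))"
    by (rule sum.reindex_bij_witness[of _ prod.swap prod.swap]) (auto simp: R_sym)
  finally show ?thesis by (simp only: one two)
qed

end

context trace_form_algebra begin

text \<open>
  \<open>casimir_iter C r x y\<close> is the value of \<open>\<tau> \<otimes> \<tau>\<close> at \<open>C\<^sup>r (x \<otimes> y)\<close>, where the power is taken in the
  algebra \<open>A \<otimes> A\<close>.
\<close>

primrec casimir_iter :: "('a \<times> 'a) list \<Rightarrow> nat \<Rightarrow> 'a \<Rightarrow> 'a \<Rightarrow> 'k" where
  "casimir_iter C 0 x y = \<tau> x * \<tau> y"
| "casimir_iter C (Suc r) x y = (\<Sum>(a, b)\<leftarrow>C. casimir_iter C r (a \<odot> x) (b \<odot> y))"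

lemma bilinear_casimir_iter: "bilinear_form scale (casimir_iter C r)"
proof -
  have "lfun (casimir_iter C r x) \<and> lfun (\<lambda>x. casimir_iter C r x y)" for x y
  proof (induction r arbitrary: x y)
    case 0
    show ?case by (auto intro!: lfunI simp: lfun_simps[OF lfun_\<tau>] algebra_simps)
  next
    case (Suc r)
    have 1: "lfun (\<lambda>y. casimir_iter C r x (b \<odot> y))" and 2: "lfun (\<lambda>x. casimir_iter C r (b \<odot> x) y)" for x y b 
      using lfun_comp[OF Suc[THEN conjunct1] lmap_left] lfun_comp[OF Suc[THEN conjunct2] lmap_left] .
    have "lfun (\<lambda>x. \<Sum>p\<leftarrow>C'. F p x)" if "\<And>p. lfun (F p)" for C' :: "('a \<times> 'a) list" and F
      by (induction C') (auto intro!: lfunI simp: lfun_simps[OF that] lfun_iff algebra_simps)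
    then show ?case using 1 2 by (simp add: case_prod_unfold)
  qed
  then show ?thesis by (simp add: bilinear_form_def)
qed

end

context peirce begin

lemma casimir_iter_even:
  assumes C: "\<And>x. (\<Sum>(a, b)\<leftarrow>C. scale (\<tau> (b \<odot> x)) a) = scale c x"
  shows "casimir_iter C (2 * Suc k) x y = (\<Sum>(f, g)\<in>R. (c / of_nat (d f)) ^ (2 * Suc k) * (\<tau> (f \<odot> x) * \<tau> (g \<odot> y)))"
proof (induction k arbitrary: x y)
  case 0
  show ?case using casimir_square[OF C bilinear_casimir_iter, of C 0 x y] by (simp add: numeral_2_eq_2)
next
  case (Suc k)
  have "casimir_iter C (2 * Suc (Suc k)) x y = (\<Sum>(f, g)\<in>R. (c / of_nat (d f))\<^sup>2 * casimir_iter C (2 * Suc k) (f \<odot> x) (g \<odot> y))"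
    using casimir_square[OF C bilinear_casimir_iter, of C "2 * Suc k" x y] by simp
  also have "... = (\<Sum>(f, g)\<in>R. (c / of_nat (d f)) ^ (2 * Suc (Suc k)) * (\<tau> (f \<odot> x) * \<tau> (g \<odot> y)))"
  proof (rule sum.cong[OF refl])
    fix p assume "p \<in> R"
    then obtain f g where p: "p = (f, g)" and fg: "(f, g) \<in> R" by (cases p) auto
    note 1 = RD[OF fg]
    have "casimir_iter C (2 * Suc k) (f \<odot> x) (g \<odot> y) 
      = (\<Sum>q\<in>R. if q = (f, g) then (c / of_nat (d f)) ^ (2 * Suc k) * (\<tau> (f \<odot> x) * \<tau> (g \<odot> y)) else 0)"
      unfolding Suc
    proof (rule sum.cong[OF refl])
      fix q assume "q \<in> R"
      then obtain h l where q: "q = (h, l)" and hl: "(h, l) \<in> R" by (cases q) auto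
      show "(case q of (h, l) \<Rightarrow> (c / of_nat (d h)) ^ (2 * Suc k) * (\<tau> (h \<odot> (f \<odot> x)) * \<tau> (l \<odot> (g \<odot> y))))
         = (if q = (f, g) then (c / of_nat (d f)) ^ (2 * Suc k) * (\<tau> (f \<odot> x) * \<tau> (g \<odot> y)) else 0)"
        using RD[OF hl] 1 by (auto simp: q multX' lfun_0[OF lfun_\<tau>])
    qed
    also have "... = (c / of_nat (d f)) ^ (2 * Suc k) * (\<tau> (f \<odot> x) * \<tau> (g \<odot> y))"
      using fg finR by simp
    finally show "(case p of (f, g) \<Rightarrow> (c / of_nat (d f))\<^sup>2 * casimir_iter C (2 * Suc k) (f \<odot> x) (g \<odot> y))
      = (case p of (f, g) \<Rightarrow> (c / of_nat (d f)) ^ (2 * Suc (Suc k)) * (\<tau> (f \<odot> x) * \<tau> (g \<odot> y)))"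
      by (simp add: p power2_eq_square algebra_simps)
  qed
  finally show ?case .
qed

text \<open>
  The idempotent \<open>f\<close> has \<open>\<tau> f = d f\<close>, so each pair of linked idempotents contributes \<open>d\<^sup>2 (n/d)\<^bsup>2k\<^esup>\<close>
  to the even iterates.
\<close>

lemma block_size_dvd:
  assumes C: "\<And>x. (\<Sum>(a, b)\<leftarrow>C. scale (\<tau> (b \<odot> x)) a) = scale (of_nat n) x"
    and int: "\<And>r. algebraic_int (casimir_iter C (Suc r) u u)" and n: "n > 0" and f: "f \<in> X"
  shows "d f dvd n"
proof -
  have "d (fst (f, f)) dvd n"
  proof (rule dvd_of_power_sums_algebraic_int[where I = R and w = "\<lambda>p. (d (fst p))\<^sup>2" and d = "\<lambda>p. d (fst p)"])
    fix k
    have "casimir_iter C (2 * Suc k) u u = (\<Sum>p\<in>R. of_nat ((d (fst p))\<^sup>2) * (of_nat n / of_nat (d (fst p))) ^ (2 * Suc k))"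
      unfolding casimir_iter_even[OF C]
    proof (rule sum.cong[OF refl])
      fix p assume "p \<in> R"
      then obtain f g where p: "p = (f, g)" and fg: "(f, g) \<in> R" by (cases p) auto
      show "(case p of (f, g) \<Rightarrow> (of_nat n / of_nat (d f)) ^ (2 * Suc k) * (\<tau> (f \<odot> u) * \<tau> (g \<odot> u)))
          = of_nat ((d (fst p))\<^sup>2) * (of_nat n / of_nat (d (fst p))) ^ (2 * Suc k)"
        using RD[OF fg] d_linked[OF RD[OF fg]]
        by (simp add: p unit_right \<tau>_idempotent power2_eq_square del: mult_Suc_right power_Suc)
    qed
    then show "algebraic_int (\<Sum>p\<in>R. of_nat ((d (fst p))\<^sup>2) * (of_nat n / of_nat (d (fst p)) :: 'k) ^ (2 * Suc k))"
      using int[of "2 * k + 1"] by simp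
    show "(f, f) \<in> R" using f linked_refl by (simp add: R_def)
  qed (use n d_pos finR in \<open>auto dest: RD(1)\<close>)
  then show ?thesis by simp
qed

text \<open>
  Some minimal idempotent \<open>f\<close> acts nontrivially.  For a vector \<open>w\<close> in its image, the vectors
  \<open>E g f w\<close> with \<open>g\<close> linked to \<open>f\<close> form a basis: they span the cyclic module generated by \<open>w\<close>, and
  \<open>E' h f\<close> picks out their coefficients.
\<close>

lemma irreducible_dim:
  fixes sv :: "'k \<Rightarrow> 'v::ab_group_add \<Rightarrow> 'v"
  assumes irr: "irreducible_representation UNIV scale m u sv \<rho>"
  shows "\<exists>f\<in>X. vector_space.dim sv UNIV = d f"
proof -
  have rep: "vector_space sv" "\<And>a. Vector_Spaces.linear sv sv (\<rho> a)" "\<And>a b v. \<rho> (a + b) v = \<rho> a v + \<rho> b v"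
    "\<And>c a v. \<rho> (scale c a) v = sv c (\<rho> a v)" "\<And>a b v. \<rho> (a \<odot> b) v = \<rho> a (\<rho> b v)" "\<And>v. \<rho> u v = v"
    and ne: "\<exists>v::'v. v \<noteq> 0"
    and sub: "\<And>W. module.subspace sv W \<Longrightarrow> (\<And>a w. w \<in> W \<Longrightarrow> \<rho> a w \<in> W) \<Longrightarrow> W = {0} \<or> W = UNIV"
    using irr by (auto simp: irreducible_representation_def representation_of_def)
  interpret V: vector_space sv by (rule rep(1))
  have lin: "\<rho> a (v + w) = \<rho> a v + \<rho> a w" "\<rho> a (sv c v) = sv c (\<rho> a v)" for a v w c
    using rep(2) by (simp_all add: Vector_Spaces.linear_iff)
  have \<rho>0: "\<rho> 0 v = 0" for v using rep(3)[of 0 0 v] by simp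
  have \<rho>0': "\<rho> a 0 = 0" for a using lin(1)[of a 0 0] by simp
  have \<rho>sum: "\<rho> (\<Sum>i\<in>I. g i) v = (\<Sum>i\<in>I. \<rho> (g i) v)" for g :: "'i \<Rightarrow> 'a" and I v
    by (induction I rule: infinite_finite_induct) (simp_all add: \<rho>0 rep(3))
  have \<rho>sum': "\<rho> a (\<Sum>i\<in>I. g i) = (\<Sum>i\<in>I. \<rho> a (g i))" for g :: "'i \<Rightarrow> 'v" and I a
    by (induction I rule: infinite_finite_induct) (simp_all add: \<rho>0' lin)
  obtain v :: 'v where v: "v \<noteq> 0" using ne by blast
  have "v = (\<Sum>f\<in>X. \<rho> f v)" using \<rho>sum[of "\<lambda>f. f" X v] by (simp add: sumX rep(6))
  then obtain f where f: "f \<in> X" "\<rho> f v \<noteq> 0" using v by (metis sum.neutral)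
  define w where "w = \<rho> f v"
  have w: "w \<noteq> 0" "\<rho> f w = w" using f by (simp_all add: w_def multX flip: rep(5))
  have "V.subspace (range (\<lambda>a. \<rho> a w))"
  proof (rule V.subspaceI)
    show "0 \<in> range (\<lambda>a. \<rho> a w)" by (metis \<rho>0 rangeI)
    fix x y c assume "x \<in> range (\<lambda>a. \<rho> a w)"
    then obtain a where a: "x = \<rho> a w" by blast
    then show "sv c x \<in> range (\<lambda>a. \<rho> a w)" by (simp flip: rep(4))
    assume "y \<in> range (\<lambda>a. \<rho> a w)"
    then obtain b where "y = \<rho> b w" by blast
    then show "x + y \<in> range (\<lambda>a. \<rho> a w)" by (simp add: a flip: rep(3))
  qed
  moreover have "\<rho> a x \<in> range (\<lambda>a. \<rho> a w)" if "x \<in> range (\<lambda>a. \<rho> a w)" for a x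
    using that by (auto simp flip: rep(5))
  ultimately have "range (\<lambda>a. \<rho> a w) = {0} \<or> range (\<lambda>a. \<rho> a w) = UNIV" by (rule sub)
  moreover have "w \<in> range (\<lambda>a. \<rho> a w)" by (rule range_eqI[of _ _ u]) (simp add: rep(6))
  ultimately have cyc: "range (\<lambda>a. \<rho> a w) = UNIV" using w by auto
  define G where "G = {g \<in> X. linked g f}"
  have G: "g \<in> X" "linked g f" "f \<in> X" if "g \<in> G" for g using that f by (auto simp: G_def)
  have fG: "finite G" using finX by (simp add: G_def)
  define b where "b g = \<rho> (E g f) w" for g
  have dual: "\<rho> (E' h f) (b g) = (if g = h then w else 0)" if "g \<in> G" "h \<in> G" for g h
  proof -
    have e: "\<rho> (E' h f) (b g) = \<rho> ((E' h f \<odot> h) \<odot> (g \<odot> E g f)) w"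
      using E_left[of g f] E'_right[of h f] G[OF that(1)] G[OF that(2)] by (simp add: b_def rep(5))
    have "(E' h f \<odot> h) \<odot> (g \<odot> E g f) = E' h f \<odot> ((h \<odot> g) \<odot> E g f)" by (simp only: m_assoc)
    also have "... = (if g = h then f else 0)"
      using G[OF that(1)] G[OF that(2)] E'_E[of h f] E_left[of g f] by (cases "g = h") (simp_all add: multX)
    finally have "\<rho> (E' h f) (b g) = \<rho> (if g = h then f else 0) w" by (simp only: e)
    then show ?thesis by (simp add: w \<rho>0)
  qed
  have inj: "inj_on b G"
  proof (rule inj_onI)
    fix g h assume gh: "g \<in> G" "h \<in> G" "b g = b h"
    have "(if g = h then w else 0) = w"
      using arg_cong[OF gh(3), of "\<rho> (E' h f)"] unfolding dual[OF gh(1,2)] dual[OF gh(2,2)] by simp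
    then show "g = h" using w(1) by (auto split: if_splits)
  qed
  have "V.independent (b ` G)"
  proof
    assume "V.dependent (b ` G)"
    then obtain c where c: "\<exists>x\<in>b ` G. c x \<noteq> 0" "(\<Sum>x\<in>b ` G. sv (c x) x) = 0"
      using V.dependent_finite[of "b ` G"] fG by auto
    then obtain h where h: "h \<in> G" "c (b h) \<noteq> 0" by auto
    have "(\<Sum>g\<in>G. sv (c (b g)) (b g)) = 0" using c(2) by (simp add: sum.reindex[OF inj])
    then have "\<rho> (E' h f) (\<Sum>g\<in>G. sv (c (b g)) (b g)) = 0" by (simp add: \<rho>0')
    then have "(\<Sum>g\<in>G. sv (c (b g)) (if g = h then w else 0)) = 0"
      using dual h(1) by (simp add: \<rho>sum' lin)
    then have "(\<Sum>g\<in>G. if g = h then sv (c (b g)) w else 0) = 0"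
      by (simp add: if_distrib cong: if_cong)
    then have "sv (c (b h)) w = 0" using h fG by simp
    then show False using h w by simp
  qed
  moreover have "V.span (b ` G) = V.span UNIV"
  proof -
    have "\<rho> a w \<in> V.span (b ` G)" for a
    proof -
      have "\<rho> a w = \<rho> (u \<odot> (a \<odot> f)) w" by (simp add: unit_left rep(5) w)
      also have "u \<odot> (a \<odot> f) = (\<Sum>g\<in>X. g \<odot> (a \<odot> f))"
        by (subst sumX[symmetric]) (simp only: m_sum_left)
      also have "... = (\<Sum>g\<in>G. scale (\<kappa> g f a) (E g f))"
        unfolding G_def by (rule sum.mono_neutral_cong_right) (auto simp: finX corner f)
      also have "\<rho> ... w = (\<Sum>g\<in>G. sv (\<kappa> g f a) (b g))" by (simp add: \<rho>sum rep(4) b_def)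
      also have "... \<in> V.span (b ` G)" by (intro V.span_sum V.span_scale V.span_base) auto
      finally show ?thesis .
    qed
    then have "range (\<lambda>a. \<rho> a w) \<subseteq> V.span (b ` G)" by blast
    then have "V.span (b ` G) = UNIV" by (simp only: cyc top.extremum_unique)
    then show ?thesis by (simp add: V.span_UNIV)
  qed
  ultimately have "V.dim UNIV = card (b ` G)" by (intro V.dim_eq_card) auto
  also have "... = card G" by (rule card_image[OF inj])
  also have "G = {g \<in> X. linked f g}" using f linked_sym by (auto simp: G_def)
  finally show ?thesis using f by (auto simp: d_def)
qed

end

context trace_form_algebra begin

theorem irreducible_dim_dvd:
  fixes sv :: "'k \<Rightarrow> 'v::ab_group_add \<Rightarrow> 'v"
  assumes irr: "irreducible_representation UNIV scale m u sv \<rho>"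
    and C: "\<And>x. (\<Sum>(a, b)\<leftarrow>C. scale (\<tau> (b \<odot> x)) a) = scale (of_nat n) x"
    and int: "\<And>r. algebraic_int (casimir_iter C (Suc r) u u)" and n: "n > 0"
  shows "vector_space.dim sv UNIV dvd n"
proof -
  obtain X where "orthogonal_decomposition u X" using decomposition_exists[of u] by (auto simp: unit_left)
  then interpret peirce scale Basis m u X by unfold_locales
  obtain f where "f \<in> X" "vector_space.dim sv UNIV = d f" using irreducible_dim[OF irr] by blast
  then show ?thesis using block_size_dvd[OF C int n] by simp
qed

end

section \<open>Sweedler sums\<close>

locale fd_hopf = hopf_algebra scale \<Delta> \<epsilon> S + fdvs scale Basis
  for scale :: "'k::{alg_closed_field, field_char_0} \<Rightarrow> 'h::ring_1 \<Rightarrow> 'h" and \<Delta> \<epsilon> S and Basis :: "'h set"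
begin

abbreviation bil :: "('h \<Rightarrow> 'h \<Rightarrow> 'k) \<Rightarrow> bool" where "bil F \<equiv> bilinear_form scale F"
abbreviation tril :: "('h \<Rightarrow> 'h \<Rightarrow> 'h \<Rightarrow> 'k) \<Rightarrow> bool" where "tril F \<equiv> trilinear_form scale F"

lemma bilI: "(\<And>x x' y. F (x + x') y = F x y + F x' y) \<Longrightarrow> (\<And>x y y'. F x (y + y') = F x y + F x y') \<Longrightarrow>
    (\<And>c x y. F (scale c x) y = c * F x y) \<Longrightarrow> (\<And>c x y. F x (scale c y) = c * F x y) \<Longrightarrow> bil F"
  by (simp add: bilinear_form_def lfun_iff)

lemma bilD: "bil F \<Longrightarrow> lfun (F x)" "bil F \<Longrightarrow> lfun (\<lambda>x. F x y)"
  by (simp_all add: bilinear_form_def)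

lemma bil_simps: assumes "bil F"
  shows "F (x + x') y = F x y + F x' y" "F x (y + y') = F x y + F x y'"
    "F (scale c x) y = c * F x y" "F x (scale c y) = c * F x y"
  using assms by (simp_all add: bilinear_form_def lfun_iff)

lemma trilI: "(\<And>x x' y z. F (x + x') y z = F x y z + F x' y z) \<Longrightarrow> (\<And>x y y' z. F x (y + y') z = F x y z + F x y' z) \<Longrightarrow>
    (\<And>x y z z'. F x y (z + z') = F x y z + F x y z') \<Longrightarrow> (\<And>c x y z. F (scale c x) y z = c * F x y z) \<Longrightarrow>
    (\<And>c x y z. F x (scale c y) z = c * F x y z) \<Longrightarrow> (\<And>c x y z. F x y (scale c z) = c * F x y z) \<Longrightarrow> tril F"
  by (simp add: trilinear_form_def lfun_iff)

lemma lfun_\<epsilon>: "lfun \<epsilon>" by (rule counit_linear)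
lemma lmap_S: "lmap S" by (rule antipode_linear)

lemma bil_prod: "lfun f \<Longrightarrow> lfun g \<Longrightarrow> bil (\<lambda>x y. f x * g y)"
  by (rule bilI) (simp_all add: lfun_add lfun_scale algebra_simps)

text \<open>
  The coproduct in coordinates.  Since \<open>cf i j\<close> is a linear functional, the Sweedler sum \<open>sw x F\<close>
  defined with it is linear in \<open>x\<close> for every \<open>F\<close>, while the sum over the list \<open>\<Delta> x\<close> is linear only
  when \<open>F\<close> is bilinear; for bilinear \<open>F\<close> the two agree.
\<close>

definition cf :: "'h \<Rightarrow> 'h \<Rightarrow> 'h \<Rightarrow> 'k" where
  "cf i j x = (\<Sum>(a, b)\<leftarrow>\<Delta> x. coord i a * coord j b)"

definition sw :: "'h \<Rightarrow> ('h \<Rightarrow> 'h \<Rightarrow> 'k) \<Rightarrow> 'k" where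
  "sw x F = (\<Sum>i\<in>Basis. \<Sum>j\<in>Basis. cf i j x * F i j)"

lemma sum_list_swap: "(\<Sum>p\<leftarrow>xs. \<Sum>i\<in>I. h p i) = (\<Sum>i\<in>I. \<Sum>p\<leftarrow>xs. h p i)" for h :: "_ \<Rightarrow> _ \<Rightarrow> 'k"
  by (induction xs) (simp_all add: sum.distrib)

lemma sum_list_concat_map: "(\<Sum>z\<leftarrow>concat (map G xs). h z) = (\<Sum>p\<leftarrow>xs. \<Sum>z\<leftarrow>G p. h z)" for h :: "_ \<Rightarrow> 'k"
  by (induction xs) simp_all

lemma sum_list_mult_left: "(\<Sum>p\<leftarrow>xs. c * h p) = c * (\<Sum>p\<leftarrow>xs. h p)" for h :: "_ \<Rightarrow> 'k"
  by (induction xs) (simp_all add: algebra_simps)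

lemma sum_list_mult: "(\<Sum>p\<leftarrow>xs. h p * c) = (\<Sum>p\<leftarrow>xs. h p) * c" for h :: "_ \<Rightarrow> 'k"
  by (induction xs) (simp_all add: algebra_simps)

lemma bil_expand: assumes F: "bil F" shows "F x y = (\<Sum>i\<in>Basis. \<Sum>j\<in>Basis. coord i x * coord j y * F i j)"
proof -
  have "F x y = (\<Sum>i\<in>Basis. coord i x * F i y)" by (rule lfun_expand[OF bilD(2)[OF F]])
  also have "... = (\<Sum>i\<in>Basis. coord i x * (\<Sum>j\<in>Basis. coord j y * F i j))"
    by (rule sum.cong[OF refl], subst lfun_expand[OF bilD(1)[OF F]]) (rule refl)
  finally show ?thesis by (simp add: sum_distrib_left mult.assoc)
qed

lemma sw_list: assumes F: "bil F" shows "(\<Sum>(a, b)\<leftarrow>\<Delta> x. F a b) = sw x F"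
proof -
  have "(\<Sum>(a, b)\<leftarrow>\<Delta> x. F a b) = (\<Sum>p\<leftarrow>\<Delta> x. \<Sum>i\<in>Basis. \<Sum>j\<in>Basis. coord i (fst p) * coord j (snd p) * F i j)"
    by (simp only: case_prod_unfold bil_expand[OF F, of "fst _" "snd _"])
  also have "... = sw x F" by (simp add: sw_def cf_def sum_list_swap sum_list_mult case_prod_unfold)
  finally show ?thesis .
qed

lemma cf_add: "cf i j (x + y) = cf i j x + cf i j y"
  using comult_add[of x y] bil_prod[OF lfun_coord lfun_coord, of i j]
  by (simp add: tensor2_eq_def cf_def)

lemma cf_scale: "cf i j (scale c x) = c * cf i j x"
proof -
  have "cf i j (scale c x) = (\<Sum>(a, b)\<leftarrow>[(scale c a, b). (a, b) \<leftarrow> \<Delta> x]. coord i a * coord j b)"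
    using comult_scale[of c x] bil_prod[OF lfun_coord lfun_coord, of i j]
    by (simp add: tensor2_eq_def cf_def)
  also have "... = c * cf i j x"
    by (simp add: cf_def case_prod_unfold comp_def coord_scale mult.assoc flip: sum_list_mult_left)
  finally show ?thesis .
qed

lemma sw_add: "sw (x + y) F = sw x F + sw y F"
  by (simp add: sw_def cf_add distrib_right sum.distrib)
lemma sw_scale: "sw (scale c x) F = sw x (\<lambda>a b. c * F a b)"
  by (simp only: sw_def cf_scale mult.assoc mult.left_commute)
lemma sw_plus: "sw x (\<lambda>a b. F a b + G a b) = sw x F + sw x G"
  by (simp add: sw_def distrib_left sum.distrib)
lemma sw_minus: "sw x (\<lambda>a b. F a b - G a b) = sw x F - sw x G"
  by (simp add: sw_def right_diff_distrib sum_subtractf)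
lemma sw_push_left: "c * sw x F = sw x (\<lambda>a b. c * F a b)"
  by (simp only: sw_def sum_distrib_left mult.left_commute)
lemma sw_push_right: "sw x F * c = sw x (\<lambda>a b. F a b * c)"
  by (simp only: sw_def sum_distrib_right mult.assoc)
lemma sw_sum: "sw x (\<lambda>a b. \<Sum>i\<in>I. F i a b) = (\<Sum>i\<in>I. sw x (F i))"
  by (induction I rule: infinite_finite_induct) (simp_all add: sw_plus, simp_all add: sw_def)
lemma sw_pairs: "sw x F = (\<Sum>p\<in>Basis \<times> Basis. cf (fst p) (snd p) x * F (fst p) (snd p))"
  by (simp add: sw_def sum.cartesian_product case_prod_unfold)
lemma sw_exchange: "sw x (\<lambda>a b. sw y (F a b)) = sw y (\<lambda>c d. sw x (\<lambda>a b. F a b c d))"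
  unfolding sw_pairs sum_distrib_left by (subst sum.swap) (simp add: mult.left_commute)

lemma sw_cong: "(\<And>a b. F a b = G a b) \<Longrightarrow> sw x F = sw x G" by presburger

lemma lfun_sw: "lfun (\<lambda>x. sw x F)"
  by (rule lfunI) (simp_all add: sw_add sw_scale sw_push_left)

text \<open>
  These rules decide that an expression is linear in one of its arguments: sums are distributed
  and scalars are pushed into the innermost Sweedler sum.
\<close>

lemmas lin_simps = distrib_left distrib_right scale_mult_left scale_mult_right sw_add sw_scale sw_plus
  sw_push_left sw_push_right lfun_simps[OF lfun_\<epsilon>] lmap_simps[OF lmap_S]
  mult.assoc mult.left_commute mult.commute[where 'a = 'k]

lemma sw_mult: assumes F: "bil F"
  shows "sw (x * y) F = sw x (\<lambda>a b. sw y (\<lambda>c d. F (a * c) (b * d)))"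
proof -
  note l = bil_simps[OF F]
  have b: "bil (\<lambda>c d. F (a * c) (b * d))" for a b by (rule bilI) (simp_all add: lin_simps l)
  have b2: "bil (\<lambda>a b. sw y (\<lambda>c d. F (a * c) (b * d)))" by (rule bilI) (simp_all add: lin_simps l)
  have "sw (x * y) F = (\<Sum>(a, b)\<leftarrow>[(a * c, b * d). (a, b) \<leftarrow> \<Delta> x, (c, d) \<leftarrow> \<Delta> y]. F a b)"
    using comult_mult[of x y] F by (simp add: tensor2_eq_def flip: sw_list)
  also have "... = (\<Sum>(a, b)\<leftarrow>\<Delta> x. \<Sum>(c, d)\<leftarrow>\<Delta> y. F (a * c) (b * d))"
    by (simp add: case_prod_unfold comp_def sum_list_concat_map)
  also have "... = sw x (\<lambda>a b. sw y (\<lambda>c d. F (a * c) (b * d)))"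
    by (simp only: sw_list[OF b] sw_list[OF b2])
  finally show ?thesis .
qed

lemma sw_coassoc: assumes F: "tril F"
  shows "sw x (\<lambda>a b. sw a (\<lambda>c d. F c d b)) = sw x (\<lambda>a b. sw b (\<lambda>c d. F a c d))"
proof -
  have l: "F (x + x') y z = F x y z + F x' y z" "F x (y + y') z = F x y z + F x y' z" "F x y (z + z') = F x y z + F x y z'"
    "F (scale c x) y z = c * F x y z" "F x (scale c y) z = c * F x y z" "F x y (scale c z) = c * F x y z" for x x' y y' z z' c
    using F by (simp_all add: trilinear_form_def lfun_iff)
  have b1: "bil (\<lambda>c d. F c d b)" and b2: "bil (F b)" for b by (rule bilI; simp add: l)+
  have b3: "bil (\<lambda>a b. sw a (\<lambda>c d. F c d b))" and b4: "bil (\<lambda>a b. sw b (\<lambda>c d. F a c d))"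
    by (rule bilI; simp add: lin_simps l)+
  have "sw x (\<lambda>a b. sw a (\<lambda>c d. F c d b)) = (\<Sum>(a, b)\<leftarrow>\<Delta> x. \<Sum>(c, d)\<leftarrow>\<Delta> a. F c d b)"
    by (simp only: sw_list[OF b1] sw_list[OF b3])
  also have "... = (\<Sum>(a, b, c)\<leftarrow>[(a1, a2, b). (a, b) \<leftarrow> \<Delta> x, (a1, a2) \<leftarrow> \<Delta> a]. F a b c)"
    by (simp add: case_prod_unfold comp_def sum_list_concat_map)
  also have "... = (\<Sum>(a, b, c)\<leftarrow>[(a, b1, b2). (a, b) \<leftarrow> \<Delta> x, (b1, b2) \<leftarrow> \<Delta> b]. F a b c)"
    using coassoc[of x] F by (simp add: tensor3_eq_def)
  also have "... = (\<Sum>(a, b)\<leftarrow>\<Delta> x. \<Sum>(c, d)\<leftarrow>\<Delta> b. F a c d)"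
    by (simp add: case_prod_unfold comp_def sum_list_concat_map)
  also have "... = sw x (\<lambda>a b. sw b (\<lambda>c d. F a c d))"
    by (simp only: sw_list[OF b2] sw_list[OF b4])
  finally show ?thesis .
qed

lemma sw_one: assumes F: "bil F" shows "sw 1 F = F 1 1"
  using comult_one F by (simp add: tensor2_eq_def flip: sw_list[OF F])

lemma sw_counit_left: assumes f: "lfun f" shows "sw x (\<lambda>a b. \<epsilon> a * f b) = f x"
proof -
  have "f (\<Sum>(a, b)\<leftarrow>\<Delta> x. scale (\<epsilon> a) b) = (\<Sum>(a, b)\<leftarrow>\<Delta> x. \<epsilon> a * f b)"
    by (simp add: lfun_sum_list[OF f] case_prod_unfold lfun_scale[OF f])
  then show ?thesis by (simp add: counit_left sw_list bil_prod lfun_\<epsilon> f)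
qed

lemma sw_counit_right: assumes f: "lfun f" shows "sw x (\<lambda>a b. \<epsilon> b * f a) = f x"
proof -
  have "f (\<Sum>(a, b)\<leftarrow>\<Delta> x. scale (\<epsilon> b) a) = (\<Sum>(a, b)\<leftarrow>\<Delta> x. f a * \<epsilon> b)"
    by (simp add: lfun_sum_list[OF f] case_prod_unfold lfun_scale[OF f] mult.commute)
  then have "(\<Sum>(a, b)\<leftarrow>\<Delta> x. f a * \<epsilon> b) = f x" by (simp add: counit_right)
  then have "sw x (\<lambda>a b. f a * \<epsilon> b) = f x" by (simp add: sw_list bil_prod lfun_\<epsilon> f)
  then show ?thesis by (simp add: mult.commute)
qed

lemma sw_antipode_left: assumes f: "lfun f" shows "sw x (\<lambda>a b. f (S a * b)) = \<epsilon> x * f 1"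
proof -
  have b: "bil (\<lambda>a b. f (S a * b))" by (rule bilI) (simp_all add: lin_simps lfun_simps[OF f])
  have "f (\<Sum>(a, b)\<leftarrow>\<Delta> x. S a * b) = (\<Sum>(a, b)\<leftarrow>\<Delta> x. f (S a * b))"
    by (simp add: lfun_sum_list[OF f] case_prod_unfold)
  then show ?thesis by (simp add: antipode_left sw_list[OF b] lfun_scale[OF f])
qed

lemma sw_antipode_right: assumes f: "lfun f" shows "sw x (\<lambda>a b. f (a * S b)) = \<epsilon> x * f 1"
proof -
  have b: "bil (\<lambda>a b. f (a * S b))" by (rule bilI) (simp_all add: lin_simps lfun_simps[OF f])
  have "f (\<Sum>(a, b)\<leftarrow>\<Delta> x. a * S b) = (\<Sum>(a, b)\<leftarrow>\<Delta> x. f (a * S b))"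
    by (simp add: lfun_sum_list[OF f] case_prod_unfold)
  then show ?thesis by (simp add: antipode_right sw_list[OF b] lfun_scale[OF f])
qed

text \<open>
  The vector valued Sweedler sum.
\<close>

definition swv :: "'h \<Rightarrow> ('h \<Rightarrow> 'h \<Rightarrow> 'h) \<Rightarrow> 'h" where
  "swv x F = (\<Sum>i\<in>Basis. \<Sum>j\<in>Basis. scale (cf i j x) (F i j))"

lemma lfun_swv: "lfun f \<Longrightarrow> f (swv x F) = sw x (\<lambda>a b. f (F a b))"
  by (simp add: swv_def sw_def lfun_sum lfun_scale)

lemma lmap_swv: "lmap (\<lambda>x. swv x F)"
  by (rule lmapI) (simp_all add: swv_def cf_add cf_scale scale_left_distrib sum.distrib scale_sum_right)

lemma lmap_mult_left: "lmap (\<lambda>x. a * x)" and lmap_mult_right: "lmap (\<lambda>x. x * a)"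
  by (simp_all add: lmap_iff distrib_left distrib_right scale_mult_left scale_mult_right)

lemma lfun_mult_left: "lfun f \<Longrightarrow> lfun (\<lambda>x. f (a * x))" and lfun_mult_right: "lfun f \<Longrightarrow> lfun (\<lambda>x. f (x * a))"
  and lfun_S: "lfun f \<Longrightarrow> lfun (\<lambda>x. f (S x))"
  by (rule lfun_comp[OF _ lmap_mult_left], assumption)
    (rule lfun_comp[OF _ lmap_mult_right], assumption, rule lfun_comp[OF _ lmap_S], assumption)

lemma sw_eq_of_products:
  assumes F: "bil F" and e: "\<And>f g. lfun f \<Longrightarrow> lfun g \<Longrightarrow> sw x (\<lambda>a b. f a * g b) = sw y (\<lambda>a b. f (p a b) * g (q a b))"
  shows "sw x F = sw y (\<lambda>a b. F (p a b) (q a b))"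
proof -
  have cf: "cf i j x = sw x (\<lambda>a b. coord i a * coord j b)" for x i j
    unfolding cf_def by (rule sw_list[OF bil_prod[OF lfun_coord lfun_coord]])
  have "sw x F = (\<Sum>i\<in>Basis. \<Sum>j\<in>Basis. sw y (\<lambda>a b. coord i (p a b) * coord j (q a b)) * F i j)"
    unfolding sw_def[of x F] by (intro sum.cong refl arg_cong2[where f = times]) (simp only: cf e lfun_coord)
  also have "... = sw y (\<lambda>a b. \<Sum>i\<in>Basis. \<Sum>j\<in>Basis. coord i (p a b) * coord j (q a b) * F i j)"
    by (simp only: sw_sum sw_push_right)
  also have "... = sw y (\<lambda>a b. F (p a b) (q a b))"
    by (simp only: bil_expand[OF F, of "p _ _" "q _ _"])
  finally show ?thesis .
qed

section \<open>Grouplike elements\<close>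

definition grouplike :: "'h \<Rightarrow> bool" where
  "grouplike g \<longleftrightarrow> (\<forall>F. bil F \<longrightarrow> sw g F = F g g) \<and> \<epsilon> g = 1"

lemma grouplikeD: "grouplike g \<Longrightarrow> bil F \<Longrightarrow> sw g F = F g g" "grouplike g \<Longrightarrow> \<epsilon> g = 1"
  by (simp_all add: grouplike_def)

lemma grouplikeI:
  assumes e: "\<And>f g. lfun f \<Longrightarrow> lfun g \<Longrightarrow> sw x (\<lambda>a b. f a * g b) = f x * g x" and "\<epsilon> x = 1"
  shows "grouplike x"
proof -
  have "cf i j x = coord i x * coord j x" for i j
    using sw_list[OF bil_prod[OF lfun_coord lfun_coord], of i j x] e[OF lfun_coord lfun_coord, of i j]
    unfolding cf_def by simp
  then have "sw x F = F x x" if "bil F" for F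
    unfolding sw_def by (subst bil_expand[OF that]) simp
  then show ?thesis using assms(2) by (simp add: grouplike_def)
qed

lemma grouplike_one: "grouplike 1" by (simp add: grouplike_def sw_one counit_one)

lemma grouplike_mult: assumes g: "grouplike g" and h: "grouplike h" shows "grouplike (g * h)"
  unfolding grouplike_def
proof (intro conjI allI impI)
  fix F assume F: "bil F"
  note l = bil_simps[OF F]
  have "bil (\<lambda>c d. F (a * c) (b * d))" for a b by (rule bilI) (simp_all add: lin_simps l)
  then have "sw (g * h) F = sw g (\<lambda>a b. F (a * h) (b * h))" by (simp add: sw_mult[OF F] grouplikeD[OF h])
  also have "... = F (g * h) (g * h)" by (rule grouplikeD(1)[OF g]) (rule bilI; simp add: lin_simps l)
  finally show "sw (g * h) F = F (g * h) (g * h)" .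
qed (simp add: counit_mult grouplikeD[OF g] grouplikeD[OF h])

lemma grouplike_power: "grouplike g \<Longrightarrow> grouplike (g ^ k)"
  by (induction k) (simp_all add: grouplike_one grouplike_mult)

lemma grouplike_antipode: assumes g: "grouplike g" shows "S g * g = 1" "g * S g = 1"
proof -
  have "f (S g * g) = f 1" if f: "lfun f" for f
    using sw_antipode_left[OF f, of g] grouplikeD[OF g] 
    by (subst (asm) grouplikeD(1)[OF g]) (auto intro!: bilI simp: lin_simps lfun_simps[OF f])
  then show "S g * g = 1" by (rule lfun_sep)
  have "f (g * S g) = f 1" if f: "lfun f" for f
    using sw_antipode_right[OF f, of g] grouplikeD[OF g] 
    by (subst (asm) grouplikeD(1)[OF g]) (auto intro!: bilI simp: lin_simps lfun_simps[OF f])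
  then show "g * S g = 1" by (rule lfun_sep)
qed

text \<open>
  Induction on the set.  Applying \<open>f \<otimes> k\<close> to the coproduct of a relation, and subtracting \<open>k(h)\<close>
  times the relation, gives a relation in which \<open>h\<close> no longer occurs.
\<close>

lemma grouplikes_independent:
  assumes "finite G" "\<And>g. g \<in> G \<Longrightarrow> grouplike g" "(\<Sum>g\<in>G. scale (c g) g) = 0" "g \<in> G"
  shows "c g = 0"
  using assms
proof (induction G arbitrary: c g)
  case (insert h G)
  have h: "grouplike h" using insert by simp
  have s: "(\<Sum>g\<in>G. c g * f g) + c h * f h = 0" if f: "lfun f" for f
    using arg_cong[OF insert(5), of f] insert(1,2)
    by (simp add: lfun_sum[OF f] lfun_scale[OF f] lfun_add[OF f] lfun_0[OF f] add.commute)
  have d: "(\<Sum>g\<in>G. c g * (f g * k g)) + c h * (f h * k h) = 0" if f: "lfun f" and k: "lfun k" for f k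
  proof -
    have "(\<Sum>g\<in>G. c g * sw g (\<lambda>a b. f a * k b)) + c h * sw h (\<lambda>a b. f a * k b) = 0" by (rule s[OF lfun_sw])
    then show ?thesis using insert(4) h grouplikeD(1)[OF _ bil_prod[OF f k]] by (simp cong: sum.cong)
  qed
  have z: "c g * (k g - k h) = 0" if k: "lfun k" and g: "g \<in> G" for k g
  proof -
    have "(\<Sum>g\<in>G. scale (c g * (k g - k h)) g) = 0"
    proof (rule lfun_sep)
      fix f assume f: "lfun f"
      have "(\<Sum>g\<in>G. c g * (k g - k h) * f g) = (\<Sum>g\<in>G. c g * (f g * k g)) - k h * (\<Sum>g\<in>G. c g * f g)"
        by (simp add: sum_distrib_left algebra_simps flip: sum_subtractf)
      also have "... = - (c h * (f h * k h)) - k h * (- (c h * f h))"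
        using s[OF f] d[OF f k] by (simp only: eq_neg_iff_add_eq_0[symmetric])
      also have "... = 0" by simp
      finally show "f (\<Sum>g\<in>G. scale (c g * (k g - k h)) g) = f 0"
        by (simp add: lfun_sum[OF f] lfun_scale[OF f] lfun_0[OF f])
    qed
    then show ?thesis using insert(3)[of "\<lambda>g. c g * (k g - k h)" g] insert(4) g by simp
  qed
  have cG: "c g = 0" if g: "g \<in> G" for g
  proof (rule ccontr)
    assume "c g \<noteq> 0"
    then have "k g = k h" if "lfun k" for k using z[OF that g] by simp
    then have "g = h" by (rule lfun_sep)
    then show False using g insert(2) by simp
  qed
  then have "c h = 0" using s[OF lfun_\<epsilon>] grouplikeD(2)[OF h] by simp
  then show ?case using cG insert(6) by auto
qed simp

text \<open>
  Distinct powers of \<open>g\<close> are independent, so two powers agree.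
\<close>

lemma grouplike_finite_order: assumes g: "grouplike g" obtains N where "N > 0" "g ^ N = 1"
proof -
  have "\<not> inj_on (\<lambda>k. g ^ k) {..card Basis}"
  proof
    assume inj: "inj_on (\<lambda>k. g ^ k) {..card Basis}"
    let ?G = "(\<lambda>k. g ^ k) ` {..card Basis}"
    have "independent ?G"
    proof
      assume "dependent ?G"
      then obtain c where "\<exists>x\<in>?G. c x \<noteq> 0" "(\<Sum>x\<in>?G. scale (c x) x) = 0" by (subst (asm) dependent_finite) auto
      then show False using grouplikes_independent[of ?G c] grouplike_power[OF g] by blast
    qed
    then have "card ?G \<le> card Basis" using independent_span_bound[OF finite_Basis, of ?G] by (simp add: span_Basis)
    then show False by (simp add: card_image[OF inj])
  qed
  then obtain i j where "i \<noteq> j" "g ^ i = g ^ j" unfolding inj_on_def by blast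
  then obtain i j where ij: "i < j" "g ^ i = g ^ j" by (cases i j rule: linorder_cases) force+
  have inv: "S g ^ k * g ^ k = 1" for k
  proof (induction k)
    case (Suc k)
    have "S g ^ Suc k * g ^ Suc k = S g ^ k * (S g * g) * g ^ k"
      by (simp only: power_Suc2[of "S g"] power_Suc[of g] mult.assoc)
    then show ?case using Suc grouplike_antipode[OF g] by simp
  qed simp
  have "g ^ j = g ^ i * g ^ (j - i)" by (metis ij(1) le_add_diff_inverse less_imp_le power_add)
  then have "S g ^ i * g ^ i = S g ^ i * g ^ i * g ^ (j - i)" using ij by (simp add: mult.assoc)
  then have "g ^ (j - i) = 1" by (simp add: inv)
  then show thesis using ij by (intro that[of "j - i"]) auto
qed

section \<open>Integrals of semisimple Hopf algebras\<close>

definition normalized_integral :: "'h \<Rightarrow> bool" where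
  "normalized_integral t \<longleftrightarrow> integral_in scale \<epsilon> t \<and> \<epsilon> t = 1"

text \<open>
  A left ideal of a semisimple algebra has a right unit, namely the component of \<open>1\<close> in it.
\<close>

lemma left_ideal_nilpotent:
  assumes ss: "semisimple_algebra scale" and N: "left_ideal scale N" and z: "\<And>x y. x \<in> N \<Longrightarrow> y \<in> N \<Longrightarrow> x * y = 0"
    and x: "x \<in> N"
  shows "x = 0"
proof -
  have "\<exists>J. left_ideal scale J \<and> N \<inter> J = {0} \<and> (\<forall>x. \<exists>y\<in>N. \<exists>z\<in>J. x = y + z)"
    using ss N unfolding semisimple_algebra_def by blast
  then obtain J where J: "left_ideal scale J" "N \<inter> J = {0}" "\<forall>x. \<exists>y\<in>N. \<exists>z\<in>J. x = y + z" by (elim exE conjE)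
  obtain y w where yw: "y \<in> N" "w \<in> J" "1 = y + w" using J(3) by blast
  have "x * w = x - x * y" using yw(3) by (metis add_diff_cancel_left' distrib_left mult.right_neutral)
  also have "... = x" using z[OF x yw(1)] by simp
  finally have "x \<in> J" using J(1) yw(2) unfolding left_ideal_def by metis
  then show "x = 0" using J(2) x by blast
qed

text \<open>
  A complement of the kernel of \<open>\<epsilon>\<close> is spanned by a left integral \<open>t\<close>.  It is two-sided because
  \<open>t x - \<epsilon>(x) t\<close> is a left integral in the kernel of \<open>\<epsilon>\<close>, and such elements form a left ideal with
  zero multiplication.
\<close>

lemma integral_exists:
  assumes ss: "semisimple_algebra scale" obtains t where "normalized_integral t"
proof -
  have ker: "left_ideal scale {x. \<epsilon> x = 0}"
    by (auto simp: left_ideal_def subspace_def lfun_0[OF lfun_\<epsilon>] lfun_simps[OF lfun_\<epsilon>] counit_mult)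
  have "\<exists>J. left_ideal scale J \<and> {x. \<epsilon> x = 0} \<inter> J = {0} \<and> (\<forall>x. \<exists>y\<in>{x. \<epsilon> x = 0}. \<exists>z\<in>J. x = y + z)"
    using ss ker unfolding semisimple_algebra_def by blast
  then obtain J where J: "left_ideal scale J" "{x. \<epsilon> x = 0} \<inter> J = {0}" "\<forall>x. \<exists>y\<in>{x. \<epsilon> x = 0}. \<exists>z\<in>J. x = y + z"
    by (elim exE conjE)
  obtain y t where yt: "\<epsilon> y = 0" "t \<in> J" "1 = y + t" using J(3)[rule_format, of 1] by auto
  have et: "\<epsilon> t = 1" using arg_cong[OF yt(3), of \<epsilon>] yt(1) by (simp add: lfun_add[OF lfun_\<epsilon>] counit_one)
  have left: "x * t = scale (\<epsilon> x) t" for x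
  proof -
    have "x * t \<in> J" "scale (\<epsilon> x) t \<in> J" using J(1) yt(2) by (auto simp: left_ideal_def subspace_def)
    then have "x * t - scale (\<epsilon> x) t \<in> J" using J(1) by (auto simp: left_ideal_def intro: subspace_diff)
    moreover have "\<epsilon> (x * t - scale (\<epsilon> x) t) = 0" by (simp add: lfun_diff[OF lfun_\<epsilon>] lfun_scale[OF lfun_\<epsilon>] counit_mult et)
    ultimately have "x * t - scale (\<epsilon> x) t = 0" using J(2) by blast
    then show ?thesis by simp
  qed
  let ?N = "{s. \<epsilon> s = 0 \<and> (\<forall>x. x * s = scale (\<epsilon> x) s)}"
  have N: "left_ideal scale ?N"
    by (auto simp: left_ideal_def subspace_def lfun_0[OF lfun_\<epsilon>] lfun_simps[OF lfun_\<epsilon>] counit_mult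
        distrib_left scale_right_distrib scale_mult_right scale_left_commute mult.commute[where 'a = 'k] simp flip: mult.assoc)
  have right: "t * x = scale (\<epsilon> x) t" for x
  proof -
    have "t * x - scale (\<epsilon> x) t \<in> ?N"
      by (auto simp: lfun_diff[OF lfun_\<epsilon>] lfun_scale[OF lfun_\<epsilon>] counit_mult et right_diff_distrib scale_mult_right scale_right_diff_distrib
          left scale_mult_left mult.commute[where 'a = 'k] simp flip: mult.assoc)
    then have "t * x - scale (\<epsilon> x) t = 0"
      by (rule left_ideal_nilpotent[OF ss N, rotated]) auto
    then show ?thesis by simp
  qed
  show thesis by (rule that[of t]) (simp add: normalized_integral_def integral_in_def et left right)
qed

end

section \<open>The Frobenius structure\<close>

locale hopf_with_integral = fd_hopf scale \<Delta> \<epsilon> S Basis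
  for scale :: "'k::{alg_closed_field, field_char_0} \<Rightarrow> 'h::ring_1 \<Rightarrow> 'h" and \<Delta> \<epsilon> S and Basis :: "'h set" +
  fixes \<Lambda> assumes \<Lambda>: "normalized_integral \<Lambda>"
begin

lemma \<Lambda>_left: "x * \<Lambda> = scale (\<epsilon> x) \<Lambda>" and \<Lambda>_right: "\<Lambda> * x = scale (\<epsilon> x) \<Lambda>" and \<epsilon>_\<Lambda>: "\<epsilon> \<Lambda> = 1"
  using \<Lambda> by (auto simp: normalized_integral_def integral_in_def)

text \<open>
  \<open>S(a) \<Lambda>\<^sub>1 \<otimes> \<Lambda>\<^sub>2 = S(a\<^sub>1) a\<^sub>2 \<Lambda>\<^sub>1 \<otimes> a\<^sub>3 \<Lambda>\<^sub>2 = \<Lambda>\<^sub>1 \<otimes> a \<Lambda>\<^sub>2\<close>.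
\<close>

lemma integral_move_left: assumes F: "bil F"
  shows "sw \<Lambda> (\<lambda>p q. F (S a * p) q) = sw \<Lambda> (\<lambda>p q. F p (a * q))"
proof -
  note l = bil_simps[OF F]
  have b: "bil (\<lambda>p q. F (S b * p) q)" for b by (rule bilI; simp add: lin_simps l)
  have t: "tril (\<lambda>c d b. sw \<Lambda> (\<lambda>p q. F (S c * (d * p)) (b * q)))" by (rule trilI; simp add: lin_simps l)
  have "sw \<Lambda> (\<lambda>p q. F (S a * p) q) = sw a (\<lambda>b c. \<epsilon> c * sw \<Lambda> (\<lambda>p q. F (S b * p) q))"
    by (rule sw_counit_right[symmetric]) (rule lfunI; simp add: lin_simps l)
  also have "... = sw a (\<lambda>b c. sw (c * \<Lambda>) (\<lambda>p q. F (S b * p) q))"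
    by (simp add: \<Lambda>_left sw_scale sw_push_left)
  also have "... = sw a (\<lambda>b c. sw c (\<lambda>d e. sw \<Lambda> (\<lambda>p q. F (S b * (d * p)) (e * q))))"
    by (simp add: sw_mult[OF b])
  also have "... = sw a (\<lambda>c e. sw c (\<lambda>b d. sw \<Lambda> (\<lambda>p q. F (S b * (d * p)) (e * q))))"
    by (rule sw_coassoc[OF t, symmetric])
  also have "... = sw a (\<lambda>c e. \<epsilon> c * sw \<Lambda> (\<lambda>p q. F p (e * q)))"
  proof (rule sw_cong)
    fix c e
    have "lfun (\<lambda>y. sw \<Lambda> (\<lambda>p q. F (y * p) (e * q)))" by (rule lfunI; simp add: lin_simps l)
    from sw_antipode_left[OF this, of c]
    show "sw c (\<lambda>b d. sw \<Lambda> (\<lambda>p q. F (S b * (d * p)) (e * q))) = \<epsilon> c * sw \<Lambda> (\<lambda>p q. F p (e * q))"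
      by (simp add: mult.assoc)
  qed
  also have "... = sw \<Lambda> (\<lambda>p q. F p (a * q))"
    by (rule sw_counit_left) (rule lfunI; simp add: lin_simps l)
  finally show ?thesis .
qed

text \<open>
  \<open>\<Lambda>\<^sub>1 \<otimes> \<Lambda>\<^sub>2 S(a) = \<Lambda>\<^sub>1 a\<^sub>1 \<otimes> \<Lambda>\<^sub>2 a\<^sub>2 S(a\<^sub>3) = \<Lambda>\<^sub>1 a \<otimes> \<Lambda>\<^sub>2\<close>.
\<close>

lemma integral_move_right: assumes F: "bil F"
  shows "sw \<Lambda> (\<lambda>p q. F (p * a) q) = sw \<Lambda> (\<lambda>p q. F p (q * S a))"
proof -
  note l = bil_simps[OF F]
  have b: "bil (\<lambda>p q. F p (q * S b))" for b by (rule bilI; simp add: lin_simps l)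
  have t: "tril (\<lambda>c d b. sw \<Lambda> (\<lambda>p q. F (p * c) (q * (d * S b))))" by (rule trilI; simp add: lin_simps l)
  have "sw \<Lambda> (\<lambda>p q. F p (q * S a)) = sw a (\<lambda>b c. \<epsilon> b * sw \<Lambda> (\<lambda>p q. F p (q * S c)))"
    by (rule sw_counit_left[symmetric]) (rule lfunI; simp add: lin_simps l)
  also have "... = sw a (\<lambda>b c. sw (\<Lambda> * b) (\<lambda>p q. F p (q * S c)))"
    by (simp add: \<Lambda>_right sw_scale sw_push_left)
  also have "... = sw a (\<lambda>b c. sw b (\<lambda>d e. sw \<Lambda> (\<lambda>p q. F (p * d) (q * (e * S c)))))"
    by (simp add: sw_mult[OF b] mult.assoc sw_exchange[of \<Lambda>])
  also have "... = sw a (\<lambda>d r. sw r (\<lambda>e c. sw \<Lambda> (\<lambda>p q. F (p * d) (q * (e * S c)))))"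
    by (rule sw_coassoc[OF t])
  also have "... = sw a (\<lambda>d r. \<epsilon> r * sw \<Lambda> (\<lambda>p q. F (p * d) q))"
  proof (rule sw_cong)
    fix d r
    have "lfun (\<lambda>y. sw \<Lambda> (\<lambda>p q. F (p * d) (q * y)))" by (rule lfunI; simp add: lin_simps l)
    from sw_antipode_right[OF this, of r]
    show "sw r (\<lambda>e c. sw \<Lambda> (\<lambda>p q. F (p * d) (q * (e * S c)))) = \<epsilon> r * sw \<Lambda> (\<lambda>p q. F (p * d) q)"
      by simp
  qed
  also have "... = sw \<Lambda> (\<lambda>p q. F (p * a) q)"
    by (rule sw_counit_right) (rule lfunI; simp add: lin_simps l)
  finally show ?thesis by simp
qed

text \<open>
  \<open>\<Lambda>\<^sub>1 \<otimes> \<Lambda>\<^sub>2\<close> is a nondegenerate tensor.  If \<open>\<Lambda>\<^sub>1 f(\<Lambda>\<^sub>2) = 0\<close>, then also \<open>\<Lambda>\<^sub>1 f(y \<Lambda>\<^sub>2) = 0\<close> for all \<open>y\<close> by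
  \<open>integral_move_left\<close>, and \<open>f(x) = f(x S(\<Lambda>\<^sub>1) \<Lambda>\<^sub>2)\<close> because \<open>\<epsilon>(\<Lambda>) = 1\<close>; expanding \<open>S(\<Lambda>\<^sub>1)\<close> in the basis shows
  that \<open>f(x)\<close> vanishes.
\<close>

lemma integral_separates_right:
  assumes f: "lfun f" and z: "\<And>g. lfun g \<Longrightarrow> sw \<Lambda> (\<lambda>p q. g p * f q) = 0"
  shows "f x = 0"
proof -
  have "f x = sw \<Lambda> (\<lambda>p q. f (x * (S p * q)))"
    using sw_antipode_left[OF lfun_mult_left[OF f, of x], of \<Lambda>] by (simp add: \<epsilon>_\<Lambda>)
  also have "... = sw \<Lambda> (\<lambda>p q. \<Sum>i\<in>Basis. coord i (S p) * f ((x * i) * q))"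
  proof (rule sw_cong)
    fix p q
    have "lfun (\<lambda>y. f (x * (y * q)))" by (rule lfunI; simp add: lin_simps lfun_simps[OF f])
    from lfun_expand[OF this, of "S p"]
    show "f (x * (S p * q)) = (\<Sum>i\<in>Basis. coord i (S p) * f ((x * i) * q))" by (simp only: mult.assoc)
  qed
  also have "... = (\<Sum>i\<in>Basis. sw \<Lambda> (\<lambda>p q. coord i (S p) * f ((x * i) * q)))" by (rule sw_sum)
  also have "... = (\<Sum>i\<in>Basis. 0)"
  proof (rule sum.cong[OF refl])
    fix i
    have b: "bil (\<lambda>p q. coord i (S p) * f q)" by (rule bil_prod[OF lfun_S[OF lfun_coord] f])
    have "lfun (\<lambda>p. coord i (S (S (x * i) * p)))" by (rule lfun_mult_left[OF lfun_S[OF lfun_coord]])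
    from z[OF this] show "sw \<Lambda> (\<lambda>p q. coord i (S p) * f ((x * i) * q)) = 0"
      by (simp only: integral_move_left[OF b, symmetric])
  qed
  finally show ?thesis by simp
qed

lemma integral_separates_left:
  assumes f: "lfun f" and z: "\<And>g. lfun g \<Longrightarrow> sw \<Lambda> (\<lambda>p q. f p * g q) = 0"
  shows "f x = 0"
proof -
  have "f x = sw \<Lambda> (\<lambda>p q. f (p * S q * x))"
    using sw_antipode_right[OF lfun_mult_right[OF f, of x], of \<Lambda>] by (simp add: \<epsilon>_\<Lambda>)
  also have "... = sw \<Lambda> (\<lambda>p q. \<Sum>i\<in>Basis. f (p * (i * x)) * coord i (S q))"
  proof (rule sw_cong)
    fix p q
    have "lfun (\<lambda>y. f (p * y * x))" by (rule lfunI; simp add: lin_simps lfun_simps[OF f])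
    from lfun_expand[OF this, of "S q"]
    show "f (p * S q * x) = (\<Sum>i\<in>Basis. f (p * (i * x)) * coord i (S q))" by (simp add: mult.assoc mult.commute[where 'a = 'k])
  qed
  also have "... = (\<Sum>i\<in>Basis. sw \<Lambda> (\<lambda>p q. f (p * (i * x)) * coord i (S q)))" by (rule sw_sum)
  also have "... = (\<Sum>i\<in>Basis. 0)"
  proof (rule sum.cong[OF refl])
    fix i
    have b: "bil (\<lambda>p q. f p * coord i (S q))" by (rule bil_prod[OF f lfun_S[OF lfun_coord]])
    have "lfun (\<lambda>q. coord i (S (q * S (i * x))))" by (rule lfun_mult_right[OF lfun_S[OF lfun_coord]])
    from z[OF this] show "sw \<Lambda> (\<lambda>p q. f (p * (i * x)) * coord i (S q)) = 0"
      by (simp only: integral_move_right[OF b])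
  qed
  finally show ?thesis by simp
qed

text \<open>
  The injective map \<open>f \<mapsto> \<Lambda>\<^sub>1 f(\<Lambda>\<^sub>2)\<close> from the dual to \<open>H\<close> is surjective, so \<open>1\<close> is in its image.
\<close>

lemma cointegral_exists: "\<exists>l. lfun l \<and> (\<forall>g. lfun g \<longrightarrow> sw \<Lambda> (\<lambda>p q. g p * l q) = g 1)"
proof -
  \<comment> \<open>\<open>f y\<close> runs through all functionals, so that \<open>T\<close> becomes an endomorphism of \<open>H\<close>.\<close>
  define f where "f y x = (\<Sum>b\<in>Basis. coord b y * coord b x)" for y x
  have f: "lfun (f y)" for y
    by (rule lfunI) (simp_all add: f_def coord_add coord_scale sum.distrib sum_distrib_left algebra_simps)
  have fb: "f y b = coord b y" if "b \<in> Basis" for b y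
    using that finite_Basis by (simp add: f_def coord_basis if_distrib cong: if_cong)
  define T where "T y = swv \<Lambda> (\<lambda>p q. scale (f y q) p)" for y
  have T: "g (T y) = sw \<Lambda> (\<lambda>p q. g p * f y q)" if "lfun g" for g y
    by (simp add: T_def lfun_swv[OF that] lfun_scale[OF that] mult.commute)
  have lT: "lmap T"
  proof (rule lmapI)
    have a: "f (x + y) q = f x q + f y q" for x y q by (simp add: f_def coord_add sum.distrib distrib_right)
    have s: "f (scale c y) q = c * f y q" for c y q by (simp add: f_def coord_scale sum_distrib_left mult.assoc)
    show "T (x + y) = T x + T y" for x y 
      by (rule lfun_sep) (simp add: T lfun_add a distrib_left sw_plus)
    show "T (scale c x) = scale c (T x)" for c x
      by (rule lfun_sep) (simp add: T lfun_scale s sw_push_left mult.left_commute)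
  qed
  have "surj T"
  proof (rule lmap_inj_surj[OF lT])
    fix y assume y: "T y = 0"
    have "sw \<Lambda> (\<lambda>p q. g p * f y q) = 0" if "lfun g" for g using T[OF that, of y] y lfun_0[OF that] by simp
    then have z: "f y x = 0" for x by (rule integral_separates_right[OF f])
    have "coord b y = 0" if "b \<in> Basis" for b by (simp only: fb[OF that, symmetric] z)
    then show "y = 0" using expand[of y] by simp
  qed
  then obtain y where "T y = 1" by (metis surjD)
  then show ?thesis using T f by (intro exI[of _ "f y"]) metis
qed

definition lam :: "'h \<Rightarrow> 'k" where
  "lam = (SOME l. lfun l \<and> (\<forall>g. lfun g \<longrightarrow> sw \<Lambda> (\<lambda>p q. g p * l q) = g 1))"

lemma lfun_lam: "lfun lam" and integral_lam: "lfun g \<Longrightarrow> sw \<Lambda> (\<lambda>p q. g p * lam q) = g 1"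
  using someI_ex[OF cointegral_exists] by (auto simp: lam_def)

lemmas lam_simps = lfun_simps[OF lfun_lam]

lemma lam_\<Lambda>: "lam \<Lambda> = 1"
  using integral_lam[OF lfun_\<epsilon>] sw_counit_left[OF lfun_lam, of \<Lambda>] by (simp add: counit_one)

text \<open>
  Both sides are functionals of \<open>x\<close> that are sent to \<open>f(1) 1\<close> by the injective map
  \<open>h \<mapsto> \<Lambda>\<^sub>1 h(\<Lambda>\<^sub>2)\<close>, because \<open>\<Lambda>\<^sub>1 \<otimes> \<Lambda>\<^sub>2 \<lambda>(\<Lambda>\<^sub>3) = 1 \<otimes> 1\<close>.
\<close>

lemma lam_left_invariant: assumes f: "lfun f" shows "sw x (\<lambda>a b. f a * lam b) = f 1 * lam x"
proof -
  note l = lfun_simps[OF f] lam_simps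
  have "sw x (\<lambda>a b. f a * lam b) - f 1 * lam x = 0"
  proof (rule integral_separates_right)
    show "lfun (\<lambda>x. sw x (\<lambda>a b. f a * lam b) - f 1 * lam x)"
      by (rule lfunI) (simp_all add: sw_add sw_scale lam_simps algebra_simps sw_push_left)
    fix g assume g: "lfun g"
    note l = l lfun_simps[OF g]
    have t: "tril (\<lambda>p a b. g p * f a * lam b)" by (rule trilI; simp add: lin_simps l)
    have "sw \<Lambda> (\<lambda>p q. g p * sw q (\<lambda>a b. f a * lam b)) = sw \<Lambda> (\<lambda>r b. sw r (\<lambda>p a. g p * f a) * lam b)"
      using sw_coassoc[OF t, of \<Lambda>] by (simp add: sw_push_left sw_push_right mult.assoc)
    also have "... = sw 1 (\<lambda>p a. g p * f a)" by (rule integral_lam[OF lfun_sw])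
    also have "... = g 1 * f 1" by (rule sw_one[OF bil_prod[OF g f]])
    finally have 1: "sw \<Lambda> (\<lambda>p q. g p * sw q (\<lambda>a b. f a * lam b)) = g 1 * f 1" .
    have "sw \<Lambda> (\<lambda>p q. g p * (f 1 * lam q)) = f 1 * sw \<Lambda> (\<lambda>p q. g p * lam q)"
      by (simp add: sw_push_left mult.left_commute)
    then have 2: "sw \<Lambda> (\<lambda>p q. g p * (f 1 * lam q)) = f 1 * g 1" by (simp add: integral_lam[OF g])
    show "sw \<Lambda> (\<lambda>p q. g p * (sw q (\<lambda>a b. f a * lam b) - f 1 * lam q)) = 0"
      by (simp add: right_diff_distrib sw_minus 1 2)
  qed
  then show ?thesis by simp
qed

lemma left_cointegral_unique:
  assumes m: "lfun \<mu>" and inv: "\<And>f. lfun f \<Longrightarrow> sw \<Lambda> (\<lambda>a b. f a * \<mu> b) = f 1 * c"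
  shows "\<mu> x = c * lam x"
proof -
  have "\<mu> x - c * lam x = 0"
  proof (rule integral_separates_right)
    show "lfun (\<lambda>x. \<mu> x - c * lam x)"
      by (rule lfunI) (simp_all add: lfun_simps[OF m] lam_simps algebra_simps)
    fix g assume g: "lfun g"
    have "sw \<Lambda> (\<lambda>p q. g p * (\<mu> q - c * lam q)) = sw \<Lambda> (\<lambda>p q. g p * \<mu> q) - c * sw \<Lambda> (\<lambda>p q. g p * lam q)"
      by (simp add: right_diff_distrib sw_minus sw_push_left mult.left_commute)
    then show "sw \<Lambda> (\<lambda>p q. g p * (\<mu> q - c * lam q)) = 0" by (simp add: inv[OF g] integral_lam[OF g])
  qed
  then show ?thesis by simp
qed

text \<open>
  The modular element of \<open>lam\<close>: left integrals are unique up to a scalar, so the product of \<open>lam\<close>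
  with a functional \<open>f\<close> from the right is a multiple \<open>f(v) lam\<close> of \<open>lam\<close>.
\<close>

definition v :: "'h" where "v = swv \<Lambda> (\<lambda>p q. scale (lam p) q)"

lemma lfun_v: "lfun g \<Longrightarrow> g v = sw \<Lambda> (\<lambda>p q. lam p * g q)"
  by (simp add: v_def lfun_swv lfun_scale)

lemma lam_right_modular: assumes f: "lfun f" shows "sw x (\<lambda>a b. lam a * f b) = f v * lam x"
proof (rule left_cointegral_unique)
  show "lfun (\<lambda>x. sw x (\<lambda>a b. lam a * f b))" by (rule lfun_sw)
  fix g assume g: "lfun g"
  note l = lfun_simps[OF f] lam_simps lfun_simps[OF g]
  have t: "tril (\<lambda>a c d. g a * (lam c * f d))" by (rule trilI; simp add: lin_simps l)
  have "sw \<Lambda> (\<lambda>a b. g a * sw b (\<lambda>c d. lam c * f d)) = sw \<Lambda> (\<lambda>r d. sw r (\<lambda>a c. g a * lam c) * f d)"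
    using sw_coassoc[OF t, of \<Lambda>] by (simp add: sw_push_left sw_push_right mult.assoc)
  also have "... = g 1 * f v" by (simp add: lam_left_invariant[OF g] lfun_v[OF f] sw_push_left mult.assoc)
  finally show "sw \<Lambda> (\<lambda>a b. g a * sw b (\<lambda>c d. lam c * f d)) = g 1 * f v" .
qed

lemma grouplike_v: "grouplike v"
proof (rule grouplikeI)
  fix f g assume f: "lfun f" and g: "lfun g"
  note l = lfun_simps[OF f] lam_simps lfun_simps[OF g]
  have t: "tril (\<lambda>p a b. lam p * (f a * g b))" by (rule trilI; simp add: lin_simps l)
  have "sw v (\<lambda>a b. f a * g b) = sw \<Lambda> (\<lambda>p q. lam p * sw q (\<lambda>a b. f a * g b))" by (rule lfun_v[OF lfun_sw])
  also have "... = sw \<Lambda> (\<lambda>r b. sw r (\<lambda>p a. lam p * f a) * g b)"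
    using sw_coassoc[OF t, of \<Lambda>] by (simp add: sw_push_left sw_push_right mult.assoc)
  also have "... = f v * g v" by (simp add: lam_right_modular[OF f] lfun_v[OF g] sw_push_left mult.assoc)
  finally show "sw v (\<lambda>a b. f a * g b) = f v * g v" .
next
  show "\<epsilon> v = 1" using sw_counit_right[OF lfun_lam, of \<Lambda>] by (simp add: lfun_v[OF lfun_\<epsilon>] lam_\<Lambda> mult.commute)
qed

section \<open>The antipode and its fourth power\<close>

lemma antipode_formula: assumes g: "lfun g" shows "g (S a) = sw \<Lambda> (\<lambda>p q. g p * lam (a * q))"
  using integral_move_left[OF bil_prod[OF g lfun_lam], of a] integral_lam[OF lfun_mult_left[OF g, of "S a"]] by simp

lemma inverse_antipode_formula: assumes g: "lfun g" shows "g a = sw \<Lambda> (\<lambda>p q. g p * lam (q * S a))"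
  using integral_move_right[OF bil_prod[OF g lfun_lam], of a] integral_lam[OF lfun_mult_right[OF g, of a]] by simp

text \<open>
  Both sides, as functionals of \<open>x\<close>, are sent to \<open>S(c)\<close> by the injective map \<open>h \<mapsto> \<Lambda>\<^sub>1 h(\<Lambda>\<^sub>2)\<close>.  So
  \<open>S\<^sup>2\<close> is the Nakayama automorphism of \<open>lam\<close>.
\<close>

lemma lam_nakayama: "lam (c * x) = lam (x * S (S c))"
proof -
  have "lam (c * x) - lam (x * S (S c)) = 0"
  proof (rule integral_separates_right[where f = "\<lambda>x. lam (c * x) - lam (x * S (S c))"])
    show "lfun (\<lambda>x. lam (c * x) - lam (x * S (S c)))"
      by (rule lfunI) (simp_all add: lam_simps distrib_left distrib_right scale_mult_left scale_mult_right algebra_simps)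
    fix g assume g: "lfun g"
    show "sw \<Lambda> (\<lambda>p q. g p * (lam (c * q) - lam (q * S (S c)))) = 0"
      by (simp add: right_diff_distrib sw_minus antipode_formula[OF g, of c, symmetric] inverse_antipode_formula[OF g, of "S c", symmetric])
  qed
  then show ?thesis by simp
qed

text \<open>
  In \<open>S(a b) = \<Lambda>\<^sub>1 \<lambda>(a b \<Lambda>\<^sub>2)\<close> the factor \<open>b\<close> is moved to the first leg, where it becomes \<open>S(b)\<close>.
\<close>

lemma antipode_mult: "S (a * b) = S b * S a"
proof (rule lfun_sep)
  fix g assume g: "lfun g"
  have b: "bil (\<lambda>p q. g p * lam (a * q))" by (rule bil_prod[OF g lfun_mult_left[OF lfun_lam]])
  have "g (S (a * b)) = sw \<Lambda> (\<lambda>p q. g p * lam (a * (b * q)))" by (simp add: antipode_formula[OF g] mult.assoc)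
  also have "... = sw \<Lambda> (\<lambda>p q. g (S b * p) * lam (a * q))" by (rule integral_move_left[OF b, symmetric])
  also have "... = g (S b * S a)" by (rule antipode_formula[OF lfun_mult_left[OF g], symmetric])
  finally show "g (S (a * b)) = g (S b * S a)" .
qed

lemma antipode_one: "S 1 = 1"
  by (rule lfun_sep) (simp add: antipode_formula integral_lam)

lemma counit_antipode: "\<epsilon> (S a) = \<epsilon> a"
  using antipode_formula[OF lfun_\<epsilon>, of a] sw_counit_left[OF lfun_mult_left[OF lfun_lam, of a], of \<Lambda>]
  by (simp add: \<Lambda>_left lam_simps lam_\<Lambda>)

text \<open>
  \<open>x\<^sub>1 \<lambda>(a x\<^sub>2) = S(a\<^sub>1) a\<^sub>2 x\<^sub>1 \<lambda>(a\<^sub>3 x\<^sub>2) = S(a\<^sub>1) \<lambda>(a\<^sub>2 x)\<close>.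
\<close>

lemma lam_strong_invariance: assumes f: "lfun f"
  shows "sw x (\<lambda>p q. f p * lam (a * q)) = sw a (\<lambda>b c. f (S b) * lam (c * x))"
proof -
  note l = lfun_simps[OF f] lam_simps
  have t: "tril (\<lambda>b c d. sw x (\<lambda>p q. f (S b * (c * p)) * lam (d * q)))" by (rule trilI; simp add: lin_simps l)
  have "sw a (\<lambda>b c. f (S b) * lam (c * x)) = sw a (\<lambda>b c. sw (c * x) (\<lambda>p q. f (S b * p) * lam q))"
    by (simp add: lam_left_invariant[OF lfun_mult_left[OF f]])
  also have "... = sw a (\<lambda>b r. sw r (\<lambda>c d. sw x (\<lambda>p q. f (S b * (c * p)) * lam (d * q))))"
    by (simp add: sw_mult[OF bil_prod[OF lfun_mult_left[OF f] lfun_lam]])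
  also have "... = sw a (\<lambda>r d. sw r (\<lambda>b c. sw x (\<lambda>p q. f (S b * (c * p)) * lam (d * q))))"
    by (rule sw_coassoc[OF t, symmetric])
  also have "... = sw a (\<lambda>r d. \<epsilon> r * sw x (\<lambda>p q. f p * lam (d * q)))"
  proof (rule sw_cong)
    fix r d
    have "lfun (\<lambda>y. sw x (\<lambda>p q. f (y * p) * lam (d * q)))" by (rule lfunI; simp add: lin_simps l)
    from sw_antipode_left[OF this, of r]
    show "sw r (\<lambda>b c. sw x (\<lambda>p q. f (S b * (c * p)) * lam (d * q))) = \<epsilon> r * sw x (\<lambda>p q. f p * lam (d * q))"
      by (simp add: mult.assoc)
  qed
  also have "... = sw x (\<lambda>p q. f p * lam (a * q))"
    by (rule sw_counit_left) (rule lfunI; simp add: lin_simps l)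
  finally show ?thesis by simp
qed

text \<open>
  \<open>\<Delta>(S(x)) = \<Lambda>\<^sub>1 \<otimes> \<Lambda>\<^sub>2 \<lambda>(x \<Lambda>\<^sub>3) = \<Lambda>\<^sub>1 \<otimes> S(x\<^sub>1) \<lambda>(x\<^sub>2 \<Lambda>\<^sub>2) = S(x\<^sub>2) \<otimes> S(x\<^sub>1)\<close> by
  \<open>lam_strong_invariance\<close>.
\<close>

lemma antipode_comult: assumes F: "bil F" shows "sw (S x) F = sw x (\<lambda>a b. F (S b) (S a))"
proof (rule sw_eq_of_products[OF F])
  fix f g assume f: "lfun f" and g: "lfun g"
  note l = lfun_simps[OF f] lam_simps lfun_simps[OF g]
  have t: "tril (\<lambda>a b q. f a * (g b * lam (x * q)))" by (rule trilI; simp add: lin_simps l)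
  have "sw (S x) (\<lambda>a b. f a * g b) = sw \<Lambda> (\<lambda>r q. sw r (\<lambda>a b. f a * g b) * lam (x * q))"
    by (rule antipode_formula[OF lfun_sw])
  also have "... = sw \<Lambda> (\<lambda>a t. f a * sw t (\<lambda>b q. g b * lam (x * q)))"
    using sw_coassoc[OF t, of \<Lambda>] by (simp add: sw_push_left sw_push_right mult.assoc)
  also have "... = sw \<Lambda> (\<lambda>a t. sw x (\<lambda>b c. f a * (g (S b) * lam (c * t))))"
    by (simp add: lam_strong_invariance[OF g] sw_push_left)
  also have "... = sw x (\<lambda>b c. sw \<Lambda> (\<lambda>a t. f a * (g (S b) * lam (c * t))))" by (rule sw_exchange)
  also have "... = sw x (\<lambda>b c. f (S c) * g (S b))"
    by (simp add: antipode_formula[OF f] sw_push_left sw_push_right mult_ac)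
  finally show "sw (S x) (\<lambda>a b. f a * g b) = sw x (\<lambda>a b. f (S b) * g (S a))" .
qed

text \<open>
  \<open>\<lambda>(S(a) \<Lambda>\<^sub>1) \<Lambda>\<^sub>2 = \<lambda>(\<Lambda>\<^sub>1) a \<Lambda>\<^sub>2 = a v\<close>, and \<open>v\<close> is invertible.
\<close>

lemma antipode_inj: assumes "S a = 0" shows "a = 0"
proof -
  have "a * v = 0"
  proof (rule lfun_sep)
    fix g assume g: "lfun g"
    have "g (a * v) = sw \<Lambda> (\<lambda>p q. lam p * g (a * q))" by (rule lfun_v[OF lfun_mult_left[OF g]])
    also have "... = sw \<Lambda> (\<lambda>p q. lam (S a * p) * g q)" by (rule integral_move_left[OF bil_prod[OF lfun_lam g], symmetric])
    also have "... = 0" by (simp add: assms lfun_0[OF lfun_lam] sw_def)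
    finally show "g (a * v) = g 0" by (simp add: lfun_0[OF g])
  qed
  then have "a * (v * S v) = 0" by (simp flip: mult.assoc)
  then show ?thesis by (simp add: grouplike_antipode[OF grouplike_v])
qed

lemma antipode_surj: obtains b where "a = S b"
  using lmap_inj_surj[OF lmap_S antipode_inj] by (metis surjD)

lemma lam_nondeg_right: assumes "\<And>x. lam (x * y) = 0" shows "y = 0"
proof -
  obtain b where b: "y = S b" by (rule antipode_surj)
  have "b = 0"
  proof (rule lfun_sep)
    fix g assume g: "lfun g"
    have "g b = sw \<Lambda> (\<lambda>p q. g p * lam (q * y))" by (simp add: inverse_antipode_formula[OF g, of b] b)
    then show "g b = g 0" by (simp add: assms lfun_0[OF g] sw_def)
  qed
  then show ?thesis by (simp add: b lmap_0[OF lmap_S])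
qed

lemma lam_antipode_right_invariant: assumes f: "lfun f"
  shows "sw x (\<lambda>a b. lam (S a) * f b) = lam (S x) * f 1"
proof -
  \<comment> \<open>The claim is that \<open>y = 0\<close>; left invariance of \<open>lam\<close> at \<open>S x\<close> only gives \<open>S y = 0\<close>.\<close>
  define y where "y = swv x (\<lambda>a b. scale (lam (S a)) b) - scale (lam (S x)) 1"
  have y: "g y = sw x (\<lambda>a b. lam (S a) * g b) - lam (S x) * g 1" if g: "lfun g" for g
    by (simp add: y_def lfun_diff[OF g] lfun_swv[OF g] lfun_scale[OF g])
  have "S y = 0"
  proof (rule lfun_sep)
    fix g assume g: "lfun g"
    have "sw (S x) (\<lambda>a b. g a * lam b) = g 1 * lam (S x)" by (rule lam_left_invariant[OF g])
    then have "sw x (\<lambda>a b. lam (S a) * g (S b)) = lam (S x) * g 1"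
      by (simp add: antipode_comult[OF bil_prod[OF g lfun_lam]] mult.commute[where 'a = 'k])
    then show "g (S y) = g 0" by (simp add: y[OF lfun_S[OF g]] antipode_one lfun_0[OF g])
  qed
  then have "y = 0" by (rule antipode_inj)
  then show ?thesis using y[OF f] by (simp add: lfun_0[OF f])
qed

lemma antipode_\<Lambda>: "S \<Lambda> = \<Lambda>"
proof (rule lfun_sep)
  fix g assume g: "lfun g"
  have "g (S \<Lambda>) = sw \<Lambda> (\<lambda>p q. \<epsilon> q * g p)" 
    by (simp add: antipode_formula[OF g] \<Lambda>_right lam_simps lam_\<Lambda> mult.commute[where 'a = 'k])
  then show "g (S \<Lambda>) = g \<Lambda>" by (simp add: sw_counit_right[OF g])
qed

text \<open>
  Both \<open>lam \<circ> S\<close> and \<open>x \<mapsto> lam (v x)\<close> are right integrals, and both take the value \<open>1\<close> at \<open>\<Lambda>\<close>.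
\<close>

lemma lam_antipode: "lam (S x) = lam (v * x)"
proof -
  have "lam (S x) - lam (v * x) = 0"
  proof (rule integral_separates_left[where f = "\<lambda>x. lam (S x) - lam (v * x)"])
    show "lfun (\<lambda>x. lam (S x) - lam (v * x))"
      by (rule lfunI) (simp_all add: lam_simps lmap_simps[OF lmap_S] distrib_left scale_mult_right algebra_simps)
    fix g assume g: "lfun g"
    have "sw (v * \<Lambda>) (\<lambda>a b. lam a * g (S v * b)) = g 1 * lam \<Lambda>"
      by (simp add: lam_right_modular[OF lfun_mult_left[OF g]] grouplike_antipode[OF grouplike_v] \<Lambda>_left grouplikeD(2)[OF grouplike_v])
    moreover have "sw (v * \<Lambda>) (\<lambda>a b. lam a * g (S v * b)) = sw \<Lambda> (\<lambda>a b. lam (v * a) * g b)"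
    proof -
      note l = lfun_simps[OF g] lam_simps
      have b: "bil (\<lambda>a b. lam a * g (S v * b))" by (rule bilI; simp add: lin_simps l)
      have b': "bil (\<lambda>a b. sw \<Lambda> (\<lambda>c d. lam (a * c) * g (S v * (b * d))))" by (rule bilI; simp add: lin_simps l)
      have "S v * (v * d) = d" for d by (simp add: grouplike_antipode[OF grouplike_v] flip: mult.assoc)
      then show ?thesis by (simp add: sw_mult[OF b] grouplikeD(1)[OF grouplike_v b'])
    qed
    ultimately have "sw \<Lambda> (\<lambda>a b. lam (v * a) * g b) = g 1" by (simp add: lam_\<Lambda>)
    then show "sw \<Lambda> (\<lambda>p q. (lam (S p) - lam (v * p)) * g q) = 0"
      by (simp add: left_diff_distrib sw_minus lam_antipode_right_invariant[OF g] antipode_\<Lambda> lam_\<Lambda>)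
  qed
  then show ?thesis by simp
qed

text \<open>
  Radford's formula for \<open>S\<^sup>4\<close> in the unimodular case.  The functional \<open>lam \<circ> S\<close> equals \<open>x \<mapsto> lam (v x)\<close>.
  The first description has Nakayama automorphism \<open>S\<^bsup>-2\<^esup>\<close>, the second \<open>v S\<^sup>2(-) v\<^bsup>-1\<^esup>\<close>; comparing them gives
  the claim.
\<close>

lemma radford_formula: "c * v = v * S (S (S (S c)))"
proof -
  have Sv: "S (S v) = v"
  proof -
    have "S (S v) = v * S v * S (S v)" by (simp add: grouplike_antipode[OF grouplike_v])
    also have "... = v * S (S v * v)" by (simp add: antipode_mult mult.assoc)
    finally show ?thesis by (simp add: grouplike_antipode[OF grouplike_v] antipode_one)
  qed
  have "lam (x * (c * v - v * S (S (S (S c))))) = 0" for x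
  proof -
    have "lam (x * (c * v)) = lam (v * (x * c))" by (simp add: lam_nakayama[of v] Sv mult.assoc)
    also have "... = lam (S c * S x)" by (simp add: antipode_mult flip: lam_antipode)
    also have "... = lam (S x * S (S (S c)))" by (rule lam_nakayama)
    also have "... = lam (S (S (S c) * x))" by (simp add: antipode_mult)
    also have "... = lam (v * S (S c) * x)" by (simp add: lam_antipode mult.assoc)
    also have "... = lam (x * (v * S (S (S (S c)))))" by (simp add: lam_nakayama[of "v * S (S c)"] antipode_mult Sv)
    finally show ?thesis by (simp add: right_diff_distrib lfun_diff[OF lfun_lam])
  qed
  then have "c * v - v * S (S (S (S c))) = 0" by (rule lam_nondeg_right)
  then show ?thesis by simp
qed

definition S2 :: "'h \<Rightarrow> 'h" where "S2 x = S (S x)"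

lemma lmap_S2: "lmap S2" unfolding S2_def by (rule lmap_comp[OF lmap_S lmap_S])
lemma S2_mult: "S2 (x * y) = S2 x * S2 y" by (simp add: S2_def antipode_mult)
lemma S2_one: "S2 1 = 1" by (simp add: S2_def antipode_one)

lemma S2_finite_order: obtains M where "M > 0" "\<forall>x. (S2 ^^ M) x = x"
proof -
  obtain N where N: "N > 0" "v ^ N = 1" by (rule grouplike_finite_order[OF grouplike_v])
  have "c * v ^ k = v ^ k * (S2 ^^ (2 * k)) c" for c k
  proof (induction k arbitrary: c)
    case (Suc k)
    have "c * v ^ Suc k = v * (S2 (S2 c) * v ^ k)" using radford_formula[of c] by (simp add: S2_def flip: mult.assoc)
    also have "... = v ^ Suc k * (S2 ^^ (2 * k)) (S2 (S2 c))" by (simp only: Suc[of "S2 (S2 c)"] mult.assoc power_Suc)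
    finally show ?case by (simp add: funpow_swap1)
  qed simp
  from this[of _ N] have "(S2 ^^ (2 * N)) c = c" for c by (simp add: N)
  then show thesis using N by (intro that[of "2 * N"]) auto
qed

text \<open>
  The formula \<open>S(a) = \<Lambda>\<^sub>1 \<lambda>(a \<Lambda>\<^sub>2)\<close> writes \<open>S\<close> as a sum of operators of rank one.
\<close>

lemma trace_comp_antipode: assumes Q: "lmap Q"
  shows "trace (\<lambda>x. Q (S x)) = sw \<Lambda> (\<lambda>p q. lam (Q p * q))"
proof -
  have S: "S a = (\<Sum>p\<in>Basis \<times> Basis. scale (cf (fst p) (snd p) \<Lambda> * lam (a * snd p)) (fst p))" for a
    by (rule lfun_sep) (simp add: antipode_formula sw_pairs lfun_sum lfun_scale mult.assoc mult.commute[where 'a = 'k] mult.left_commute)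
  have "trace (\<lambda>x. Q (S x)) = trace (\<lambda>x. \<Sum>p\<in>Basis \<times> Basis. scale (cf (fst p) (snd p) \<Lambda> * lam (x * snd p)) (Q (fst p)))"
    by (subst S) (simp add: lmap_sum[OF Q] lmap_scale[OF Q])
  also have "... = (\<Sum>p\<in>Basis \<times> Basis. cf (fst p) (snd p) \<Lambda> * lam (Q (fst p) * snd p))"
    unfolding trace_sum
  proof (rule sum.cong[OF refl], rule trace_rank1)
    fix p show "lfun (\<lambda>x. cf (fst p) (snd p) \<Lambda> * lam (x * snd p))"
      by (rule lfunI) (simp_all add: lam_simps distrib_right scale_mult_left algebra_simps)
  qed
  finally show ?thesis by (simp add: sw_pairs)
qed

lemma trace_left_mult_S2: "trace (\<lambda>x. y * S2 x) = lam y"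
proof -
  have "trace (\<lambda>x. y * S2 x) = sw \<Lambda> (\<lambda>p q. lam (y * S p * q))"
    unfolding S2_def by (rule trace_comp_antipode[of "\<lambda>x. y * S x"]) (rule lmap_comp[OF lmap_mult_left lmap_S])
  also have "... = lam y"
    using sw_antipode_left[OF lfun_mult_left[OF lfun_lam, of y], of \<Lambda>] by (simp add: \<epsilon>_\<Lambda> mult.assoc)
  finally show ?thesis .
qed

end

section \<open>The square of the antipode\<close>

locale semisimple_hopf = hopf_with_integral scale \<Delta> \<epsilon> S Basis \<Lambda>
  for scale :: "'k::{alg_closed_field, field_char_0} \<Rightarrow> 'h::ring_1 \<Rightarrow> 'h" and \<Delta> \<epsilon> S and Basis :: "'h set" and \<Lambda> +
  assumes semisimple: "semisimple_algebra scale"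
begin

text \<open>
  The radical of the trace form is a left ideal; its right unit \<open>e\<close> is an idempotent for which
  left multiplication has trace zero, so \<open>e\<close> vanishes by \<open>trace_idempotent\<close>.
\<close>

lemma trace_form_nondegenerate: assumes x: "\<And>y. trace (\<lambda>z. (y * x) * z) = 0" shows "x = 0"
proof -
  define I where "I = {x. \<forall>y. trace (\<lambda>z. (y * x) * z) = 0}"
  have I: "left_ideal scale I"
  proof -
    have l: "trace (\<lambda>z. (a + b) * z) = trace (\<lambda>z. a * z) + trace (\<lambda>z. b * z)"
      "trace (\<lambda>z. scale c a * z) = c * trace (\<lambda>z. a * z)" for a b c
      by (simp_all only: distrib_right trace_add scale_mult_left trace_scale)
    have "trace (\<lambda>z. 0 * z) = 0" by (simp add: trace_def)
    then have "subspace I"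
      by (auto simp only: subspace_def I_def distrib_left l scale_mult_right mem_Collect_eq mult_zero_right add_0)
    moreover have "a * x \<in> I" if "x \<in> I" for a x
      using that by (simp add: I_def flip: mult.assoc)
    ultimately show ?thesis by (simp add: left_ideal_def)
  qed
  have "\<exists>J. left_ideal scale J \<and> I \<inter> J = {0} \<and> (\<forall>x. \<exists>y\<in>I. \<exists>z\<in>J. x = y + z)"
    using semisimple I unfolding semisimple_algebra_def by blast
  then obtain J where J: "left_ideal scale J" "I \<inter> J = {0}" "\<forall>x. \<exists>y\<in>I. \<exists>z\<in>J. x = y + z" by (elim exE conjE)
  obtain e w where ew: "e \<in> I" "w \<in> J" "1 = e + w" using J(3) by blast
  have unit: "x * e = x" if x: "x \<in> I" for x
  proof -
    have "x * w = x - x * e" using ew(3) by (metis add_diff_cancel_left' distrib_left mult.right_neutral)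
    moreover have "x - x * e \<in> I" using I ew(1) x by (auto simp: left_ideal_def intro: subspace_diff)
    moreover have "x * w \<in> J" using J(1) ew(2) by (simp add: left_ideal_def)
    ultimately have "x - x * e \<in> I \<inter> J" by simp
    then have "x - x * e = 0" by (simp only: J(2) singleton_iff)
    then show ?thesis by simp
  qed
  have ee: "e * (e * z) = e * z" for z by (simp add: unit[OF ew(1)] flip: mult.assoc)
  have "\<forall>y. trace (\<lambda>z. (y * e) * z) = 0" using ew(1) unfolding I_def mem_Collect_eq .
  then have t0: "trace (\<lambda>z. (1 * e) * z) = 0" by (rule spec)
  obtain r where r: "trace (\<lambda>z. e * z) = of_nat r" "r \<le> card Basis" "r = 0 \<longrightarrow> (\<forall>z. e * z = 0)"
    "r = card Basis \<longrightarrow> (\<forall>z. e * z = z)"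
    by (rule trace_idempotent[OF lmap_mult_left[of e] ee])
  have "(of_nat r :: 'k) = 0" using t0 r(1) by simp
  then have "\<forall>z. e * z = 0" using r(3) by simp
  then have "e * 1 = 0" by (rule spec)
  then show "x = 0" using unit[of x] x by (simp add: I_def)
qed

sublocale A: trace_form_algebra scale Basis "(*)" 1
  by unfold_locales (auto simp: distrib_left distrib_right scale_mult_left scale_mult_right mult.assoc intro: trace_form_nondegenerate)

text \<open>
  The functional \<open>lam\<close> is represented by an element \<open>g\<close> with respect to the symmetric form \<open>\<tau>\<close>.
  Comparing the Nakayama automorphisms of \<open>\<tau>\<close> and of \<open>lam\<close> shows that \<open>S\<^sup>2\<close> is conjugation by \<open>g\<close>.
\<close>

lemma S2_inner:
  obtains g h where "h * g = 1" "g * h = 1" "\<And>c. g * c = S2 c * g"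
proof -
  obtain g where g: "\<And>x. lam x = A.\<tau> (g * x)" using A.\<tau>_represents[OF lfun_lam] by blast
  have inj: "y = 0" if "y * g = 0" for y
  proof (rule lam_nondeg_right)
    fix x
    have "lam (x * y) = A.\<tau> (x * (y * g))" by (simp add: g A.\<tau>_comm[of g] mult.assoc)
    then show "lam (x * y) = 0" by (simp add: that lfun_0[OF A.lfun_\<tau>])
  qed
  have "surj (\<lambda>y. y * g)" by (rule lmap_inj_surj[OF lmap_mult_right inj])
  then obtain h where h: "h * g = 1" by (metis surjD)
  have "(g * h - 1) * g = 0" by (simp add: left_diff_distrib mult.assoc h)
  then have gh: "g * h = 1" using inj by fastforce
  have "g * c - S2 c * g = 0" for c
  proof (rule A.\<tau>_nondeg)
    fix x
    have "A.\<tau> (x * (g * c)) = lam (c * x)" by (simp add: g A.\<tau>_comm[of x] mult.assoc)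
    also have "... = A.\<tau> (g * x * S2 c)" using lam_nakayama[of c x] by (simp add: g S2_def mult.assoc)
    also have "... = A.\<tau> (x * (S2 c * g))" using A.\<tau>_comm[of g "x * S2 c"] by (simp add: mult.assoc)
    finally show "A.\<tau> (x * (g * c - S2 c * g)) = 0" by (simp add: right_diff_distrib lfun_diff[OF A.lfun_\<tau>])
  qed
  then show thesis using h gh by (intro that[of h g]) auto
qed

lemma root_exists: assumes "M > 0" shows "\<exists>x. x ^ M = (b :: 'k)"
proof -
  have "degree (monom 1 M - [:b:]) = M"
    using assms by (subst diff_conv_add_uminus, subst degree_add_eq_left) (auto simp: degree_monom_eq)
  then obtain x where "poly (monom 1 M - [:b:]) x = 0" using alg_closed_imp_poly_has_root[of "monom 1 M - [:b:]"] assms by auto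
  then show ?thesis by (auto simp: poly_monom)
qed

text \<open>
  A power \<open>g\<^sup>M\<close> of the conjugating element is central, since \<open>S\<^sup>2\<close> has finite order.  It acts by a
  scalar on every block, and dividing \<open>g\<close> by an \<open>M\<close>-th root of these scalars makes its \<open>M\<close>-th power
  equal to \<open>1\<close>.
\<close>

lemma S2_inner_of_finite_order:
  obtains u M where "M > 0" "u ^ M = 1" "\<forall>c. u * c = S2 c * u"
proof -
  obtain g h where g: "h * g = 1" "g * h = 1" "\<And>c. g * c = S2 c * g" by (rule S2_inner) blast
  obtain M where M: "M > 0" "\<forall>x. (S2 ^^ M) x = x" by (rule S2_finite_order)
  have "g ^ k * c = (S2 ^^ k) c * g ^ k" for k c
  proof (induction k)
    case (Suc k)
    have "g ^ Suc k * c = g * (S2 ^^ k) c * g ^ k" by (simp add: Suc mult.assoc)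
    also have "... = S2 ((S2 ^^ k) c) * g ^ Suc k" by (simp only: g(3) mult.assoc power_Suc)
    finally show ?case by simp
  qed simp
  from this[of M] have central: "g ^ M * c = c * g ^ M" for c by (simp add: M)
  have gM: "h ^ k * g ^ k = 1" for k
  proof (induction k)
    case (Suc k)
    have "h ^ Suc k * g ^ Suc k = h ^ k * (h * g) * g ^ k" by (simp only: power_Suc2[of h] power_Suc[of g] mult.assoc)
    then show ?case by (simp add: g Suc)
  qed simp
  obtain X where "A.orthogonal_decomposition 1 X" using A.decomposition_exists[of 1] by auto
  then interpret P: peirce scale Basis "(*)" 1 X by unfold_locales
  define \<beta> where "\<beta> f = P.ev f (g ^ M)" for f
  have \<beta>: "g ^ M * f = scale (\<beta> f) f" "f * g ^ M = scale (\<beta> f) f" if f: "f \<in> X" for f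
  proof -
    have "f * (g ^ M * f) = g ^ M * (f * f)" by (simp only: central mult.assoc)
    then show "g ^ M * f = scale (\<beta> f) f" using P.ev[OF f, of "g ^ M"] by (simp add: A.minimal_idem[OF P.minX[OF f]] \<beta>_def)
    then show "f * g ^ M = scale (\<beta> f) f" by (simp add: central)
  qed
  have \<beta>0: "\<beta> f \<noteq> 0" if f: "f \<in> X" for f
  proof
    assume "\<beta> f = 0"
    then have "h ^ M * (g ^ M * f) = 0" by (simp add: \<beta>[OF f])
    then have "f = 0" by (simp add: gM flip: mult.assoc)
    then show False using A.minimal_nonzero[OF P.minX[OF f]] by simp
  qed
  define r where "r b = (SOME x. x ^ M = (1 / b :: 'k))" for b
  have r: "r b ^ M = 1 / b" for b unfolding r_def by (rule someI_ex[OF root_exists[OF M(1)]])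
  define y where "y = (\<Sum>f\<in>X. scale (r (\<beta> f)) f)"
  have y_central: "y * a = a * y" for a
  proof -
    have one: "(\<Sum>f\<in>X. f) = 1" by (rule P.sumX)
    have "y * a = (\<Sum>f\<in>X. scale (r (\<beta> f)) f) * a * (\<Sum>k\<in>X. k)" by (simp add: y_def one)
    also have "... = (\<Sum>f\<in>X. \<Sum>k\<in>X. scale (r (\<beta> f)) (f * a * k))"
      by (simp add: sum_distrib_left sum_distrib_right scale_mult_left) (rule sum.swap)
    also have "... = (\<Sum>f\<in>X. \<Sum>k\<in>X. scale (r (\<beta> k)) (f * a * k))"
    proof (intro sum.cong refl)
      fix f k assume f: "f \<in> X" and k: "k \<in> X"
      have "scale (\<beta> f) (f * a * k) = (f * g ^ M) * (a * k)" by (simp add: \<beta>[OF f] scale_mult_left mult.assoc)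
      also have "... = f * (a * (k * g ^ M))" by (simp add: central mult.assoc)
      also have "... = scale (\<beta> k) (f * a * k)" by (simp add: \<beta>[OF k] scale_mult_right mult.assoc)
      finally have "scale (\<beta> f) (f * a * k) = scale (\<beta> k) (f * a * k)" .
      then show "scale (r (\<beta> f)) (f * a * k) = scale (r (\<beta> k)) (f * a * k)" by auto
    qed
    also have "... = (\<Sum>f\<in>X. f) * a * y"
      by (simp add: sum_distrib_left sum_distrib_right scale_mult_right y_def scale_sum_right) (rule sum.swap)
    finally show ?thesis by (simp add: one)
  qed
  have yk: "y ^ k = (\<Sum>f\<in>X. scale (r (\<beta> f) ^ k) f)" for k
  proof (induction k)
    case 0 then show ?case by (simp add: P.sumX)
  next
    case (Suc k)
    have "y ^ Suc k = (\<Sum>f\<in>X. \<Sum>k'\<in>X. scale (r (\<beta> f)) f * scale (r (\<beta> k') ^ k) k')"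
      by (simp only: power_Suc Suc) (simp only: y_def sum_product)
    also have "... = (\<Sum>f\<in>X. \<Sum>k'\<in>X. if f = k' then scale (r (\<beta> f) ^ Suc k) f else 0)"
      by (intro sum.cong refl) (auto simp: scale_mult_left scale_mult_right P.multX mult.commute)
    also have "... = (\<Sum>f\<in>X. scale (r (\<beta> f) ^ Suc k) f)" using P.finX by simp
    finally show ?case .
  qed
  have "(g * y) ^ k = g ^ k * y ^ k" for k
  proof (induction k)
    case (Suc k)
    have "(g * y) ^ Suc k = g * (y * g ^ k) * y ^ k" by (simp add: Suc mult.assoc)
    also have "... = g ^ Suc k * y ^ Suc k" by (simp only: y_central power_Suc mult.assoc)
    finally show ?case .
  qed simp
  then have "(g * y) ^ M = g ^ M * y ^ M" .
  also have "... = (\<Sum>f\<in>X. f)"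
    unfolding yk sum_distrib_left by (intro sum.cong refl) (simp add: scale_mult_right \<beta> r \<beta>0)
  finally have "(g * y) ^ M = 1" by (simp add: P.sumX)
  moreover have "(g * y) * c = S2 c * (g * y)" for c
  proof -
    have "(g * y) * c = (g * c) * y" by (simp only: mult.assoc y_central[of c])
    also have "... = S2 c * (g * y)" by (simp only: g(3) mult.assoc)
    finally show ?thesis .
  qed
  ultimately show thesis using M(1) by (intro that) auto
qed

lemma root_of_unity_sum: assumes "(q :: 'k) ^ M = 1" "q \<noteq> 1" shows "(\<Sum>k<M. q ^ k) = 0"
  using geometric_sum[OF assms(2), of M] assms(1) by simp

text \<open>
  The spectral idempotents of \<open>u\<close> are \<open>p j = 1/M \<Sum> w\<^bsup>-jk\<^esup> u\<^sup>k\<close>; they are split further into minimal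
  idempotents, which inherit the eigenvalues.
\<close>

lemma eigen_decomposition:
  assumes M: "M > 0" and u: "u ^ M = 1" and w: "(w :: 'k) ^ M = 1" "\<forall>k. 0 < k \<longrightarrow> k < M \<longrightarrow> w ^ k \<noteq> 1"
  obtains X a where "A.orthogonal_decomposition 1 X" 
    "\<forall>f\<in>X. u * f = scale (w ^ a f) f \<and> f * u = scale (w ^ a f) f"
proof -
  have w0: "w \<noteq> 0" using w(1) M by (auto simp: power_0_left)
  define p where "p j = scale (1 / of_nat M) (\<Sum>k<M. scale ((1 / w ^ j) ^ k) (u ^ k))" for j
  have up: "u * p j = scale (w ^ j) (p j)" and pu: "p j * u = scale (w ^ j) (p j)" for j
  proof -
    let ?a = "\<lambda>k. scale ((1 / w ^ j) ^ k) (u ^ k)"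
    have "?a M = ?a 0" using u w(1) by (simp add: power_divide flip: power_mult) (simp add: mult.commute power_mult)
    then have shift: "(\<Sum>k<M. ?a (Suc k)) = (\<Sum>k<M. ?a k)"
      using sum.lessThan_Suc_shift[of ?a M] by simp
    have a: "u * ?a k = scale (w ^ j) (?a (Suc k))" "?a k * u = scale (w ^ j) (?a (Suc k))" for k
      using w0 by (simp_all add: scale_mult_left scale_mult_right power_commutes)
    have "u * (\<Sum>k<M. ?a k) = scale (w ^ j) (\<Sum>k<M. ?a (Suc k))" "(\<Sum>k<M. ?a k) * u = scale (w ^ j) (\<Sum>k<M. ?a (Suc k))"
      unfolding sum_distrib_left sum_distrib_right a scale_sum_right by (rule refl)+
    then show "u * p j = scale (w ^ j) (p j)" "p j * u = scale (w ^ j) (p j)"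
      unfolding shift p_def by (simp_all add: scale_mult_left scale_mult_right mult.commute)
  qed
  have ukp: "u ^ k * p j = scale ((w ^ j) ^ k) (p j)" for k j
    by (induction k) (simp_all add: scale_mult_right up mult.assoc mult.commute)
  have q1: "w ^ j / w ^ i \<noteq> 1" if "i < M" "j < M" "i \<noteq> j" for i j
  proof
    assume "w ^ j / w ^ i = 1"
    then have e: "w ^ j = w ^ i" using w0 by simp
    have "w ^ (j - i) = 1" if "i < j" using power_diff[OF w0, of i j] that e w0 by simp
    moreover have "w ^ (i - j) = 1" if "j < i" using power_diff[OF w0, of j i] that e w0 by simp
    ultimately show False using w(2)[rule_format, of "j - i"] w(2)[rule_format, of "i - j"] that by (cases i j rule: linorder_cases) auto
  qed
  have "(w ^ j) ^ M = 1" for j by (metis mult.commute power_mult power_one w(1))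
  then have qM: "(w ^ j / w ^ i) ^ M = 1" for i j by (simp add: power_divide)
  have pp: "p i * p j = (if i = j then p i else 0)" if "i \<in> {..<M}" "j \<in> {..<M}" for i j
  proof -
    have "p i * p j = scale (1 / of_nat M) (\<Sum>k<M. scale ((1 / w ^ i) ^ k * (w ^ j) ^ k) (p j))"
      by (simp add: p_def[of i] scale_mult_left sum_distrib_right ukp)
    also have "... = scale (1 / of_nat M * (\<Sum>k<M. (w ^ j / w ^ i) ^ k)) (p j)"
      by (simp only: scale_scale[symmetric] scale_sum_left) (simp add: power_divide)
    finally have e: "p i * p j = scale (1 / of_nat M * (\<Sum>k<M. (w ^ j / w ^ i) ^ k)) (p j)" .
    show ?thesis
    proof (cases "i = j")
      case True
      then show ?thesis using e M w0 by simp
    next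
      case False
      then show ?thesis using e root_of_unity_sum[OF qM q1] that by simp
    qed
  qed
  have sum: "(\<Sum>j<M. p j) = 1"
  proof -
    have "(\<Sum>j<M. p j) = scale (1 / of_nat M) (\<Sum>k<M. scale (\<Sum>j<M. (1 / w ^ k) ^ j) (u ^ k))"
      unfolding p_def scale_sum_left scale_sum_right[symmetric]
      by (rule arg_cong[where f = "scale _"], subst sum.swap) (simp add: power_divide mult.commute flip: power_mult)
    also have "(\<Sum>k<M. scale (\<Sum>j<M. (1 / w ^ k) ^ j) (u ^ k)) = (\<Sum>k<M. if k = 0 then scale (of_nat M) 1 else 0)"
    proof (rule sum.cong[OF refl])
      fix k assume k: "k \<in> {..<M}"
      show "scale (\<Sum>j<M. (1 / w ^ k) ^ j) (u ^ k) = (if k = 0 then scale (of_nat M) 1 else 0)"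
      proof (cases "k = 0")
        case False
        have "(\<Sum>j<M. (w ^ 0 / w ^ k) ^ j) = 0" by (rule root_of_unity_sum[OF qM q1]) (use k False M in auto)
        then show ?thesis using False by simp
      qed simp
    qed
    finally show ?thesis using M by simp
  qed
  obtain X where X: "A.orthogonal_decomposition (\<Sum>j<M. p j) X" "\<forall>f\<in>X. \<exists>j\<in>{..<M}. p j * f = f \<and> f * p j = f"
    using A.decomposition_sum[of "{..<M}" p] pp by auto
  have "\<forall>f\<in>X. \<exists>j. u * f = scale (w ^ j) f \<and> f * u = scale (w ^ j) f"
  proof
    fix f assume "f \<in> X"
    then obtain j where j: "p j * f = f" "f * p j = f" using X(2) by blast
    have "u * f = u * p j * f" "f * u = f * (p j * u)" using j by (simp_all add: mult.assoc flip: mult.assoc[of f])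
    then show "\<exists>j. u * f = scale (w ^ j) f \<and> f * u = scale (w ^ j) f"
      by (intro exI[of _ j]) (simp add: up pu scale_mult_left scale_mult_right j)
  qed
  then obtain a where "\<forall>f\<in>X. u * f = scale (w ^ a f) f \<and> f * u = scale (w ^ a f) f" by metis
  then show thesis using X(1) unfolding sum by (intro that)
qed

text \<open>
  \<open>lam 1\<close> is the trace of \<open>S\<^sup>2\<close>, which is the sum of \<open>w\<^bsup>a f - a h\<^esup>\<close> over all pairs of linked
  idempotents \<open>f\<close>, \<open>h\<close>.  If it vanishes, the corresponding complex sum vanishes too, and then so does
  the sum of the complex eigenvalues over each block.  Transported back, this says that \<open>lam\<close> is
  identically zero, contrary to \<open>lam \<Lambda> = 1\<close>.
\<close>

lemma lam_one_nonzero: "lam 1 \<noteq> 0"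
proof
  assume zero: "lam 1 = 0"
  obtain u M where M: "M > 0" and u: "u ^ M = 1" "\<forall>c. u * c = S2 c * u" by (rule S2_inner_of_finite_order)
  obtain w :: 'k and z :: complex where w: "w ^ M = 1" "\<forall>k. 0 < k \<longrightarrow> k < M \<longrightarrow> w ^ k \<noteq> 1" and z: "norm z = 1"
    and wz: "\<forall>q. rpoly q w = 0 \<longleftrightarrow> rpoly q z = 0"
    by (rule primitive_root_with_complex_conjugate[OF M])
  obtain X a where X: "A.orthogonal_decomposition 1 X" 
    and a': "\<forall>f\<in>X. u * f = scale (w ^ a f) f \<and> f * u = scale (w ^ a f) f"
    by (rule eigen_decomposition[OF M u(1) w])
  have a: "u * f = scale (w ^ a f) f" "f * u = scale (w ^ a f) f" if "f \<in> X" for f using a' that by blast+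
  interpret P: peirce scale Basis "(*)" 1 X by unfold_locales (rule X)
  have uu: "u * u ^ (M - 1) = 1" using M u(1) by (metis Suc_diff_1 power_Suc)
  have S2: "S2 y = u * (y * u ^ (M - 1))" for y
  proof -
    have "u * (y * u ^ (M - 1)) = S2 y * (u * u ^ (M - 1))" by (simp only: u(2)[rule_format, of y] mult.assoc[symmetric])
    then show ?thesis by (simp only: uu mult_1_right)
  qed
  have fu: "f * u ^ k = scale (w ^ (k * a f)) f" if "f \<in> X" for f k
    by (induction k) (simp_all add: a[OF that] scale_mult_left scale_mult_right power_add mult.commute[where 'a = 'k] flip: mult.assoc)
  have lam: "lam x = (\<Sum>f\<in>X. \<Sum>h | h \<in> X \<and> P.linked f h. w ^ a f * w ^ ((M - 1) * a h) * P.ev f x)" for x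
    unfolding trace_left_mult_S2[of x, symmetric] S2 by (rule P.trace_conjugation) (simp_all add: a fu)
  have ev1: "P.ev f 1 = 1" if "f \<in> X" for f
    by (rule P.ev_eqI[OF that]) (simp add: A.minimal_idem[OF P.minX[OF that]])
  have zM: "z ^ M = 1"
    using wz[rule_format, of "monom 1 M - 1"] by (simp add: rpoly_diff rpoly_monom rpoly_1 w)
  have zc: "z ^ ((M - 1) * k) = cnj (z ^ k)" for k
  proof -
    have "z * z ^ (M - 1) = 1" using M zM by (metis Suc_diff_1 power_Suc)
    moreover have "z * cnj z = 1" using z by (simp flip: complex_norm_square)
    ultimately have "z ^ (M - 1) = cnj z" by (metis mult_cancel_left mult_zero_left zero_neq_one)
    then show ?thesis by (simp add: power_mult)
  qed
  \<comment> \<open>The rational polynomial whose value at \<open>w\<close> is \<open>lam 1\<close>; the exponent \<open>M - 1\<close> stands for inversion.\<close>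
  define Q where "Q = (\<Sum>f\<in>X. \<Sum>h | h \<in> X \<and> P.linked f h. monom (1::rat) (a f + (M - 1) * a h))"
  have "rpoly Q w = 0" using zero by (simp add: lam ev1 Q_def rpoly_sum rpoly_monom power_add)
  then have "rpoly Q z = 0" by (simp add: wz[rule_format])
  then have s0: "(\<Sum>f\<in>X. \<Sum>h | h \<in> X \<and> P.linked f h. z ^ a f * cnj (z ^ a h)) = 0"
    by (simp only: Q_def rpoly_sum rpoly_monom power_add zc)
  have block: "(\<Sum>h | h \<in> X \<and> P.linked f h. w ^ ((M - 1) * a h)) = 0" if f: "f \<in> X" for f
  proof -
    define q where "q = (\<Sum>h | h \<in> X \<and> P.linked f h. monom (1::rat) ((M - 1) * a h))"
    have "rpoly q z = cnj (\<Sum>h | h \<in> X \<and> P.linked f h. z ^ a h)"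
      by (simp only: q_def rpoly_sum rpoly_monom zc cnj_sum)
    also have "... = 0" using P.block_sums_vanish[OF s0 f] by simp
    finally have "rpoly q w = 0" by (simp add: wz[rule_format])
    then show ?thesis by (simp add: q_def rpoly_sum rpoly_monom)
  qed
  have "lam \<Lambda> = 0"
    unfolding lam
  proof (rule sum.neutral, rule ballI)
    fix f assume f: "f \<in> X"
    have "(\<Sum>h | h \<in> X \<and> P.linked f h. w ^ a f * w ^ ((M - 1) * a h) * P.ev f \<Lambda>)
      = w ^ a f * P.ev f \<Lambda> * (\<Sum>h | h \<in> X \<and> P.linked f h. w ^ ((M - 1) * a h))"
      by (simp only: sum_distrib_left mult_ac)
    then show "(\<Sum>h | h \<in> X \<and> P.linked f h. w ^ a f * w ^ ((M - 1) * a h) * P.ev f \<Lambda>) = 0"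
      by (simp only: block[OF f] mult_zero_right)
  qed
  then show False by (simp add: lam_\<Lambda>)
qed

lemma v_eq_one: "v = 1"
proof (rule lfun_sep)
  fix f assume f: "lfun f"
  have "lam 1 * f 1 = f v * lam 1" using lam_right_modular[OF f, of 1] by (simp add: sw_one[OF bil_prod[OF lfun_lam f]])
  then show "f v = f 1" using lam_one_nonzero by simp
qed

lemma S2_involution: "S2 (S2 c) = c"
  using radford_formula[of c] by (simp add: v_eq_one S2_def)

text \<open>
  This expresses that the tensor product of the regular representation with a representation \<open>V\<close>
  is a multiple of the regular representation, for \<open>V\<close> regular, on the level of characters.  With
  \<open>H\<^sub>k(y) = y\<^sub>1 \<phi>\<^sub>k(y\<^sub>2)\<close> and \<open>G\<^sub>k(y) = y\<^sub>1 \<tau>(S(e\<^sub>k) y\<^sub>2)\<close> for dual bases \<open>e\<^sub>k\<close>, \<open>\<phi>\<^sub>k\<close>, the left-hand side is the trace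
  of \<open>\<Sum> G\<^sub>k \<circ> L\<^sub>x \<circ> H\<^sub>k\<close>.  Permuting cyclically gives \<open>\<Sum> H\<^sub>k \<circ> G\<^sub>k \<circ> L\<^sub>x\<close>, and \<open>\<Sum> H\<^sub>k \<circ> G\<^sub>k\<close> is \<open>\<tau>(1) = n\<close> times the
  identity.
\<close>

lemma regular_character_idempotent: "sw x (\<lambda>a b. A.\<tau> a * A.\<tau> b) = of_nat (card Basis) * A.\<tau> x"
proof -
  define G where "G k y = swv y (\<lambda>p q. scale (A.\<tau> (S k * q)) p)" for k y
  define H where "H k y = swv y (\<lambda>a b. scale (coord k b) a)" for k y
  have lG: "lmap (G k)" and lH: "lmap (H k)" for k
    using lmap_swv unfolding G_def H_def by auto
  have G: "f (G k y) = sw y (\<lambda>p q. A.\<tau> (S k * q) * f p)" and H: "f (H k y) = sw y (\<lambda>a b. coord k b * f a)" if "lfun f" for f k y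
    by (simp_all add: G_def H_def lfun_swv[OF that] lfun_scale[OF that])
  note lt = lfun_simps[OF A.lfun_\<tau>]
  have exp: "(\<Sum>k\<in>Basis. coord k b * A.\<tau> (S k * q)) = A.\<tau> (S b * q)" for b q
    by (rule lfun_expand[of "\<lambda>b. A.\<tau> (S b * q)", symmetric]) (rule lfunI; simp add: lin_simps lt)
  have HG: "(\<Sum>k\<in>Basis. H k (G k y)) = scale (of_nat (card Basis)) y" for y
  proof (rule lfun_sep)
    fix f assume f: "lfun f"
    note l = lt lfun_simps[OF f]
    have t: "tril (\<lambda>a b q. f a * A.\<tau> (S b * q))" by (rule trilI; simp add: lin_simps l)
    have "f (\<Sum>k\<in>Basis. H k (G k y)) = (\<Sum>k\<in>Basis. sw y (\<lambda>p q. A.\<tau> (S k * q) * sw p (\<lambda>a b. coord k b * f a)))"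
      by (simp add: lfun_sum[OF f] H[OF f] G[OF lfun_sw])
    also have "... = sw y (\<lambda>p q. sw p (\<lambda>a b. f a * (\<Sum>k\<in>Basis. coord k b * A.\<tau> (S k * q))))"
      by (simp add: sw_push_left sum_distrib_left mult_ac flip: sw_sum)
    also have "... = sw y (\<lambda>a r. sw r (\<lambda>b q. f a * A.\<tau> (S b * q)))"
      unfolding exp by (rule sw_coassoc[OF t])
    also have "... = sw y (\<lambda>a r. f a * (\<epsilon> r * A.\<tau> 1))"
      by (simp add: sw_antipode_left[OF A.lfun_\<tau>] flip: sw_push_left)
    also have "... = A.\<tau> 1 * sw y (\<lambda>a r. \<epsilon> r * f a)" by (simp add: sw_push_left mult_ac)
    also have "... = f (scale (of_nat (card Basis)) y)"
      by (simp add: sw_counit_right[OF f] lfun_scale[OF f] A.\<tau>_def trace_id)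
    finally show "f (\<Sum>k\<in>Basis. H k (G k y)) = f (scale (of_nat (card Basis)) y)" .
  qed
  have GH: "(\<Sum>k\<in>Basis. G k (x * H k a)) = swv x (\<lambda>b c. scale (A.\<tau> c) (b * a))" for a
  proof (rule lfun_sep)
    fix f assume f: "lfun f"
    note l = lt lfun_simps[OF f]
    have t: "tril (\<lambda>c d e. f (x1 * c) * A.\<tau> (S e * (x2 * d)))" for x1 x2 by (rule trilI; simp add: lin_simps l)
    have b: "bil (\<lambda>p q. f p * A.\<tau> (S a2 * q))" for a2 by (rule bilI; simp add: lin_simps l)
    have L: "lfun (\<lambda>h. sw (x * h) (\<lambda>p q. A.\<tau> (S k * q) * f p))" for k by (rule lfunI; simp add: lin_simps l)
    have "f (\<Sum>k\<in>Basis. G k (x * H k a)) = (\<Sum>k\<in>Basis. sw a (\<lambda>a1 a2. coord k a2 * sw (x * a1) (\<lambda>p q. A.\<tau> (S k * q) * f p)))"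
      by (simp add: lfun_sum[OF f] G[OF f] H[OF L])
    also have "... = sw a (\<lambda>a1 a2. sw (x * a1) (\<lambda>p q. (\<Sum>k\<in>Basis. coord k a2 * A.\<tau> (S k * q)) * f p))"
      by (simp add: sw_push_left sum_distrib_left sum_distrib_right mult_ac flip: sw_sum)
    also have "... = sw a (\<lambda>a1 a2. sw x (\<lambda>x1 x2. sw a1 (\<lambda>c d. f (x1 * c) * A.\<tau> (S a2 * (x2 * d)))))"
      unfolding exp by (simp add: sw_mult[OF b] mult.commute[where 'a = 'k])
    also have "... = sw x (\<lambda>x1 x2. sw a (\<lambda>a1 a2. sw a1 (\<lambda>c d. f (x1 * c) * A.\<tau> (S a2 * (x2 * d)))))"
      by (rule sw_exchange)
    also have "... = sw x (\<lambda>x1 x2. sw a (\<lambda>c r. sw r (\<lambda>d e. f (x1 * c) * A.\<tau> (S e * (x2 * d)))))"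
      by (simp only: sw_coassoc[OF t])
    also have "... = sw x (\<lambda>x1 x2. sw a (\<lambda>c r. f (x1 * c) * (\<epsilon> r * A.\<tau> x2)))"
    proof (intro sw_cong)
      fix x1 x2 c r
      have "A.\<tau> (S e * (x2 * d)) = A.\<tau> (x2 * (d * S e))" for d e using A.\<tau>_comm[of "S e" "x2 * d"] by (simp add: mult.assoc)
      then show "sw r (\<lambda>d e. f (x1 * c) * A.\<tau> (S e * (x2 * d))) = f (x1 * c) * (\<epsilon> r * A.\<tau> x2)"
        using sw_antipode_right[OF lfun_mult_left[OF A.lfun_\<tau>, of x2], of r] by (simp flip: sw_push_left)
    qed
    also have "... = sw x (\<lambda>x1 x2. A.\<tau> x2 * sw a (\<lambda>c r. \<epsilon> r * f (x1 * c)))" by (simp add: sw_push_left mult_ac)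
    also have "... = f (swv x (\<lambda>b c. scale (A.\<tau> c) (b * a)))"
      by (simp add: sw_counit_right[OF lfun_mult_left[OF f]] lfun_swv[OF f] lfun_scale[OF f])
    finally show "f (\<Sum>k\<in>Basis. G k (x * H k a)) = f (swv x (\<lambda>b c. scale (A.\<tau> c) (b * a)))" .
  qed
  have "sw x (\<lambda>a b. A.\<tau> a * A.\<tau> b) = trace (\<lambda>a. swv x (\<lambda>b c. scale (A.\<tau> c) (b * a)))"
    by (simp add: swv_def trace_sum trace_scale sw_def A.\<tau>_def[of "_ :: 'h", symmetric] mult_ac)
  also have "... = (\<Sum>k\<in>Basis. trace (\<lambda>a. G k (x * H k a)))" by (simp only: GH[symmetric] trace_sum)
  also have "... = (\<Sum>k\<in>Basis. trace (\<lambda>a. H k (G k (x * a))))"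
    by (intro sum.cong refl trace_comm[OF lmap_comp[OF lG lmap_mult_left] lH])
  also have "... = trace (\<lambda>a. scale (of_nat (card Basis)) (x * a))" by (simp only: HG[symmetric] trace_sum)
  finally show ?thesis by (simp add: trace_scale A.\<tau>_def)
qed

lemma card_Basis_pos: "card Basis > 0"
proof -
  have "Basis \<noteq> {}" using expand[of 1] by auto
  then show ?thesis using finite_Basis by (simp add: card_gt_0_iff)
qed

lemma S2_comult: assumes F: "bil F" shows "sw (S2 x) F = sw x (\<lambda>a b. F (S2 a) (S2 b))"
proof -
  note l = bil_simps[OF F]
  have "bil (\<lambda>a b. F (S b) (S a))" by (rule bilI; simp add: lin_simps l)
  then show ?thesis by (simp add: S2_def antipode_comult[OF F] antipode_comult)
qed

lemma scale_half: "scale (1 / 2) (y + y) = (y :: 'h)"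
  by (simp add: scale_right_distrib flip: scale_left_distrib)

text \<open>
  The idempotent \<open>e = \<tau>/n\<close> of the dual acts on \<open>H\<close> by the projection \<open>E(x) = x\<^sub>1 e(x\<^sub>2)\<close>, which commutes
  with \<open>S\<^sup>2\<close>, and \<open>Tr(E \<circ> S\<^sup>2) = \<lambda>(1) e(\<Lambda>) = \<lambda>(1)/n\<close>.  As \<open>S\<^sup>2\<close> is an involution, \<open>P = (E + E S\<^sup>2)/2\<close> is an
  idempotent, so that \<open>Tr(E \<circ> S\<^sup>2) = 2 Tr(P) - Tr(E)\<close> is an integer.
\<close>

lemma trace_S2_divisible: obtains i :: int where "lam 1 = of_nat (card Basis) * of_int i"
proof -
  define n where "n = (of_nat (card Basis) :: 'k)"
  have n: "n \<noteq> 0" using card_Basis_pos by (simp add: n_def)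
  define e where "e x = A.\<tau> x / n" for x
  have e: "lfun e" by (rule lfunI) (simp_all add: e_def lfun_simps[OF A.lfun_\<tau>] add_divide_distrib)
  have ee: "sw x (\<lambda>a b. e a * e b) = e x" for x
  proof -
    have "sw x (\<lambda>a b. e a * e b) = sw x (\<lambda>a b. 1 / (n * n) * (A.\<tau> a * A.\<tau> b))" by (simp add: e_def)
    also have "... = 1 / (n * n) * (n * A.\<tau> x)" by (simp only: sw_push_left[symmetric] regular_character_idempotent n_def)
    finally show ?thesis using n by (simp add: e_def)
  qed
  have eT: "e (S2 x) = e x" for x
  proof -
    have "A.\<tau> (S2 x) = trace (\<lambda>z. S2 (x * S2 z))" by (simp add: A.\<tau>_def S2_mult S2_involution)
    also have "... = trace (\<lambda>z. x * S2 (S2 z))" by (rule trace_comm[OF lmap_S2 lmap_comp[OF lmap_mult_left lmap_S2]])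
    finally show ?thesis by (simp add: S2_involution e_def A.\<tau>_def)
  qed
  define E where "E x = swv x (\<lambda>a b. scale (e b) a)" for x
  have E: "f (E x) = sw x (\<lambda>a b. e b * f a)" if "lfun f" for f x
    by (simp add: E_def lfun_swv[OF that] lfun_scale[OF that])
  have lE: "lmap E" unfolding E_def by (rule lmap_swv)
  have EE: "E (E x) = E x" for x
  proof (rule lfun_sep)
    fix f assume f: "lfun f"
    note l = lfun_simps[OF e] lfun_simps[OF f]
    have t: "tril (\<lambda>a b q. f a * (e b * e q))" by (rule trilI; simp add: lin_simps l)
    have "f (E (E x)) = sw x (\<lambda>p q. sw p (\<lambda>a b. f a * (e b * e q)))"
      by (simp add: E[OF f] E[OF lfun_sw] sw_push_left mult_ac)
    also have "... = sw x (\<lambda>a r. f a * sw r (\<lambda>b q. e b * e q))" by (simp add: sw_coassoc[OF t] sw_push_left)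
    finally show "f (E (E x)) = f (E x)" by (simp add: ee E[OF f] mult.commute)
  qed
  have ET: "E (S2 x) = S2 (E x)" for x
  proof (rule lfun_sep)
    fix f assume f: "lfun f"
    note l = lfun_simps[OF e] lfun_simps[OF f]
    have b: "bil (\<lambda>a b. e b * f a)" by (rule bilI; simp add: lin_simps l)
    show "f (E (S2 x)) = f (S2 (E x))"
      by (simp add: E[OF f] E[OF lfun_comp[OF f lmap_S2]] S2_comult[OF b] eT)
  qed
  have e\<Lambda>: "e \<Lambda> = 1 / n"
    using trace_rank1[OF lfun_\<epsilon>, of \<Lambda>] by (simp add: e_def A.\<tau>_def \<Lambda>_right \<epsilon>_\<Lambda>)
  have tr: "trace (\<lambda>x. E (S2 x)) = lam 1 / n"
  proof -
    note l = lfun_simps[OF e] lam_simps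
    have b: "bil (\<lambda>a b. e b * lam (a * q))" for q by (rule bilI; simp add: lin_simps l)
    have t: "tril (\<lambda>a b q. e (S a) * lam (S b * q))" by (rule trilI; simp add: lin_simps l)
    have "trace (\<lambda>x. E (S2 x)) = sw \<Lambda> (\<lambda>p q. lam (E (S p) * q))"
      unfolding S2_def by (rule trace_comp_antipode[of "\<lambda>x. E (S x)"]) (rule lmap_comp[OF lE lmap_S])
    also have "... = sw \<Lambda> (\<lambda>p q. sw p (\<lambda>a b. e (S a) * lam (S b * q)))"
      by (simp add: E[OF lfun_mult_right[OF lfun_lam]] antipode_comult[OF b])
    also have "... = sw \<Lambda> (\<lambda>a r. sw r (\<lambda>b q. e (S a) * lam (S b * q)))" by (rule sw_coassoc[OF t])
    also have "... = sw \<Lambda> (\<lambda>a r. lam 1 * (\<epsilon> r * e (S a)))"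
      by (simp add: sw_antipode_left[OF lfun_lam] mult_ac flip: sw_push_left)
    also have "... = lam 1 * e (S \<Lambda>)" by (simp add: sw_counit_right[OF lfun_S[OF e]] flip: sw_push_left)
    finally show ?thesis by (simp add: antipode_\<Lambda> e\<Lambda>)
  qed
  obtain r1 where r1: "trace E = of_nat r1" by (rule trace_idempotent[OF lE EE]) (rule that)
  define P where "P x = scale (1 / 2) (E x + E (S2 x))" for x
  have lP: "lmap P" by (rule lmapI) (simp_all add: P_def lmap_simps[OF lE] lmap_simps[OF lmap_S2] algebra_simps scale_right_distrib)
  have PP: "P (P x) = P x" for x
  proof -
    have "E (P x) = P x" "E (S2 (P x)) = P x"
      by (simp_all add: P_def lmap_simps[OF lE] lmap_simps[OF lmap_S2] EE ET S2_involution add.commute)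
    then show ?thesis unfolding P_def[of "P x"] by (simp only: scale_half)
  qed
  obtain r2 where r2: "trace P = of_nat r2" by (rule trace_idempotent[OF lP PP]) (rule that)
  have "trace P = 1 / 2 * (trace E + lam 1 / n)" unfolding P_def trace_scale trace_add tr by simp
  then have "lam 1 / n = of_int (2 * int r2 - int r1)" by (simp add: r1 r2 field_simps)
  then have "lam 1 = n * of_int (2 * int r2 - int r1)" using n by (simp add: field_simps)
  then show thesis unfolding n_def by (rule that)
qed

text \<open>
  With the idempotent \<open>P = (1 + S\<^sup>2)/2\<close> of rank \<open>r\<close>, the integer \<open>lam 1 = 2 r - n\<close> is a nonzero multiple
  of \<open>n\<close>, hence \<open>r\<close> is \<open>0\<close> or \<open>n\<close>; the first case is excluded by \<open>S(1) = 1\<close>.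
\<close>

theorem antipode_involution: "S (S x) = x"
proof -
  define P where "P x = scale (1 / 2) (x + S2 x)" for x
  have lP: "lmap P" by (rule lmapI) (simp_all add: P_def lmap_simps[OF lmap_S2] algebra_simps scale_right_distrib)
  have PP: "P (P x) = P x" for x
  proof -
    have "S2 (P x) = P x" by (simp add: P_def lmap_simps[OF lmap_S2] S2_involution add.commute)
    then show ?thesis unfolding P_def[of "P x"] by (simp only: scale_half)
  qed
  obtain r where r: "trace P = of_nat r" "r \<le> card Basis" "r = 0 \<longrightarrow> (\<forall>x. P x = 0)"
    "r = card Basis \<longrightarrow> (\<forall>x. P x = x)"
    by (rule trace_idempotent[OF lP PP])
  have "trace P = 1 / 2 * (of_nat (card Basis) + lam 1)"
    unfolding P_def trace_scale trace_add trace_id using trace_left_mult_S2[of 1] by simp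
  then have D: "lam 1 = of_int (2 * int r - int (card Basis))" by (simp add: r field_simps)
  obtain i :: int where i: "lam 1 = of_nat (card Basis) * of_int i" by (rule trace_S2_divisible)
  have "(of_int (2 * int r - int (card Basis)) :: 'k) = of_int (int (card Basis) * i)" using D i by simp
  then have eq: "2 * int r - int (card Basis) = int (card Basis) * i" by (simp only: of_int_eq_iff)
  have "i \<noteq> 0" using i lam_one_nonzero by auto
  have "r = 0 \<or> r = card Basis"
  proof (rule ccontr)
    assume "\<not> ?thesis"
    then have "\<bar>2 * int r - int (card Basis)\<bar> < int (card Basis)" using r(2) by linarith
    moreover have "int (card Basis) \<le> \<bar>int (card Basis) * i\<bar>"
      using mult_left_mono[of 1 "\<bar>i\<bar>" "int (card Basis)"] \<open>i \<noteq> 0\<close> by (simp add: abs_mult)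
    ultimately show False using eq by simp
  qed
  moreover have "r \<noteq> 0"
  proof
    assume "r = 0"
    then have "P 1 = 0" using r(3) by blast
    then have "(1 :: 'h) = 0" unfolding P_def S2_one by (simp only: scale_half)
    then show False by simp
  qed
  ultimately have "P x = x" using r(4) by blast
  then have "scale 2 (P x) = scale 2 x" by simp
  then have "x + S2 x = scale 2 x" by (simp add: P_def)
  then show ?thesis using scale_left_distrib[of 1 1 x] by (simp add: S2_def)
qed

lemma lam_eq_regular_character: "lam x = A.\<tau> x"
  using trace_left_mult_S2[of x] by (simp add: A.\<tau>_def S2_def antipode_involution)

lemma lam_one: "lam 1 = of_nat (card Basis)"
  by (simp add: lam_eq_regular_character A.\<tau>_def trace_id)

end

section \<open>Basic invariants\<close>

lemma sum_list_swap_lists: "(\<Sum>a\<leftarrow>xs. \<Sum>b\<leftarrow>ys. f a b) = (\<Sum>b\<leftarrow>ys. \<Sum>a\<leftarrow>xs. (f a b :: 'k::comm_monoid_add))"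
  by (induction xs) (simp_all add: sum_list_addf)

lemma concat_concat: "concat (concat xs) = concat (map concat xs)"
  by (induction xs) simp_all

context semisimple_hopf begin

abbreviation n :: 'k where "n \<equiv> of_nat (card Basis)"
definition ell where "ell = scale n \<Lambda>"

lemma sw_ell: "sw ell F = n * sw \<Lambda> F" by (simp add: ell_def sw_scale sw_push_left)

lemma conv_eq: "lfun f \<Longrightarrow> lfun g \<Longrightarrow> conv \<Delta> f g x = sw x (\<lambda>a b. f a * g b)"
  unfolding conv_def by (rule sw_list[OF bil_prod])

lemma lfun_conv: assumes "lfun f" "lfun g" shows "lfun (conv \<Delta> f g)"
proof -
  have "conv \<Delta> f g = (\<lambda>x. sw x (\<lambda>a b. f a * g b))" by (rule ext) (rule conv_eq[OF assms])
  then show ?thesis by (simp add: lfun_sw)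
qed

lemma integral_ell: "integral_in scale \<epsilon> ell" "\<epsilon> ell = of_nat (vector_space.dim scale UNIV)"
  by (simp_all add: integral_in_def ell_def \<Lambda>_left \<Lambda>_right \<epsilon>_\<Lambda> scale_mult_left scale_mult_right lfun_scale[OF lfun_\<epsilon>] dim_UNIV mult.commute)

lemma integral_on_lam: "integral_on scale \<Delta> lam" "lam 1 = of_nat (vector_space.dim scale UNIV)"
proof -
  have "conv \<Delta> f lam = dual_scale (f 1) lam" "conv \<Delta> lam f = dual_scale (f 1) lam" if f: "lfun f" for f
    by (rule ext; simp add: conv_eq f lfun_lam dual_scale_def lam_left_invariant[OF f] lam_right_modular[OF f] v_eq_one)+
  then show "integral_on scale \<Delta> lam" by (simp add: integral_on_def lfun_lam)
  show "lam 1 = of_nat (vector_space.dim scale UNIV)" by (simp add: lam_one dim_UNIV)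
qed

lemma dual_comult_spec: assumes f: "lfun \<phi>"
  shows dual_comult_lfun: "\<And>\<alpha> \<beta>. (\<alpha>, \<beta>) \<in> set (dual_comult scale \<phi>) \<Longrightarrow> lfun \<alpha> \<and> lfun \<beta>"
    and dual_comult_sum: "\<And>x y. (\<Sum>(\<alpha>, \<beta>)\<leftarrow>dual_comult scale \<phi>. \<alpha> x * \<beta> y) = \<phi> (x * y)"
proof -
  obtain bs where bs: "set bs = Basis" "distinct bs" using finite_distinct_list[OF finite_Basis] by blast
  let ?P = "\<lambda>t. (\<forall>(\<alpha>, \<beta>) \<in> set t. functional scale \<alpha> \<and> functional scale \<beta>) \<and> (\<forall>x y. \<phi> (x * y) = (\<Sum>(\<alpha>, \<beta>)\<leftarrow>t. \<alpha> x * \<beta> y))"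
  have "?P (map (\<lambda>b. (\<lambda>x. \<phi> (x * b), coord b)) bs)"
  proof (intro conjI allI)
    show "\<forall>(\<alpha>, \<beta>)\<in>set (map (\<lambda>b. (\<lambda>x. \<phi> (x * b), coord b)) bs). lfun \<alpha> \<and> lfun \<beta>"
      by (auto simp: lfun_mult_right[OF f] lfun_coord)
    fix x y
    have "\<phi> (x * y) = (\<Sum>b\<in>Basis. coord b y * \<phi> (x * b))" by (rule lfun_expand[OF lfun_mult_left[OF f]])
    also have "... = (\<Sum>b\<leftarrow>bs. \<phi> (x * b) * coord b y)"
      using bs by (simp add: sum_list_distinct_conv_sum_set mult.commute)
    finally show "\<phi> (x * y) = (\<Sum>(\<alpha>, \<beta>)\<leftarrow>map (\<lambda>b. (\<lambda>x. \<phi> (x * b), coord b)) bs. \<alpha> x * \<beta> y)"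
      by (simp add: comp_def)
  qed
  then have P: "?P (dual_comult scale \<phi>)" unfolding dual_comult_def by (rule someI)
  then show "\<And>\<alpha> \<beta>. (\<alpha>, \<beta>) \<in> set (dual_comult scale \<phi>) \<Longrightarrow> lfun \<alpha> \<and> lfun \<beta>" by blast
  show "\<And>x y. (\<Sum>(\<alpha>, \<beta>)\<leftarrow>dual_comult scale \<phi>. \<alpha> x * \<beta> y) = \<phi> (x * y)" using P by metis
qed

abbreviation obt where "obt \<equiv> obtainable scale \<Delta> ell lam"

text \<open>
  \<open>chain r\<close> starts from \<open>lam \<otimes> lam\<close> and uses one more copy of the integral in each step, multiplying
  the first leg into the first argument from the left and the second leg into the second argument
  from the right.  It arises from the iterated Casimir tensor when the antipode is removed from the
  second legs.  \<open>dual_chain\<close> is the same construction for the dual.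
\<close>

primrec chain :: "nat \<Rightarrow> 'h \<Rightarrow> 'h \<Rightarrow> 'k" where
  "chain 0 x y = lam x * lam y"
| "chain (Suc r) x y = (\<Sum>(a, b)\<leftarrow>\<Delta> ell. chain r (a * x) (y * b))"

primrec dual_chain :: "nat \<Rightarrow> ('h \<Rightarrow> 'k) \<Rightarrow> ('h \<Rightarrow> 'k) \<Rightarrow> 'k" where
  "dual_chain 0 f g = f ell * g ell"
| "dual_chain (Suc r) f g = (\<Sum>(\<alpha>, \<beta>)\<leftarrow>dual_comult scale lam. dual_chain r (conv \<Delta> \<alpha> f) (conv \<Delta> g \<beta>))"

text \<open>
  All \<open>q + r\<close> copies of the integral are present from the start, and each step consumes one of
  them.  A step splits the first copy of \<open>ell\<close> and both functionals, and pairs the first piece of the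
  first functional and the last piece of the second one with the two legs of \<open>ell\<close>.
\<close>

lemma chain_obtainable:
  "\<exists>t. obt 2 q t \<and> (\<forall>s\<in>set t. \<exists>c \<phi> \<psi>. s = (c, [\<phi>, \<psi>], replicate q ell) \<and> lfun \<phi> \<and> lfun \<psi>) \<and>
     (\<forall>x y. (\<Sum>(c, \<phi>s, xs)\<leftarrow>t. c * (\<phi>s ! 0) x * (\<phi>s ! 1) y) = chain r x y)"
proof (induction r arbitrary: q)
  case 0
  show ?case
    by (rule exI[of _ "[(1, replicate 2 lam, replicate q ell)]"], intro conjI, rule obtainable.start)
      (auto simp: lfun_lam numeral_2_eq_2)
next
  case (Suc r)
  obtain t where t: "obt 2 (Suc q) t"
    and shape: "\<And>s. s \<in> set t \<Longrightarrow> \<exists>c \<phi> \<psi>. s = (c, [\<phi>, \<psi>], replicate (Suc q) ell) \<and> lfun \<phi> \<and> lfun \<psi>"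
    and val: "\<And>x y. (\<Sum>(c, \<phi>s, xs)\<leftarrow>t. c * (\<phi>s ! 0) x * (\<phi>s ! 1) y) = chain r x y"
    using Suc[of "Suc q"] by blast
  define F where "F s = map (pair_at 2 0) (map (pair_at 0 0) (concat (map (dual_comult_at scale 2)
      (concat (map (dual_comult_at scale 0) (comult_at \<Delta> 0 s))))))" for s :: "('k, 'h) summand"
  \<comment> \<open>The factors are \<open>\<phi>, \<psi>; a, b\<close>, then \<open>\<alpha>, \<beta>, \<psi>; a, b\<close>, then \<open>\<alpha>, \<beta>, \<gamma>, \<delta>; a, b\<close>; pairing \<open>\<alpha>\<close> with \<open>a\<close> and \<open>\<delta>\<close> with \<open>b\<close> leaves \<open>\<beta>, \<gamma>\<close>.\<close>
  let ?t1 = "concat (map (comult_at \<Delta> 0) t)"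
  let ?t2 = "concat (map (dual_comult_at scale 0) ?t1)"
  let ?t3 = "concat (map (dual_comult_at scale 2) ?t2)"
  define t' where "t' = map (pair_at 2 0) (map (pair_at 0 0) ?t3)"
  have t'F: "t' = concat (map F t)"
    unfolding t'_def F_def by (induction t) simp_all
  have "obt 2 (Suc (Suc q)) ?t1"
    by (rule obtainable.comult[OF t]) simp
  then have "obt (Suc 2) (Suc (Suc q)) ?t2"
    by (rule obtainable.dual_comult) simp
  then have "obt (Suc (Suc 2)) (Suc (Suc q)) ?t3"
    by (rule obtainable.dual_comult) simp
  then have "obt (Suc 2) (Suc q) (map (pair_at 0 0) ?t3)"
    by (rule obtainable.pair) simp_all
  then have "obt 2 q t'" unfolding t'_def by (rule obtainable.pair) simp_all
  moreover have Fs: "F (c, [\<phi>, \<psi>], replicate (Suc q) ell) = concat (map (\<lambda>(a, b). concat (map (\<lambda>(\<alpha>, \<beta>). 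
      map (\<lambda>(\<gamma>, \<delta>). (c * \<alpha> a * \<delta> b, [\<beta>, \<gamma>], replicate q ell)) (dual_comult scale \<psi>)) (dual_comult scale \<phi>))) (\<Delta> ell))" for c \<phi> \<psi>
    by (simp add: F_def map_concat comp_def case_prod_unfold concat_concat)
  have "\<exists>c \<phi> \<psi>. s = (c, [\<phi>, \<psi>], replicate q ell) \<and> lfun \<phi> \<and> lfun \<psi>" if st: "s \<in> set t'" for s
  proof -
    obtain s' where s': "s' \<in> set t" "s \<in> set (F s')" using st unfolding t'F set_concat set_map by blast
    obtain c \<phi> \<psi> where e: "s' = (c, [\<phi>, \<psi>], replicate (Suc q) ell)" and f: "lfun \<phi>" "lfun \<psi>" using shape[OF s'(1)] by blast
    have "s \<in> set (F (c, [\<phi>, \<psi>], replicate (Suc q) ell))" using s'(2) unfolding e .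
    then obtain k \<alpha> \<beta> \<gamma> \<delta> where "(\<alpha>, \<beta>) \<in> set (dual_comult scale \<phi>)" "(\<gamma>, \<delta>) \<in> set (dual_comult scale \<psi>)"
      "s = (k, [\<beta>, \<gamma>], replicate q ell)"
      unfolding Fs by auto
    then show ?thesis using dual_comult_lfun[OF f(1)] dual_comult_lfun[OF f(2)] by blast
  qed
  moreover have "(\<Sum>(c, \<phi>s, xs)\<leftarrow>t'. c * (\<phi>s ! 0) x * (\<phi>s ! 1) y) = chain (Suc r) x y" for x y
  proof -
    have "(\<Sum>(c, \<phi>s, xs)\<leftarrow>t'. c * (\<phi>s ! 0) x * (\<phi>s ! 1) y) = (\<Sum>s\<leftarrow>t. \<Sum>(c, \<phi>s, xs)\<leftarrow>F s. c * (\<phi>s ! 0) x * (\<phi>s ! 1) y)"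
      by (simp add: t'F sum_list_concat_map)
    also have "... = (\<Sum>s\<leftarrow>t. \<Sum>p\<leftarrow>\<Delta> ell. case s of (c, \<phi>s, xs) \<Rightarrow> c * (\<phi>s ! 0) (fst p * x) * (\<phi>s ! 1) (y * snd p))"
    proof (rule arg_cong[where f = sum_list], rule map_cong[OF refl])
      fix s assume "s \<in> set t"
      then obtain c \<phi> \<psi> where s: "s = (c, [\<phi>, \<psi>], replicate (Suc q) ell)" and f: "lfun \<phi>" "lfun \<psi>" using shape by blast
      have "(\<Sum>(c, \<phi>s, xs)\<leftarrow>F s. c * (\<phi>s ! 0) x * (\<phi>s ! 1) y)
        = (\<Sum>p\<leftarrow>\<Delta> ell. \<Sum>p1\<leftarrow>dual_comult scale \<phi>. \<Sum>p2\<leftarrow>dual_comult scale \<psi>. c * fst p1 (fst p) * snd p2 (snd p) * snd p1 x * fst p2 y)"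
        unfolding s Fs by (simp add: sum_list_concat_map comp_def case_prod_unfold)
      also have "... = (\<Sum>p\<leftarrow>\<Delta> ell. c * (\<Sum>(\<alpha>, \<beta>)\<leftarrow>dual_comult scale \<phi>. \<alpha> (fst p) * \<beta> x) * (\<Sum>(\<gamma>, \<delta>)\<leftarrow>dual_comult scale \<psi>. \<gamma> y * \<delta> (snd p)))"
        by (simp add: case_prod_unfold mult_ac flip: sum_list_mult_left sum_list_mult)
      finally show "(\<Sum>(c, \<phi>s, xs)\<leftarrow>F s. c * (\<phi>s ! 0) x * (\<phi>s ! 1) y)
        = (\<Sum>p\<leftarrow>\<Delta> ell. case s of (c, \<phi>s, xs) \<Rightarrow> c * (\<phi>s ! 0) (fst p * x) * (\<phi>s ! 1) (y * snd p))"
        by (simp add: s dual_comult_sum f)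
    qed
    also have "... = (\<Sum>p\<leftarrow>\<Delta> ell. chain r (fst p * x) (y * snd p))"
      by (simp only: sum_list_swap_lists[where xs = t] val)
    finally show ?thesis by (simp add: case_prod_unfold)
  qed
  ultimately show ?case by blast
qed

lemma basic_invariantI: "obt 0 0 t \<Longrightarrow> r = (\<Sum>(c, _, _)\<leftarrow>t. c) \<Longrightarrow> basic_invariant scale \<Delta> \<epsilon> r"
  unfolding basic_invariant_def using integral_ell integral_on_lam by blast

text \<open>
  The last step evaluates both functionals on the two legs of one more copy of \<open>ell\<close>, which
  contracts the whole tensor to a scalar.
\<close>

lemma chain_one_basic_invariant: "basic_invariant scale \<Delta> \<epsilon> (chain (Suc r) 1 1)"
proof -
  obtain t where t: "obt 2 1 t"
    and shape: "\<And>s. s \<in> set t \<Longrightarrow> \<exists>c \<phi> \<psi>. s = (c, [\<phi>, \<psi>], replicate 1 ell) \<and> lfun \<phi> \<and> lfun \<psi>"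
    and val: "\<And>x y. (\<Sum>(c, \<phi>s, xs)\<leftarrow>t. c * (\<phi>s ! 0) x * (\<phi>s ! 1) y) = chain r x y"
    using chain_obtainable[of 1 r] by blast
  define t' where "t' = map (pair_at 0 0) (map (pair_at 0 0) (concat (map (comult_at \<Delta> 0) t)))"
  have "obt (Suc 1) (Suc 1) (concat (map (comult_at \<Delta> 0) t))"
    using obtainable.comult[OF t, of 0] by (simp add: numeral_2_eq_2)
  then have "obt 1 1 (map (pair_at 0 0) (concat (map (comult_at \<Delta> 0) t)))"
    by (rule obtainable.pair) simp_all
  then have "obt 0 0 t'" unfolding t'_def One_nat_def by (rule obtainable.pair) simp_all
  moreover have "chain (Suc r) 1 1 = (\<Sum>(c, _, _)\<leftarrow>t'. c)"
  proof -
    have "(\<Sum>(c, _, _)\<leftarrow>t'. c) = (\<Sum>s\<leftarrow>t. \<Sum>(c, _, _)\<leftarrow>map (pair_at 0 0) (map (pair_at 0 0) (comult_at \<Delta> 0 s)). c)"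
      unfolding t'_def by (induction t) (simp_all add: comp_def)
    also have "... = (\<Sum>s\<leftarrow>t. \<Sum>p\<leftarrow>\<Delta> ell. case s of (c, \<phi>s, xs) \<Rightarrow> c * (\<phi>s ! 0) (fst p) * (\<phi>s ! 1) (snd p))"
    proof (rule arg_cong[where f = sum_list], rule map_cong[OF refl])
      fix s assume "s \<in> set t"
      then obtain c \<phi> \<psi> where s: "s = (c, [\<phi>, \<psi>], replicate 1 ell)" using shape by blast
      show "(\<Sum>(c, _, _)\<leftarrow>map (pair_at 0 0) (map (pair_at 0 0) (comult_at \<Delta> 0 s)). c)
        = (\<Sum>p\<leftarrow>\<Delta> ell. case s of (c, \<phi>s, xs) \<Rightarrow> c * (\<phi>s ! 0) (fst p) * (\<phi>s ! 1) (snd p))"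
        by (simp add: s comp_def case_prod_unfold)
    qed
    also have "... = (\<Sum>p\<leftarrow>\<Delta> ell. chain r (fst p) (snd p))"
      by (simp only: sum_list_swap_lists[where xs = t] val)
    finally show ?thesis by (simp add: case_prod_unfold)
  qed
  ultimately show ?thesis by (rule basic_invariantI)
qed

text \<open>
  The mirror image of \<open>chain_obtainable\<close>: now one copy of \<open>lam\<close> and the two elements are split, and
  the pieces \<open>\<alpha>\<close>, \<open>\<beta>\<close> of \<open>lam\<close> are paired with the first piece of the first element and the last piece
  of the second one.
\<close>

lemma dual_chain_obtainable:
  "\<exists>t. obt q 2 t \<and> (\<forall>s\<in>set t. \<exists>c x y. s = (c, replicate q lam, [x, y])) \<and>
     (\<forall>f g. lfun f \<longrightarrow> lfun g \<longrightarrow> (\<Sum>(c, \<phi>s, xs)\<leftarrow>t. c * f (xs ! 0) * g (xs ! 1)) = dual_chain r f g)"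
proof (induction r arbitrary: q)
  case 0
  show ?case
    by (rule exI[of _ "[(1, replicate q lam, replicate 2 ell)]"], intro conjI, rule obtainable.start)
      (auto simp: numeral_2_eq_2)
next
  case (Suc r)
  obtain t where t: "obt (Suc q) 2 t"
    and shape: "\<And>s. s \<in> set t \<Longrightarrow> \<exists>c x y. s = (c, replicate (Suc q) lam, [x, y])"
    and val: "\<And>f g. lfun f \<Longrightarrow> lfun g \<Longrightarrow> (\<Sum>(c, \<phi>s, xs)\<leftarrow>t. c * f (xs ! 0) * g (xs ! 1)) = dual_chain r f g"
    using Suc[of "Suc q"] by blast
  define F where "F s = map (pair_at 0 2) (map (pair_at 0 0) (concat (map (comult_at \<Delta> 2)
      (concat (map (comult_at \<Delta> 0) (dual_comult_at scale 0 s))))))" for s :: "('k, 'h) summand"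
  let ?t1 = "concat (map (dual_comult_at scale 0) t)"
  let ?t2 = "concat (map (comult_at \<Delta> 0) ?t1)"
  let ?t3 = "concat (map (comult_at \<Delta> 2) ?t2)"
  define t' where "t' = map (pair_at 0 2) (map (pair_at 0 0) ?t3)"
  have t'F: "t' = concat (map F t)"
    unfolding t'_def F_def by (induction t) simp_all
  have "obt (Suc (Suc q)) 2 ?t1"
    by (rule obtainable.dual_comult[OF t]) simp
  then have "obt (Suc (Suc q)) (Suc 2) ?t2"
    by (rule obtainable.comult) simp
  then have "obt (Suc (Suc q)) (Suc (Suc 2)) ?t3"
    by (rule obtainable.comult) simp
  then have "obt (Suc q) (Suc 2) (map (pair_at 0 0) ?t3)"
    by (rule obtainable.pair) simp_all
  then have "obt q 2 t'" unfolding t'_def by (rule obtainable.pair) simp_all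
  moreover have Fs: "F (c, replicate (Suc q) lam, [x, y]) = concat (map (\<lambda>(\<alpha>, \<beta>). concat (map (\<lambda>(x1, x2). 
      map (\<lambda>(y1, y2). (c * \<alpha> x1 * \<beta> y2, replicate q lam, [x2, y1])) (\<Delta> y)) (\<Delta> x))) (dual_comult scale lam))" for c x y
    by (simp add: F_def map_concat comp_def case_prod_unfold concat_concat)
  have "\<exists>c x y. s = (c, replicate q lam, [x, y])" if st: "s \<in> set t'" for s
  proof -
    obtain s' where s': "s' \<in> set t" "s \<in> set (F s')" using st unfolding t'F set_concat set_map by blast
    obtain c x y where e: "s' = (c, replicate (Suc q) lam, [x, y])" using shape[OF s'(1)] by blast
    have "s \<in> set (F (c, replicate (Suc q) lam, [x, y]))" using s'(2) unfolding e .
    then show ?thesis unfolding Fs by auto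
  qed
  moreover have "(\<Sum>(c, \<phi>s, xs)\<leftarrow>t'. c * f (xs ! 0) * g (xs ! 1)) = dual_chain (Suc r) f g" if f: "lfun f" and g: "lfun g" for f g
  proof -
    have "(\<Sum>(c, \<phi>s, xs)\<leftarrow>t'. c * f (xs ! 0) * g (xs ! 1)) = (\<Sum>s\<leftarrow>t. \<Sum>(c, \<phi>s, xs)\<leftarrow>F s. c * f (xs ! 0) * g (xs ! 1))"
      by (simp add: t'F sum_list_concat_map)
    also have "... = (\<Sum>s\<leftarrow>t. \<Sum>p\<leftarrow>dual_comult scale lam. case s of (c, \<phi>s, xs) \<Rightarrow> c * conv \<Delta> (fst p) f (xs ! 0) * conv \<Delta> g (snd p) (xs ! 1))"
    proof (rule arg_cong[where f = sum_list], rule map_cong[OF refl])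
      fix s assume "s \<in> set t"
      then obtain c x y where s: "s = (c, replicate (Suc q) lam, [x, y])" using shape by blast
      have "(\<Sum>(c, \<phi>s, xs)\<leftarrow>F s. c * f (xs ! 0) * g (xs ! 1))
        = (\<Sum>p\<leftarrow>dual_comult scale lam. \<Sum>p1\<leftarrow>\<Delta> x. \<Sum>p2\<leftarrow>\<Delta> y. c * fst p (fst p1) * snd p (snd p2) * f (snd p1) * g (fst p2))"
        unfolding s Fs by (simp add: sum_list_concat_map comp_def case_prod_unfold)
      also have "... = (\<Sum>p\<leftarrow>dual_comult scale lam. c * (\<Sum>(x1, x2)\<leftarrow>\<Delta> x. fst p x1 * f x2) * (\<Sum>(y1, y2)\<leftarrow>\<Delta> y. g y1 * snd p y2))"
        by (simp add: case_prod_unfold mult_ac flip: sum_list_mult_left sum_list_mult)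
      finally show "(\<Sum>(c, \<phi>s, xs)\<leftarrow>F s. c * f (xs ! 0) * g (xs ! 1))
        = (\<Sum>p\<leftarrow>dual_comult scale lam. case s of (c, \<phi>s, xs) \<Rightarrow> c * conv \<Delta> (fst p) f (xs ! 0) * conv \<Delta> g (snd p) (xs ! 1))"
        by (simp add: s conv_def)
    qed
    also have "... = (\<Sum>p\<leftarrow>dual_comult scale lam. dual_chain r (conv \<Delta> (fst p) f) (conv \<Delta> g (snd p)))"
      unfolding sum_list_swap_lists[where xs = t]
      by (rule arg_cong[where f = sum_list], rule map_cong[OF refl], rule val; rule lfun_conv)
        (use f g dual_comult_lfun[OF lfun_lam] in \<open>force simp: prod_eq_iff\<close>)+
    finally show ?thesis by (simp add: case_prod_unfold)
  qed
  ultimately show ?case by blast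
qed

lemma dual_chain_basic_invariant:
  "basic_invariant scale \<Delta> \<epsilon> (\<Sum>(\<alpha>, \<beta>)\<leftarrow>dual_comult scale lam. dual_chain r \<alpha> \<beta>)"
proof -
  obtain t where t: "obt 1 2 t"
    and shape: "\<And>s. s \<in> set t \<Longrightarrow> \<exists>c x y. s = (c, replicate 1 lam, [x, y])"
    and val: "\<And>f g. lfun f \<Longrightarrow> lfun g \<Longrightarrow> (\<Sum>(c, \<phi>s, xs)\<leftarrow>t. c * f (xs ! 0) * g (xs ! 1)) = dual_chain r f g"
    using dual_chain_obtainable[of 1 r] by blast
  define t' where "t' = map (pair_at 0 0) (map (pair_at 0 0) (concat (map (dual_comult_at scale 0) t)))"
  have "obt (Suc 1) (Suc 1) (concat (map (dual_comult_at scale 0) t))"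
    using obtainable.dual_comult[OF t, of 0] by (simp add: numeral_2_eq_2)
  then have "obt 1 1 (map (pair_at 0 0) (concat (map (dual_comult_at scale 0) t)))"
    by (rule obtainable.pair) simp_all
  then have "obt 0 0 t'" unfolding t'_def One_nat_def by (rule obtainable.pair) simp_all
  moreover have "(\<Sum>(\<alpha>, \<beta>)\<leftarrow>dual_comult scale lam. dual_chain r \<alpha> \<beta>) = (\<Sum>(c, _, _)\<leftarrow>t'. c)"
  proof -
    have "(\<Sum>(c, _, _)\<leftarrow>t'. c) = (\<Sum>s\<leftarrow>t. \<Sum>(c, _, _)\<leftarrow>map (pair_at 0 0) (map (pair_at 0 0) (dual_comult_at scale 0 s)). c)"
      unfolding t'_def by (induction t) (simp_all add: comp_def)
    also have "... = (\<Sum>s\<leftarrow>t. \<Sum>p\<leftarrow>dual_comult scale lam. case s of (c, \<phi>s, xs) \<Rightarrow> c * fst p (xs ! 0) * snd p (xs ! 1))"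
    proof (rule arg_cong[where f = sum_list], rule map_cong[OF refl])
      fix s assume "s \<in> set t"
      then obtain c x y where s: "s = (c, replicate 1 lam, [x, y])" using shape by blast
      show "(\<Sum>(c, _, _)\<leftarrow>map (pair_at 0 0) (map (pair_at 0 0) (dual_comult_at scale 0 s)). c)
        = (\<Sum>p\<leftarrow>dual_comult scale lam. case s of (c, \<phi>s, xs) \<Rightarrow> c * fst p (xs ! 0) * snd p (xs ! 1))"
        by (simp add: s comp_def case_prod_unfold)
    qed
    also have "... = (\<Sum>p\<leftarrow>dual_comult scale lam. dual_chain r (fst p) (snd p))"
      unfolding sum_list_swap_lists[where xs = t]
      by (rule arg_cong[where f = sum_list], rule map_cong[OF refl], rule val)
        (use dual_comult_lfun[OF lfun_lam] in \<open>force simp: prod_eq_iff\<close>)+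
    finally show ?thesis by (simp add: case_prod_unfold)
  qed
  ultimately show ?thesis by (rule basic_invariantI)
qed

section \<open>Irreducible representations of \<open>H\<close>\<close>

definition casimir :: "('h \<times> 'h) list" where "casimir = map (\<lambda>(a, b). (a, S b)) (\<Delta> ell)"

lemma lam_S: "lam (S x) = lam x" by (simp add: lam_antipode v_eq_one)
lemma lam_comm: "lam (x * y) = lam (y * x)" by (simp add: lam_eq_regular_character A.\<tau>_comm)

text \<open>
  This says that \<open>\<Lambda>\<^sub>1 \<otimes> S(\<Lambda>\<^sub>2)\<close> is the Casimir tensor of the form \<open>lam\<close>.
\<close>

lemma reproducing: assumes f: "lfun f" shows "sw \<Lambda> (\<lambda>p q. f p * lam (S q * x)) = f x"
proof -
  have "lam (q * S x) = lam (S q * x)" for q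
    using lam_S[of "q * S x"] by (simp add: antipode_mult antipode_involution lam_comm[of x])
  then show ?thesis using inverse_antipode_formula[OF f, of x] by simp
qed

lemma casimir_property: "(\<Sum>(a, b)\<leftarrow>casimir. scale (A.\<tau> (b * x)) a) = scale n x"
proof (rule lfun_sep)
  fix f assume f: "lfun f"
  have b: "bil (\<lambda>a b. f a * lam (S b * x))" by (rule bil_prod[OF f lfun_S[OF lfun_mult_right[OF lfun_lam]]])
  have "f (\<Sum>(a, b)\<leftarrow>casimir. scale (A.\<tau> (b * x)) a) = (\<Sum>(a, b)\<leftarrow>\<Delta> ell. f a * lam (S b * x))"
    by (simp add: casimir_def lfun_sum_list[OF f] lfun_scale[OF f] case_prod_unfold comp_def lam_eq_regular_character mult.commute)
  also have "... = f (scale n x)" by (simp add: sw_list[OF b] sw_ell reproducing[OF f] lfun_scale[OF f])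
  finally show "f (\<Sum>(a, b)\<leftarrow>casimir. scale (A.\<tau> (b * x)) a) = f (scale n x)" .
qed

lemma casimir_iter_chain: "A.casimir_iter casimir r x (S y) = chain r x y"
proof (induction r arbitrary: x y)
  case 0
  then show ?case by (simp add: lam_S flip: lam_eq_regular_character)
next
  case (Suc r)
  then show ?case by (simp add: casimir_def case_prod_unfold comp_def flip: antipode_mult)
qed

theorem irreducible_dim_dvd:
  fixes sv :: "'k \<Rightarrow> 'v::ab_group_add \<Rightarrow> 'v"
  assumes int: "\<And>r. basic_invariant scale \<Delta> \<epsilon> r \<Longrightarrow> algebraic_int r"
    and irr: "irreducible_representation UNIV scale (*) 1 sv \<rho>"
  shows "vector_space.dim sv UNIV dvd vector_space.dim scale UNIV"
proof -
  have "algebraic_int (A.casimir_iter casimir (Suc r) 1 1)" for r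
    using int[OF chain_one_basic_invariant[of r]] casimir_iter_chain[of "Suc r" 1 1] by (simp only: antipode_one)
  then show ?thesis
    using A.irreducible_dim_dvd[OF irr casimir_property _ card_Basis_pos] by (simp add: dim_UNIV)
qed

section \<open>Irreducible representations of the dual\<close>

text \<open>
  Sending each basis vector to the corresponding coordinate functional identifies \<open>H\<close> with its
  dual as a vector space.  \<open>fn\<close> and \<open>vec\<close> are the two directions; \<open>dmult\<close> is the multiplication of the
  dual transported along them.
\<close>

definition fn :: "'h \<Rightarrow> 'h \<Rightarrow> 'k" where "fn x y = (\<Sum>b\<in>Basis. coord b x * coord b y)"
definition vec :: "('h \<Rightarrow> 'k) \<Rightarrow> 'h" where "vec f = (\<Sum>b\<in>Basis. scale (f b) b)"

lemma lfun_fn: "lfun (fn x)"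
  by (rule lfunI) (simp_all add: fn_def coord_add coord_scale sum.distrib sum_distrib_left algebra_simps)

lemma fn_basis: "b \<in> Basis \<Longrightarrow> fn x b = coord b x" "b \<in> Basis \<Longrightarrow> fn b = coord b"
  using finite_Basis by (auto simp: fn_def coord_basis fun_eq_iff if_distrib if_distribR cong: if_cong)

lemma coord_vec: "b \<in> Basis \<Longrightarrow> coord b (vec f) = f b"
  using finite_Basis by (simp add: vec_def coord_sum coord_scale coord_basis if_distrib cong: if_cong)

lemma fn_vec: assumes "lfun f" shows "fn (vec f) = f"
  by (rule lfun_eqI[OF lfun_fn assms]) (simp add: fn_basis coord_vec)

lemma vec_fn: "vec (fn x) = x"
  using expand[of x] by (simp add: vec_def fn_basis cong: sum.cong)

lemma fn_add: "fn (x + y) = fn x + fn y" and fn_scale: "fn (scale c x) = dual_scale c (fn x)"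
  by (auto simp: fun_eq_iff fn_def coord_add coord_scale sum.distrib sum_distrib_left dual_scale_def algebra_simps)

lemma fn_inj: "fn x = fn y \<Longrightarrow> x = y" by (metis vec_fn)

definition dmult :: "'h \<Rightarrow> 'h \<Rightarrow> 'h" where "dmult x y = vec (conv \<Delta> (fn x) (fn y))"

lemma fn_dmult: "fn (dmult x y) = conv \<Delta> (fn x) (fn y)"
  unfolding dmult_def by (rule fn_vec[OF lfun_conv[OF lfun_fn lfun_fn]])

lemma fn_dmult': "fn (dmult x y) z = sw z (\<lambda>a b. fn x a * fn y b)"
  by (simp add: fn_dmult conv_eq lfun_fn)

lemma trace_formula: assumes Q: "lmap Q" shows "trace Q = sw \<Lambda> (\<lambda>p q. lam (S q * Q p))"
proof -
  have I: "a = (\<Sum>p\<in>Basis \<times> Basis. scale (cf (fst p) (snd p) \<Lambda> * lam (S (snd p) * a)) (fst p))" for a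
  proof (rule lfun_sep)
    fix f assume f: "lfun f"
    show "f a = f (\<Sum>p\<in>Basis \<times> Basis. scale (cf (fst p) (snd p) \<Lambda> * lam (S (snd p) * a)) (fst p))"
      using reproducing[OF f, of a] by (simp add: sw_pairs lfun_sum[OF f] lfun_scale[OF f] mult_ac)
  qed
  have l: "lfun (\<lambda>a. cf (fst p) (snd p) \<Lambda> * lam (S (snd p) * a))" for p
    by (rule lfunI) (simp_all add: lam_simps distrib_left scale_mult_right mult.left_commute)
  show ?thesis
    using trace_dual_system[OF Q, of "Basis \<times> Basis" "\<lambda>p a. cf (fst p) (snd p) \<Lambda> * lam (S (snd p) * a)" fst, OF l I]
    by (simp add: sw_pairs)
qed

text \<open>
  Left multiplication by \<open>f\<close> on the dual is the transpose of \<open>y \<mapsto> f(y\<^sub>1) y\<^sub>2\<close>, whose trace is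
  \<open>f(\<Lambda>\<^sub>1) \<lambda>(S(\<Lambda>\<^sub>3) \<Lambda>\<^sub>2) = f(\<Lambda>\<^sub>1) \<lambda>(S(\<Lambda>\<^sub>2) \<Lambda>\<^sub>3) = f(\<Lambda>) \<lambda>(1)\<close>.  So \<open>ell\<close> is the regular character of the
  dual.
\<close>

lemma dual_trace: "trace (\<lambda>z. dmult x z) = fn x ell"
proof -
  define E where "E y = swv y (\<lambda>p q. scale (fn x p) q)" for y
  have E: "f (E y) = sw y (\<lambda>p q. fn x p * f q)" if "lfun f" for f y
    by (simp add: E_def lfun_swv[OF that] lfun_scale[OF that])
  have lE: "lmap E" unfolding E_def by (rule lmap_swv)
  note l = lfun_simps[OF lfun_fn] lam_simps
  have t: "tril (\<lambda>a b q. fn x a * lam (S q * b))" by (rule trilI; simp add: lin_simps l)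
  have "trace (\<lambda>z. dmult x z) = (\<Sum>b\<in>Basis. conv \<Delta> (fn x) (fn b) b)"
    unfolding trace_def dmult_def by (rule sum.cong) (simp_all add: coord_vec)
  also have "... = trace E"
    unfolding trace_def by (rule sum.cong) (simp_all add: conv_eq lfun_fn lfun_coord E[OF lfun_coord] fn_basis)
  also have "... = sw \<Lambda> (\<lambda>p q. sw p (\<lambda>a b. fn x a * lam (S q * b)))"
    by (simp add: trace_formula[OF lE] E[OF lfun_mult_left[OF lfun_lam]])
  also have "... = sw \<Lambda> (\<lambda>a r. sw r (\<lambda>b q. fn x a * lam (S q * b)))" by (rule sw_coassoc[OF t])
  also have "... = sw \<Lambda> (\<lambda>a r. n * (\<epsilon> r * fn x a))"
  proof (intro sw_cong)
    fix a r
    have "lam (S q * b) = lam (S b * q)" for q b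
      using lam_S[of "S q * b"] by (simp add: antipode_mult antipode_involution)
    then show "sw r (\<lambda>b q. fn x a * lam (S q * b)) = n * (\<epsilon> r * fn x a)"
      using sw_antipode_left[OF lfun_lam, of r] by (simp add: lam_one flip: sw_push_left)
  qed
  also have "... = fn x ell"
    by (simp add: sw_counit_right[OF lfun_fn] ell_def lfun_scale[OF lfun_fn] flip: sw_push_left)
  finally show ?thesis .
qed

sublocale D: trace_form_algebra scale Basis dmult "vec \<epsilon>"
proof
  fix x y z c
  note l = lfun_simps[OF lfun_fn]
  show "dmult (x + y) z = dmult x z + dmult y z" "dmult x (y + z) = dmult x y + dmult x z"
    by (rule fn_inj, rule ext, simp add: fn_dmult' fn_add algebra_simps sw_plus)+
  show "dmult (scale c x) y = scale c (dmult x y)" "dmult x (scale c y) = scale c (dmult x y)"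
    by (rule fn_inj, rule ext, simp add: fn_dmult' fn_scale dual_scale_def sw_push_left mult_ac)+
  show "dmult (dmult x y) z = dmult x (dmult y z)"
  proof (rule fn_inj, rule ext)
    fix h
    have t: "tril (\<lambda>a b c. fn x a * (fn y b * fn z c))" by (rule trilI; simp add: lin_simps l)
    show "fn (dmult (dmult x y) z) h = fn (dmult x (dmult y z)) h"
      using sw_coassoc[OF t, of h] by (simp add: fn_dmult' sw_push_left sw_push_right mult.assoc)
  qed
  show "dmult (vec \<epsilon>) x = x"
    by (rule fn_inj, rule ext) (simp add: fn_dmult' fn_vec[OF lfun_\<epsilon>] sw_counit_left[OF lfun_fn])
  show "dmult x (vec \<epsilon>) = x"
    by (rule fn_inj, rule ext) (simp add: fn_dmult' fn_vec[OF lfun_\<epsilon>] mult.commute[of "fn x _"] sw_counit_right[OF lfun_fn])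
  show "x = 0" if "\<And>y. trace (\<lambda>z. dmult (dmult y x) z) = 0"
  proof -
    have "fn x h = 0" for h
    proof (rule integral_separates_right[OF lfun_fn])
      fix g assume g: "lfun g"
      have "n * sw \<Lambda> (\<lambda>p q. g p * fn x q) = 0"
        using that[of "vec g"] by (simp add: dual_trace fn_dmult' fn_vec[OF g] sw_ell)
      then show "sw \<Lambda> (\<lambda>p q. g p * fn x q) = 0" using card_Basis_pos by simp
    qed
    then have "fn x = fn 0" by (simp add: fun_eq_iff lfun_0 fn_def)
    then show ?thesis by (rule fn_inj)
  qed
qed

lemma D_\<tau>: "D.\<tau> x = fn x ell" by (simp add: D.\<tau>_def dual_trace)

definition dual_casimir :: "('h \<times> 'h) list" where
  "dual_casimir = map (\<lambda>(\<alpha>, \<beta>). (vec \<alpha>, vec (\<lambda>x. \<beta> (S x)))) (dual_comult scale lam)"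

text \<open>
  The dual of \<open>reproducing\<close>: the formula for the antipode, read with \<open>S(\<Lambda>) = \<Lambda>\<close>.
\<close>

lemma dual_reproducing: assumes f: "lfun f" shows "sw \<Lambda> (\<lambda>p q. lam (y * S p) * f q) = f y"
proof -
  have b: "bil (\<lambda>p q. f (S p) * lam (y * q))" by (rule bil_prod[OF lfun_S[OF f] lfun_mult_left[OF lfun_lam]])
  have "f y = sw \<Lambda> (\<lambda>p q. f (S p) * lam (y * q))"
    using antipode_formula[OF lfun_S[OF f], of y] by (simp add: antipode_involution)
  also have "... = sw (S \<Lambda>) (\<lambda>p q. f (S p) * lam (y * q))" by (simp add: antipode_\<Lambda>)
  also have "... = sw \<Lambda> (\<lambda>p q. lam (y * S p) * f q)"
    by (simp add: antipode_comult[OF b] antipode_involution mult.commute)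
  finally show ?thesis by simp
qed

lemma dual_casimir_property: "(\<Sum>(a, b)\<leftarrow>dual_casimir. scale (D.\<tau> (dmult b x)) a) = scale n x"
proof (rule fn_inj, rule ext)
  fix y
  have fl: "fn (\<Sum>i\<leftarrow>I. g i) y = (\<Sum>i\<leftarrow>I. fn (g i) y)" for I :: "(('h \<Rightarrow> 'k) \<times> ('h \<Rightarrow> 'k)) list" and g
    by (induction I) (simp_all add: fn_add, simp add: fn_def)
  have "fn (\<Sum>(a, b)\<leftarrow>dual_casimir. scale (D.\<tau> (dmult b x)) a) y
    = (\<Sum>(\<alpha>, \<beta>)\<leftarrow>dual_comult scale lam. n * sw \<Lambda> (\<lambda>p q. \<alpha> y * \<beta> (S p) * fn x q))"
    unfolding dual_casimir_def map_map fl
  proof (rule arg_cong[where f = sum_list], rule map_cong[OF refl])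
    fix p assume p: "p \<in> set (dual_comult scale lam)"
    obtain \<alpha> \<beta> where ab: "p = (\<alpha>, \<beta>)" by (cases p)
    then have l: "lfun \<alpha>" "lfun \<beta>" using dual_comult_lfun[OF lfun_lam] p by blast+
    show "fn (((\<lambda>(a, b). scale (D.\<tau> (dmult b x)) a) \<circ> (\<lambda>(\<alpha>, \<beta>). (vec \<alpha>, vec (\<lambda>x. \<beta> (S x))))) p) y
      = (case p of (\<alpha>, \<beta>) \<Rightarrow> n * sw \<Lambda> (\<lambda>p q. \<alpha> y * \<beta> (S p) * fn x q))"
      by (simp add: ab D_\<tau> fn_scale fn_dmult' fn_vec l lfun_S dual_scale_def sw_ell sw_push_left sw_push_right mult_ac)
  qed
  also have "... = n * sw \<Lambda> (\<lambda>p q. (\<Sum>(\<alpha>, \<beta>)\<leftarrow>dual_comult scale lam. \<alpha> y * \<beta> (S p)) * fn x q)"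
  proof -
    have "(\<Sum>p\<leftarrow>I. sw \<Lambda> (G p)) = sw \<Lambda> (\<lambda>a b. \<Sum>p\<leftarrow>I. G p a b)" for I :: "(('h \<Rightarrow> 'k) \<times> ('h \<Rightarrow> 'k)) list" and G
      by (induction I) (simp_all add: sw_plus, simp add: sw_def)
    then show ?thesis by (simp add: case_prod_unfold sum_list_mult_left flip: sum_list_mult)
  qed
  also have "... = fn (scale n x) y"
    by (simp add: dual_comult_sum[OF lfun_lam] dual_reproducing[OF lfun_fn] fn_scale dual_scale_def)
  finally show "fn (\<Sum>(a, b)\<leftarrow>dual_casimir. scale (D.\<tau> (dmult b x)) a) y = fn (scale n x) y" .
qed

lemma dmult_vec: "lfun f \<Longrightarrow> lfun g \<Longrightarrow> dmult (vec f) (vec g) = vec (conv \<Delta> f g)"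
  by (simp add: dmult_def fn_vec)

lemma conv_antipode: assumes f: "lfun f" and g: "lfun g"
  shows "conv \<Delta> (\<lambda>x. f (S x)) (\<lambda>x. g (S x)) = (\<lambda>x. conv \<Delta> g f (S x))"
  by (rule ext) (simp add: conv_eq f g lfun_S antipode_comult[OF bil_prod[OF g f]], simp add: mult.commute)

text \<open>
  As for \<open>H\<close>, composing the second argument with the antipode reverses the order of its factors.
\<close>

lemma dual_casimir_iter_chain:
  "lfun f \<Longrightarrow> lfun g \<Longrightarrow> D.casimir_iter dual_casimir r (vec f) (vec (\<lambda>x. g (S x))) = dual_chain r f g"
proof (induction r arbitrary: f g)
  case 0
  then show ?case by (simp add: D_\<tau> fn_vec lfun_S) (simp add: ell_def lmap_scale[OF lmap_S] antipode_\<Lambda>)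
next
  case (Suc r)
  show ?case
    unfolding D.casimir_iter.simps dual_chain.simps dual_casimir_def map_map
  proof (rule arg_cong[where f = sum_list], rule map_cong[OF refl])
    fix p assume p: "p \<in> set (dual_comult scale lam)"
    obtain \<alpha> \<beta> where ab: "p = (\<alpha>, \<beta>)" by (cases p)
    then have l: "lfun \<alpha>" "lfun \<beta>" using dual_comult_lfun[OF lfun_lam] p by blast+
    have "D.casimir_iter dual_casimir r (dmult (vec \<alpha>) (vec f)) (dmult (vec (\<lambda>x. \<beta> (S x))) (vec (\<lambda>x. g (S x))))
      = dual_chain r (conv \<Delta> \<alpha> f) (conv \<Delta> g \<beta>)"
      by (simp add: dmult_vec l Suc lfun_S conv_antipode lfun_conv)
    then show "((\<lambda>(a, b). D.casimir_iter (map (\<lambda>(\<alpha>, \<beta>). (vec \<alpha>, vec (\<lambda>x. \<beta> (S x)))) (dual_comult scale lam)) r (dmult a (vec f)) (dmult b (vec (\<lambda>x. g (S x))))) \<circ> (\<lambda>(\<alpha>, \<beta>). (vec \<alpha>, vec (\<lambda>x. \<beta> (S x))))) p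
      = (case p of (\<alpha>, \<beta>) \<Rightarrow> dual_chain r (conv \<Delta> \<alpha> f) (conv \<Delta> g \<beta>))"
      by (simp add: ab dual_casimir_def)
  qed
qed

theorem dual_irreducible_dim_dvd:
  fixes sw' :: "'k \<Rightarrow> 'w::ab_group_add \<Rightarrow> 'w"
  assumes int: "\<And>r. basic_invariant scale \<Delta> \<epsilon> r \<Longrightarrow> algebraic_int r"
    and irr: "irreducible_representation (dual_space scale) dual_scale (conv \<Delta>) \<epsilon> sw' \<rho>"
  shows "vector_space.dim sw' UNIV dvd vector_space.dim scale UNIV"
proof -
  have "algebraic_int (D.casimir_iter dual_casimir (Suc r) (vec \<epsilon>) (vec \<epsilon>))" for r
  proof -
    have "D.casimir_iter dual_casimir (Suc r) (vec \<epsilon>) (vec \<epsilon>) = dual_chain (Suc r) \<epsilon> \<epsilon>"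
      using dual_casimir_iter_chain[OF lfun_\<epsilon> lfun_\<epsilon>, of "Suc r"] by (simp only: counit_antipode)
    also have "... = (\<Sum>(\<alpha>, \<beta>)\<leftarrow>dual_comult scale lam. dual_chain r \<alpha> \<beta>)"
      unfolding dual_chain.simps
    proof (rule arg_cong[where f = sum_list], rule map_cong[OF refl])
      fix p assume p: "p \<in> set (dual_comult scale lam)"
      obtain \<alpha> \<beta> where ab: "p = (\<alpha>, \<beta>)" by (cases p)
      then have l: "lfun \<alpha>" "lfun \<beta>" using dual_comult_lfun[OF lfun_lam] p by blast+
      have "conv \<Delta> \<alpha> \<epsilon> = \<alpha>" "conv \<Delta> \<epsilon> \<beta> = \<beta>"
        by (rule ext; simp add: conv_eq l lfun_\<epsilon> sw_counit_left mult.commute[of "\<alpha> _"] sw_counit_right)+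
      then show "(case p of (\<alpha>, \<beta>) \<Rightarrow> dual_chain r (conv \<Delta> \<alpha> \<epsilon>) (conv \<Delta> \<epsilon> \<beta>)) = (case p of (\<alpha>, \<beta>) \<Rightarrow> dual_chain r \<alpha> \<beta>)"
        by (simp add: ab)
    qed
    finally show ?thesis using int[OF dual_chain_basic_invariant[of r]] by simp
  qed
  moreover have "irreducible_representation UNIV scale dmult (vec \<epsilon>) sw' (\<lambda>x. \<rho> (fn x))"
  proof -
    have fd: "fn x \<in> dual_space scale" for x using lfun_fn by simp
    have sur: "\<exists>x. f = fn x" if "f \<in> dual_space scale" for f using fn_vec[of f] that by (metis mem_Collect_eq)
    have "representation_of UNIV scale dmult (vec \<epsilon>) sw' (\<lambda>x. \<rho> (fn x))"
      using irr fd unfolding irreducible_representation_def representation_of_def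
      by (simp add: fn_add fn_scale fn_dmult fn_vec[OF lfun_\<epsilon>] lfun_fn)
    moreover have "W = {0} \<or> W = UNIV" if W: "module.subspace sw' W" "\<forall>a\<in>UNIV. \<forall>w\<in>W. \<rho> (fn a) w \<in> W" for W
    proof -
      have "\<forall>a\<in>dual_space scale. \<forall>w\<in>W. \<rho> a w \<in> W" using W(2) sur by blast
      then show ?thesis using irr W(1) unfolding irreducible_representation_def by blast
    qed
    ultimately show ?thesis using irr unfolding irreducible_representation_def by blast
  qed
  ultimately show ?thesis
    using D.irreducible_dim_dvd[OF _ dual_casimir_property _ card_Basis_pos] by (simp add: dim_UNIV)
qed

end

lemma (in vector_space) finite_dim_basis:
  assumes "finite_dim scale" obtains Basis where "finite_dimensional_vector_space scale Basis"
proof -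
  obtain C where C: "finite C" "span C = UNIV" using assms by (auto simp: finite_dim_def)
  obtain B where B: "B \<subseteq> (UNIV :: 'b set)" "independent B" "UNIV \<subseteq> span B" by (rule basis_exists)
  have "finite B" using independent_span_bound[OF C(1) B(2)] C(2) by simp
  then have "finite_dimensional_vector_space scale B"
    using B by unfold_locales auto
  then show thesis by (rule that)
qed

theorem theorem1p9:
  fixes scale :: "'k::{alg_closed_field, field_char_0} \<Rightarrow> 'h::ring_1 \<Rightarrow> 'h"
    and \<Delta> :: "'h \<Rightarrow> ('h \<times> 'h) list"
    and \<epsilon> :: "'h \<Rightarrow> 'k"
    and S :: "'h \<Rightarrow> 'h"
  assumes "hopf_algebra scale \<Delta> \<epsilon> S"
    and "finite_dim scale"
    and "semisimple_algebra scale"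
    and "\<And>r. basic_invariant scale \<Delta> \<epsilon> r \<Longrightarrow> algebraic_int r"
  shows "(\<forall>(sv :: 'k \<Rightarrow> 'v::ab_group_add \<Rightarrow> 'v) (\<rho> :: 'h \<Rightarrow> 'v \<Rightarrow> 'v).
            irreducible_representation UNIV scale (*) 1 sv \<rho> \<longrightarrow>
            vector_space.dim sv UNIV dvd vector_space.dim scale UNIV) \<and>
         (\<forall>(sw :: 'k \<Rightarrow> 'w::ab_group_add \<Rightarrow> 'w) (\<rho> :: ('h \<Rightarrow> 'k) \<Rightarrow> 'w \<Rightarrow> 'w).
            irreducible_representation (dual_space scale) dual_scale (conv \<Delta>) \<epsilon> sw \<rho> \<longrightarrow>
            vector_space.dim sw UNIV dvd vector_space.dim scale UNIV)"
proof -
  interpret hopf_algebra scale \<Delta> \<epsilon> S by (rule assms(1))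
  obtain Basis where "finite_dimensional_vector_space scale Basis" by (rule finite_dim_basis[OF assms(2)])
  then interpret finite_dimensional_vector_space scale Basis .
  interpret fd_hopf scale \<Delta> \<epsilon> S Basis ..
  obtain \<Lambda> where "normalized_integral \<Lambda>" by (rule integral_exists[OF assms(3)])
  then interpret semisimple_hopf scale \<Delta> \<epsilon> S Basis \<Lambda>
    using assms(3) by unfold_locales
  show ?thesis
    using irreducible_dim_dvd[OF assms(4)] dual_irreducible_dim_dvd[OF assms(4)] by blast
qed

end
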